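(* Let $\Omega\subseteq\mathbb{R}^d$ be open, $p\in[1,\infty)$, $m\in\mathbb{N}$, $v\in\mathcal{C}^{m,*}(\Omega)\cap L^\infty(\Omega)$, and $s:\pi_m\to[0,\infty)$ an admissible map. Assume there is $C>0$ such that for all $n\ge1$, all $\sigma\in\pi_m^0$ and all $x\in M_n\setminus M_{2n}$, $|\partial^\sigma v(x)|\le Cn^{s(\sigma)-1}$. Then for every $f\in W^{m,p}_{s,v}(\Omega)$, each $\chi_nf$ belongs to $W^{m,p}(\Omega)$ and $\chi_nf\to f$ in $W^{m,p}_{s,v}(\Omega)$ as $n\to\infty$.
   Context: Throughout, $\Omega\subseteq\mathbb{R}^d$ is open, $\mathbb{N}=\{0,1,2,\dots\}$, $p\in[1,\infty)$, $K\Subset\Omega$ means $K$ compact in $\Omega$, $\pi_m=\{\alpha\in\mathbb{N}^d:|\alpha|\le m\}$, $\pi_m^0=\pi_m\setminus\{0\}$, $\beta\le\alpha$ componentwise. A weight is a locally integrable function positive a.e.; $E_p(\Omega)$ is the set of measurable $w$ with $|w|^p$ a weight. For measurable $u$, $L^p_u(\Omega)=\{f:fu\in L^p(\Omega)\}$ with norm $\|fu\|_{L^p}$; $L^p_{u,\mathrm{loc}}$: $fu\in L^p(K)$ for all $K\Subset\Omega$. $\mathcal{C}^{k,*}(\Omega)$: $v\in\mathcal{C}^k(\Omega)$ with $v\ne0$ a.e. Condition (H): for every $K\Subset\Omega$ there is $C>0$ with $|v|\le C|w|$ a.e. in $K$. Weak derivative $D^\alpha_v$ ($|\alpha|\ge1$,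 $w\in E_p(\Omega)$, $v\in\mathcal{C}^{|\alpha|,*}(\Omega)$ with (H) w.r.t. $w$): for $f\in L^1_{w,\mathrm{loc}}(\Omega)$, $D^\alpha_vf$ is the unique $g\in L^1_{v^{|\alpha|+1},\mathrm{loc}}(\Omega)$, if it exists, with $\int_\Omega f\,\partial^\alpha(v^{|\alpha|+1}\phi)\,dx=(-1)^{|\alpha|}\int_\Omega v^{|\alpha|+1}\phi\,g\,dx$ for all $\phi\in C_c^\infty(\Omega)$; $D^0_vf:=f$. $W^{m,p}_{V,v}(\Omega)$ for $V=\{w_\alpha\}_{\alpha\in\pi_m}\subset E_p(\Omega)$, $v\in\mathcal{C}^{m,*}(\Omega)$ with (H) w.r.t. $w_0$: all $f\in L^p_{w_0}(\Omega)$ with $D^\alpha_vf\in L^p_{w_\alpha}(\Omega)$ for $\alpha\in\pi_m^0$, norm $(\sum_{\alpha\in\pi_m}\|w_\alpha D^\alpha_vf\|_{L^p}^p)^{1/p}$. Admissible map: $s:\pi_m\to[0,\infty)$ with $s(\alpha)\le|\alpha|$ and $s(\alpha-\beta)+s(\beta)\le s(\alpha)$ for $\alpha\in\pi_m,\beta\le\alpha$. $W^{m,p}_{s,v}(\Omega):=W^{m,p}_{V,v}(\Omega)$ with $w_\alpha=|v|^{s(\alpha)+1}$. Cut-offs: fix $\eta\in\mathcal{C}^\infty(\mathbb{R})$ with $0\le\eta\le1$, $\eta\equiv1$ on $\mathbb{R}\setminus[-1,1]$, $\eta\equiv0$ on $[-\tfrac12,\tfrac12]$. For $n\ge1$, $\chi_n:=\eta(n\,v(\cdot))$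 and $M_n:=\{x\in\Omega:|v(x)|\le1/n\}$. *)

theory Defs
  imports "HOL-Analysis.Analysis"
begin

type_synonym 'n mindex = "'n \<Rightarrow> nat"

definition mi_abs :: "('n::finite) mindex \<Rightarrow> nat" where
  "mi_abs \<alpha> = (\<Sum>i\<in>UNIV. \<alpha> i)"

definition partial :: "'n::finite \<Rightarrow> (real^'n \<Rightarrow> real) \<Rightarrow> real^'n \<Rightarrow> real" where
  "partial i f = (\<lambda>x. frechet_derivative f (at x) (axis i 1))"

text \<open>Iterated partial derivative; fuel k = |alpha|. The order in which the
  coordinate derivatives are taken is fixed by choice; it is irrelevant for
  C^m functions (Schwarz).\<close>
primrec mderiv_aux :: "nat \<Rightarrow> ('n::finite) mindex \<Rightarrow> (real^'n \<Rightarrow> real) \<Rightarrow> real^'n \<Rightarrow> real" where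
  "mderiv_aux 0 \<alpha> f = f"
| "mderiv_aux (Suc k) \<alpha> f =
     (let i = (SOME i. \<alpha> i \<noteq> 0) in partial i (mderiv_aux k (\<alpha>(i := \<alpha> i - 1)) f))"

definition mderiv :: "('n::finite) mindex \<Rightarrow> (real^'n \<Rightarrow> real) \<Rightarrow> real^'n \<Rightarrow> real" where
  "mderiv \<alpha> f = mderiv_aux (mi_abs \<alpha>) \<alpha> f"

fun Ck_on :: "nat \<Rightarrow> (real^'n::finite) set \<Rightarrow> (real^'n \<Rightarrow> real) \<Rightarrow> bool" where
  "Ck_on 0 U f = continuous_on U f"
| "Ck_on (Suc k) U f = (continuous_on U f \<and> f differentiable_on U \<and> (\<forall>i. Ck_on k U (partial i f)))"

definition Ck_star_on :: "nat \<Rightarrow> (real^'n::finite) set \<Rightarrow> (real^'n \<Rightarrow> real) \<Rightarrow> bool" where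
  "Ck_star_on k U v \<longleftrightarrow> Ck_on k U v \<and> (AE x in lebesgue. x \<in> U \<longrightarrow> v x \<noteq> 0)"

definition ess_bounded_on :: "(real^'n::finite) set \<Rightarrow> (real^'n \<Rightarrow> real) \<Rightarrow> bool" where
  "ess_bounded_on U v \<longleftrightarrow> (\<exists>B. AE x in lebesgue. x \<in> U \<longrightarrow> \<bar>v x\<bar> \<le> B)"

definition test_fun :: "(real^'n::finite) set \<Rightarrow> (real^'n \<Rightarrow> real) \<Rightarrow> bool" where
  "test_fun U \<phi> \<longleftrightarrow> (\<forall>k. Ck_on k UNIV \<phi>) \<and>
     compact (closure {x. \<phi> x \<noteq> 0}) \<and> closure {x. \<phi> x \<noteq> 0} \<subseteq> U"

definition Lp_w :: "(real^'n::finite) set \<Rightarrow> real \<Rightarrow> (real^'n \<Rightarrow> real) \<Rightarrow> (real^'n \<Rightarrow> real) \<Rightarrow> bool" where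
  "Lp_w A p u f \<longleftrightarrow> set_borel_measurable lebesgue A (\<lambda>x. f x * u x) \<and>
     (\<integral>\<^sup>+x. ennreal (\<bar>f x * u x\<bar> powr p) * indicator A x \<partial>lebesgue) < \<infinity>"

definition Lp_w_pow :: "(real^'n::finite) set \<Rightarrow> real \<Rightarrow> (real^'n \<Rightarrow> real) \<Rightarrow> (real^'n \<Rightarrow> real) \<Rightarrow> real" where
  "Lp_w_pow A p u f = enn2real (\<integral>\<^sup>+x. ennreal (\<bar>f x * u x\<bar> powr p) * indicator A x \<partial>lebesgue)"

definition Lp_w_loc :: "(real^'n::finite) set \<Rightarrow> real \<Rightarrow> (real^'n \<Rightarrow> real) \<Rightarrow> (real^'n \<Rightarrow> real) \<Rightarrow> bool" where
  "Lp_w_loc U p u f \<longleftrightarrow> (\<forall>K. compact K \<and> K \<subseteq> U \<longrightarrow> Lp_w K p u f)"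

definition is_wdv :: "(real^'n::finite) set \<Rightarrow> (real^'n \<Rightarrow> real) \<Rightarrow> 'n mindex
     \<Rightarrow> (real^'n \<Rightarrow> real) \<Rightarrow> (real^'n \<Rightarrow> real) \<Rightarrow> bool" where
  "is_wdv U v \<alpha> f g \<longleftrightarrow>
     Lp_w_loc U 1 (\<lambda>x. v x ^ (mi_abs \<alpha> + 1)) g \<and>
     (\<forall>\<phi>. test_fun U \<phi> \<longrightarrow>
        (LINT x:U|lebesgue. f x * mderiv \<alpha> (\<lambda>y. v y ^ (mi_abs \<alpha> + 1) * \<phi> y) x)
        = (-1) ^ mi_abs \<alpha> * (LINT x:U|lebesgue. v x ^ (mi_abs \<alpha> + 1) * \<phi> x * g x))"

text \<open>D^alpha_v f (a representative; unique up to null sets when it exists); D^0_v f = f.\<close>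
definition wdv :: "(real^'n::finite) set \<Rightarrow> (real^'n \<Rightarrow> real) \<Rightarrow> 'n mindex
     \<Rightarrow> (real^'n \<Rightarrow> real) \<Rightarrow> real^'n \<Rightarrow> real" where
  "wdv U v \<alpha> f = (if mi_abs \<alpha> = 0 then f else (SOME g. is_wdv U v \<alpha> f g))"

definition W_Vv :: "(real^'n::finite) set \<Rightarrow> nat \<Rightarrow> real \<Rightarrow> ('n mindex \<Rightarrow> real^'n \<Rightarrow> real)
     \<Rightarrow> (real^'n \<Rightarrow> real) \<Rightarrow> (real^'n \<Rightarrow> real) set" where
  "W_Vv U m p V v = {f. Lp_w U p (V (\<lambda>_. 0)) f \<and> Lp_w_loc U 1 (V (\<lambda>_. 0)) f \<and>
      (\<forall>\<alpha>. 1 \<le> mi_abs \<alpha> \<and> mi_abs \<alpha> \<le> m \<longrightarrow>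
         (\<exists>g. is_wdv U v \<alpha> f g) \<and> Lp_w U p (V \<alpha>) (wdv U v \<alpha> f))}"

definition W_Vv_norm :: "(real^'n::finite) set \<Rightarrow> nat \<Rightarrow> real \<Rightarrow> ('n mindex \<Rightarrow> real^'n \<Rightarrow> real)
     \<Rightarrow> (real^'n \<Rightarrow> real) \<Rightarrow> (real^'n \<Rightarrow> real) \<Rightarrow> real" where
  "W_Vv_norm U m p V v f =
     (\<Sum>\<alpha>\<in>{\<alpha>. mi_abs \<alpha> \<le> m}. Lp_w_pow U p (V \<alpha>) (wdv U v \<alpha> f)) powr (1 / p)"

definition admissible :: "nat \<Rightarrow> (('n::finite) mindex \<Rightarrow> real) \<Rightarrow> bool" where
  "admissible m s \<longleftrightarrow>
     (\<forall>\<alpha>. mi_abs \<alpha> \<le> m \<longrightarrow> 0 \<le> s \<alpha> \<and> s \<alpha> \<le> real (mi_abs \<alpha>)) \<and>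
     (\<forall>\<alpha> \<beta>. mi_abs \<alpha> \<le> m \<and> \<beta> \<le> \<alpha> \<longrightarrow> s (\<lambda>i. \<alpha> i - \<beta> i) + s \<beta> \<le> s \<alpha>)"

definition s_weights :: "(('n::finite) mindex \<Rightarrow> real) \<Rightarrow> (real^'n \<Rightarrow> real) \<Rightarrow> 'n mindex \<Rightarrow> real^'n \<Rightarrow> real" where
  "s_weights s v = (\<lambda>\<alpha> x. \<bar>v x\<bar> powr (s \<alpha> + 1))"

definition W_sv :: "(real^'n::finite) set \<Rightarrow> nat \<Rightarrow> real \<Rightarrow> ('n mindex \<Rightarrow> real)
     \<Rightarrow> (real^'n \<Rightarrow> real) \<Rightarrow> (real^'n \<Rightarrow> real) set" where
  "W_sv U m p s v = W_Vv U m p (s_weights s v) v"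

definition W_sv_norm :: "(real^'n::finite) set \<Rightarrow> nat \<Rightarrow> real \<Rightarrow> ('n mindex \<Rightarrow> real)
     \<Rightarrow> (real^'n \<Rightarrow> real) \<Rightarrow> (real^'n \<Rightarrow> real) \<Rightarrow> real" where
  "W_sv_norm U m p s v = W_Vv_norm U m p (s_weights s v) v"

definition is_weak_deriv :: "(real^'n::finite) set \<Rightarrow> 'n mindex \<Rightarrow> (real^'n \<Rightarrow> real) \<Rightarrow> (real^'n \<Rightarrow> real) \<Rightarrow> bool" where
  "is_weak_deriv U \<alpha> f g \<longleftrightarrow>
     Lp_w_loc U 1 (\<lambda>_. 1) f \<and> Lp_w_loc U 1 (\<lambda>_. 1) g \<and>
     (\<forall>\<phi>. test_fun U \<phi> \<longrightarrow>
        (LINT x:U|lebesgue. f x * mderiv \<alpha> \<phi> x) = (-1) ^ mi_abs \<alpha> * (LINT x:U|lebesgue. \<phi> x * g x))"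

definition W_std :: "(real^'n::finite) set \<Rightarrow> nat \<Rightarrow> real \<Rightarrow> (real^'n \<Rightarrow> real) set" where
  "W_std U m p = {f. Lp_w U p (\<lambda>_. 1) f \<and>
      (\<forall>\<alpha>. 1 \<le> mi_abs \<alpha> \<and> mi_abs \<alpha> \<le> m \<longrightarrow> (\<exists>g. is_weak_deriv U \<alpha> f g \<and> Lp_w U p (\<lambda>_. 1) g))}"

definition smooth_real :: "(real \<Rightarrow> real) \<Rightarrow> bool" where
  "smooth_real \<eta> \<longleftrightarrow> (\<forall>k x. ((deriv ^^ k) \<eta>) differentiable (at x))"

definition cutoff_profile :: "(real \<Rightarrow> real) \<Rightarrow> bool" where
  "cutoff_profile \<eta> \<longleftrightarrow> smooth_real \<eta> \<and> (\<forall>t. 0 \<le> \<eta> t \<and> \<eta> t \<le> 1) \<and>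
     (\<forall>t. t \<notin> {-1..1} \<longrightarrow> \<eta> t = 1) \<and> (\<forall>t\<in>{-1/2..1/2}. \<eta> t = 0)"

definition chi :: "(real \<Rightarrow> real) \<Rightarrow> (real^'n::finite \<Rightarrow> real) \<Rightarrow> nat \<Rightarrow> real^'n \<Rightarrow> real" where
  "chi \<eta> v n = (\<lambda>x. \<eta> (real n * v x))"

definition Mset :: "(real^'n::finite) set \<Rightarrow> (real^'n \<Rightarrow> real) \<Rightarrow> nat \<Rightarrow> (real^'n) set" where
  "Mset U v n = {x\<in>U. \<bar>v x\<bar> \<le> 1 / real n}"

end

theory Submission
  imports Defs
begin

text \<open>On \<open>{v \<noteq> 0}\<close> the weighted derivatives of \<open>f\<close> are ordinary weak derivatives, because a test function
  supported there may be divided by a power of \<open>v\<close>. As \<open>\<chi>\<^sub>n\<close> is supported in that set, \<open>\<chi>\<^sub>n f\<close> has the weak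
  derivatives given by the Leibniz formula. The terms in which \<open>\<chi>\<^sub>n\<close> is differentiated live on the annulus
  \<open>M\<^sub>n - M\<^sub>2\<^sub>n\<close>; there the hypothesis on \<open>v\<close> and superadditivity of \<open>s\<close> give \<open>\<bar>\<partial>\<^sup>\<sigma> \<chi>\<^sub>n\<bar> \<le> B n\<^sup>s\<^sup>(\<^sup>\<sigma>\<^sup>)\<close>, and since
  \<open>\<bar>v\<bar> \<le> 1/n\<close> the weights absorb this factor. Hence \<open>\<chi>\<^sub>n f - f\<close> and its derivatives are dominated by
  fixed \<open>L\<^sup>p\<close> functions restricted to \<open>M\<^sub>n\<close>, which shrinks to a null set.

  Multi-indices are represented by words of coordinate directions. A sum over all ways of splitting a word
  into two subwords then replaces the binomial coefficients of the Leibniz formula, and Schwarz's theorem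
  makes a derivative depend only on the multi-index of its word.\<close>

section \<open>Iterated partial derivatives\<close>


text \<open>The exponents in the hypothesis balance exactly. Every use of the chain rule on
  \<open>\<eta> (n * v x)\<close> brings out one factor \<open>n\<close> together with one
  derivative of \<open>v\<close>, and the \<open>- 1\<close> in
  \<open>n powr (s \<sigma> - 1)\<close> absorbs that factor.

  Several obstacles shape the argument. The quotient of a test function by a power of
  \<open>v\<close> is only as smooth as \<open>v\<close>, so identities for smooth test functions
  are extended to \<open>Ckc\<close> functions by mollification, with uniform convergence of the
  derivatives involved. The function \<open>wdv\<close> is an arbitrary choice among those
  satisfying the defining identity, so formulas for it hold only almost everywhere and only through
  uniqueness, that is, through the fundamental lemma of the calculus of variations. As
  \<open>f\<close> is locally integrable only after multiplication by \<open>|v|\<close>, even the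
  linearity of the defining integrals needs an argument. Finally, the support of a cut-off need not
  be compact; being closed relative to the open set, it still meets the support of a test function
  in a compact set.\<close>

lemma open_differentiable_onD:
  "open U \<Longrightarrow> f differentiable_on U \<Longrightarrow> x \<in> U \<Longrightarrow> f differentiable (at x)"
  by (metis at_within_open differentiable_on_def)

lemma open_differentiable_onI:
  "(\<And>x. x \<in> U \<Longrightarrow> f differentiable (at x)) \<Longrightarrow> f differentiable_on U"
  by (simp add: differentiable_at_imp_differentiable_on)

lemma partial_eqI:
  "(f has_derivative D) (at x) \<Longrightarrow> partial i f x = D (axis i 1)"
  unfolding partial_def using frechet_derivative_at by metis

lemma has_derivative_frechet:
  "f differentiable (at x) \<Longrightarrow> (f has_derivative frechet_derivative f (at x)) (at x)"
  by (rule iffD1[OF frechet_derivative_works])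

text \<open>No differentiability is assumed. \<open>frechet_derivative\<close> is a choice from the
  set of all derivatives at \<open>x\<close>, and this set is the same for two functions that agree
  near \<open>x\<close>, also when it is empty.\<close>

lemma partial_cong:
  assumes "open U" "x \<in> U" "\<And>y. y \<in> U \<Longrightarrow> f y = g y"
  shows "partial i f x = partial i g x"
proof (cases "f differentiable (at x)")
  case True
  then show ?thesis
    unfolding partial_def using frechet_derivative_transform_within_open[OF True assms] by simp
next
  case False
  have "\<not> g differentiable (at x)"
    using False assms has_derivative_transform_within_open[of g _ x UNIV U f]
    unfolding differentiable_def by metis
  then have "(\<lambda>D. (f has_derivative D) (at x)) = (\<lambda>D. (g has_derivative D) (at x))"
    using False unfolding differentiable_def by auto
  then show ?thesis unfolding partial_def frechet_derivative_def by simp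
qed

lemma partial_add:
  assumes "f differentiable (at x)" "g differentiable (at x)"
  shows "partial i (\<lambda>x. f x + g x) x = partial i f x + partial i g x"
  using partial_eqI[OF has_derivative_add[OF has_derivative_frechet[OF assms(1)] has_derivative_frechet[OF assms(2)]]]
  by (simp add: partial_def)

lemma partial_mult:
  assumes "f differentiable (at x)" "g differentiable (at x)"
  shows "partial i (\<lambda>x. f x * g x) x = partial i f x * g x + f x * partial i g x"
  using partial_eqI[OF has_derivative_mult[OF has_derivative_frechet[OF assms(1)] has_derivative_frechet[OF assms(2)]], of i]
  by (simp add: partial_def algebra_simps)

lemma partial_const [simp]: "partial i (\<lambda>x. c) = (\<lambda>x. 0)"
  by (simp add: partial_def)

lemma partial_cmult:
  "f differentiable (at x) \<Longrightarrow> partial i (\<lambda>x. c * f x) x = c * partial i f x"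
  using partial_mult[of "\<lambda>_. c" x f i] by simp

lemma partial_compose:
  assumes "f differentiable (at x)" "(h has_real_derivative h') (at (f x))"
  shows "partial i (\<lambda>x. h (f x)) x = h' * partial i f x"
proof -
  have "((\<lambda>x. h (f x)) has_derivative (\<lambda>y. h' * frechet_derivative f (at x) y)) (at x)"
    using has_derivative_compose[OF has_derivative_frechet[OF assms(1)], of h "\<lambda>y. h' * y"] assms(2)
    by (simp add: has_field_derivative_def)
  from partial_eqI[OF this] show ?thesis by (simp add: partial_def)
qed

lemma frechet_eq_sum_partial:
  fixes f :: "real^'n::finite \<Rightarrow> real"
  assumes "f differentiable (at x)"
  shows "frechet_derivative f (at x) h = (\<Sum>i\<in>UNIV. h $ i * partial i f x)"
proof -
  let ?D = "frechet_derivative f (at x)"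
  have lin: "linear ?D" by (rule linear_frechet_derivative[OF assms])
  have "h = (\<Sum>i\<in>UNIV. h $ i *\<^sub>R axis i 1)"
    by (metis basis_expansion scalar_mult_eq_scaleR)
  then have "?D h = ?D (\<Sum>i\<in>UNIV. h $ i *\<^sub>R axis i 1)" by simp
  also have "\<dots> = (\<Sum>i\<in>UNIV. h $ i *\<^sub>R ?D (axis i 1))"
    using lin by (simp add: linear_sum linear_scale)
  finally show ?thesis by (simp add: partial_def)
qed

section \<open>Closure properties of the classes of k times continuously differentiable
  functions\<close>

lemma Ck_on_cont: "Ck_on k U f \<Longrightarrow> continuous_on U f"
  by (cases k) auto

lemma Ck_on_Suc_imp: "Ck_on (Suc k) U f \<Longrightarrow> Ck_on k U f"
  by (induction k arbitrary: f) auto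

lemma Ck_on_mono: "Ck_on k U f \<Longrightarrow> j \<le> k \<Longrightarrow> Ck_on j U f"
proof (induction k)
  case (Suc k)
  then show ?case using Ck_on_Suc_imp le_Suc_eq by blast
qed auto

lemma Ck_on_subset: "Ck_on k U f \<Longrightarrow> W \<subseteq> U \<Longrightarrow> Ck_on k W f"
  by (induction k arbitrary: f) (auto intro: continuous_on_subset differentiable_on_subset)

lemma Ck_on_differentiable:
  "Ck_on k U f \<Longrightarrow> 1 \<le> k \<Longrightarrow> open U \<Longrightarrow> x \<in> U \<Longrightarrow> f differentiable (at x)"
  by (cases k) (auto intro: open_differentiable_onD)

text \<open>The formulas for partial derivatives of sums, products and compositions are available
  only at points of \<open>U\<close>; the inductions below exchange \<open>partial i\<close> of the
  composite for the formula through this lemma.\<close>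

lemma Ck_on_cong:
  assumes "open U" "Ck_on k U f" "\<And>x. x \<in> U \<Longrightarrow> f x = g x"
  shows "Ck_on k U g"
  using assms(2,3)
proof (induction k arbitrary: f g)
  case 0
  then show ?case using continuous_on_cong[of U U f g] by simp
next
  case (Suc k)
  have "g differentiable (at x)" if "x \<in> U" for x
    using open_differentiable_onD[OF assms(1) _ that, of f] Suc.prems that assms(1)
      has_derivative_transform_within_open[of f _ x UNIV U g]
    unfolding differentiable_def by auto
  moreover have "Ck_on k U (partial i g)" for i
    using Suc.IH[of "partial i f" "partial i g"] partial_cong[OF assms(1), of _ f g i] Suc.prems
    by auto
  moreover have "continuous_on U g"
    using Suc.prems continuous_on_cong[of U U f g] by simp
  ultimately show ?case by (auto intro: open_differentiable_onI)
qed

text \<open>Serves to glue a function on \<open>U\<close> to its extension by zero on the complement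
  of a compact set.\<close>

lemma Ck_on_Un:
  assumes "open U" "open W" "Ck_on k U f" "Ck_on k W f"
  shows "Ck_on k (U \<union> W) f"
  using assms(3,4)
proof (induction k arbitrary: f)
  case 0
  then show ?case using assms by (simp add: continuous_on_open_Un)
next
  case (Suc k)
  then show ?case using assms(1,2)
    by (auto simp: continuous_on_open_Un intro!: open_differentiable_onI dest: open_differentiable_onD)
qed

lemma Ck_on_const [simp]: "Ck_on k U (\<lambda>_. c)"
  by (induction k arbitrary: c) auto

lemma Ck_on_add:
  assumes "open U" "Ck_on k U f" "Ck_on k U g"
  shows "Ck_on k U (\<lambda>x. f x + g x)"
  using assms(2,3)
proof (induction k arbitrary: f g)
  case (Suc k)
  have "Ck_on k U (partial i (\<lambda>x. f x + g x))" for i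
    by (rule Ck_on_cong[OF assms(1), of _ "\<lambda>x. partial i f x + partial i g x"])
      (use Suc assms(1) in \<open>auto simp: partial_add open_differentiable_onD\<close>)
  then show ?case using Suc.prems by (auto intro: continuous_on_add differentiable_on_add)
qed (auto intro: continuous_on_add)

lemma Ck_on_mult:
  assumes "open U" "Ck_on k U f" "Ck_on k U g"
  shows "Ck_on k U (\<lambda>x. f x * g x)"
  using assms(2,3)
proof (induction k arbitrary: f g)
  case (Suc k)
  have "Ck_on k U (partial i (\<lambda>x. f x * g x))" for i
  proof (rule Ck_on_cong[OF assms(1), of _ "\<lambda>x. partial i f x * g x + f x * partial i g x"])
    show "Ck_on k U (\<lambda>x. partial i f x * g x + f x * partial i g x)"
      using Suc.prems Ck_on_Suc_imp[OF Suc.prems(1)] Ck_on_Suc_imp[OF Suc.prems(2)]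
      by (intro Ck_on_add[OF assms(1)] Suc.IH) auto
  qed (use Suc.prems assms(1) in \<open>auto simp: partial_mult open_differentiable_onD\<close>)
  then show ?case using Suc.prems by (auto intro: continuous_on_mult differentiable_on_mult)
qed (auto intro: continuous_on_mult)

lemma Ck_on_power:
  "open U \<Longrightarrow> Ck_on k U f \<Longrightarrow> Ck_on k U (\<lambda>x. f x ^ j)"
  by (induction j) (auto intro: Ck_on_mult)

lemma Ck_on_sum:
  "open U \<Longrightarrow> (\<And>i. i \<in> I \<Longrightarrow> Ck_on k U (f i)) \<Longrightarrow> Ck_on k U (\<lambda>x. \<Sum>i\<in>I. f i x)"
  by (induction I rule: infinite_finite_induct) (auto intro: Ck_on_add)

lemma Ck_on_inverse:
  assumes "open U" "Ck_on k U f" "\<And>x. x \<in> U \<Longrightarrow> f x \<noteq> 0"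
  shows "Ck_on k U (\<lambda>x. inverse (f x))"
  using assms(2,3)
proof (induction k arbitrary: f)
  case (Suc k)
  have d: "f differentiable (at x)" if "x \<in> U" for x
    using Suc.prems assms(1) that by (auto intro: open_differentiable_onD)
  have "Ck_on k U (partial i (\<lambda>x. inverse (f x)))" for i
  proof (rule Ck_on_cong[OF assms(1), of _ "\<lambda>x. (- 1) * ((inverse (f x) * inverse (f x)) * partial i f x)"])
    show "Ck_on k U (\<lambda>x. (- 1) * ((inverse (f x) * inverse (f x)) * partial i f x))"
      using Suc Ck_on_Suc_imp[OF Suc.prems(1)] by (intro Ck_on_mult[OF assms(1)] Suc.IH) auto
    fix x assume "x \<in> U"
    then show "- 1 * (inverse (f x) * inverse (f x) * partial i f x) = partial i (\<lambda>x. inverse (f x)) x"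
      using partial_compose[OF d, of x inverse] DERIV_inverse[of "f x"] Suc.prems(2)
      by (fastforce simp: power2_eq_square)
  qed
  then show ?case using Suc.prems d
    by (auto intro!: continuous_on_inverse open_differentiable_onI differentiable_inverse)
qed (auto intro: continuous_on_inverse)

lemma smooth_real_deriv: "smooth_real h \<Longrightarrow> smooth_real (deriv h)"
  unfolding smooth_real_def by (metis funpow_Suc_right comp_apply)

lemma smooth_real_has_deriv: "smooth_real h \<Longrightarrow> (h has_real_derivative deriv h x) (at x)"
  unfolding smooth_real_def using real_differentiable_def DERIV_deriv_iff_real_differentiable
  by (metis funpow_0)

lemma smooth_real_continuous: "smooth_real h \<Longrightarrow> continuous_on UNIV h"
  by (rule DERIV_continuous_on[where D = "deriv h"]) (auto intro: smooth_real_has_deriv)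

lemma Ck_on_compose:
  assumes "open U" "Ck_on k U f" "smooth_real h"
  shows "Ck_on k U (\<lambda>x. h (f x))"
  using assms(3,2)
proof (induction k arbitrary: h)
  case 0
  then show ?case using continuous_on_compose2[OF smooth_real_continuous, of h U f] by simp
next
  case (Suc k)
  have d: "f differentiable (at x)" if "x \<in> U" for x
    using Suc.prems assms(1) that by (auto intro: open_differentiable_onD)
  have "Ck_on k U (partial i (\<lambda>x. h (f x)))" for i
  proof (rule Ck_on_cong[OF assms(1), of _ "\<lambda>x. deriv h (f x) * partial i f x"])
    show "Ck_on k U (\<lambda>x. deriv h (f x) * partial i f x)"
      using Suc Ck_on_Suc_imp[OF Suc.prems(2)] smooth_real_deriv by (intro Ck_on_mult[OF assms(1)]) auto
  qed (use partial_compose[OF d smooth_real_has_deriv] Suc.prems in auto)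
  moreover have "(\<lambda>x. h (f x)) differentiable (at x)" if "x \<in> U" for x
    using differentiable_chain_at[OF d[OF that], of h] smooth_real_has_deriv[OF Suc.prems(1)]
    by (auto simp: o_def real_differentiable_def)
  ultimately show ?case using Suc.prems(2) continuous_on_compose2[OF smooth_real_continuous[OF Suc.prems(1)], of U f]
    by (auto intro: open_differentiable_onI)
qed

lemma Ck_on_cmult: "open U \<Longrightarrow> Ck_on k U f \<Longrightarrow> Ck_on k U (\<lambda>x. c * f x)"
  by (rule Ck_on_mult) auto

section \<open>Derivatives along words and the Leibniz formula\<close>

definition pd :: "'n list \<Rightarrow> (real^'n::finite \<Rightarrow> real) \<Rightarrow> real^'n \<Rightarrow> real" where
  "pd l f = foldr partial l f"

lemma pd_Nil [simp]: "pd [] f = f" and pd_Cons [simp]: "pd (i # l) f = partial i (pd l f)"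
  and pd_append: "pd (a @ b) f = pd a (pd b f)"
  by (simp_all add: pd_def)

lemma Ck_on_pd:
  "Ck_on k U f \<Longrightarrow> length l + j \<le> k \<Longrightarrow> Ck_on j U (pd l f)"
proof (induction l arbitrary: j)
  case Nil
  then show ?case using Ck_on_mono by auto
next
  case (Cons i l)
  then have "Ck_on (Suc j) U (pd l f)" by (metis add_Suc_right add_Suc_shift length_Cons)
  then show ?case by simp
qed

lemma pd_differentiable:
  "Ck_on k U f \<Longrightarrow> length l < k \<Longrightarrow> open U \<Longrightarrow> x \<in> U \<Longrightarrow> pd l f differentiable (at x)"
  using Ck_on_pd[of k U f l 1] Ck_on_differentiable[of 1 U "pd l f" x] by simp

lemma pd_continuous_on: "Ck_on k U f \<Longrightarrow> length l \<le> k \<Longrightarrow> continuous_on U (pd l f)"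
  using Ck_on_pd[of k U f l 0] by simp

lemma pd_cong:
  assumes "open U" "\<And>y. y \<in> U \<Longrightarrow> f y = g y" "x \<in> U"
  shows "pd l f x = pd l g x"
  using assms(3)
proof (induction l arbitrary: x)
  case (Cons i l)
  then show ?case using partial_cong[OF assms(1), of x "pd l f" "pd l g"] by simp
qed (simp add: assms)

lemma pd_zero [simp]: "pd l (\<lambda>_. 0) = (\<lambda>_. 0)"
  by (induction l) auto

lemma pd_const: "l \<noteq> [] \<Longrightarrow> pd l (\<lambda>_. c) = (\<lambda>_. 0)"
proof (induction l)
  case (Cons i l)
  then show ?case by (cases l) auto
qed simp

lemma pd_cmult:
  assumes "open U" "Ck_on k U f" "length l \<le> k" "x \<in> U"
  shows "pd l (\<lambda>x. c * f x) x = c * pd l f x"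
  using assms(3,4)
proof (induction l arbitrary: x)
  case (Cons i l)
  have "partial i (pd l (\<lambda>x. c * f x)) x = partial i (\<lambda>x. c * pd l f x) x"
    by (rule partial_cong[OF assms(1)]) (use Cons in auto)
  then show ?case using partial_cmult[OF pd_differentiable[OF assms(2) _ assms(1), of l x]] Cons by simp
qed simp

primrec splits :: "'a list \<Rightarrow> ('a list \<times> 'a list) list" where
  "splits [] = [([], [])]"
| "splits (i # l) = map (\<lambda>(a, b). (i # a, b)) (splits l) @ map (\<lambda>(a, b). (a, i # b)) (splits l)"

lemma splits_mset: "(a, b) \<in> set (splits l) \<Longrightarrow> mset a + mset b = mset l"
  by (induction l arbitrary: a b) auto

lemma splits_length: "(a, b) \<in> set (splits l) \<Longrightarrow> length a + length b = length l"
  using splits_mset by (metis size_mset size_union)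

lemma sum_list_splits_Cons:
  fixes F :: "'a list \<Rightarrow> 'a list \<Rightarrow> 'b::comm_monoid_add"
  shows "(\<Sum>(a, b)\<leftarrow>splits (i # l). F a b)
    = (\<Sum>(a, b)\<leftarrow>splits l. F (i # a) b) + (\<Sum>(a, b)\<leftarrow>splits l. F a (i # b))"
  by (simp add: o_def case_prod_unfold)

lemma differentiable_sum_list:
  "(\<And>c. c \<in> set T \<Longrightarrow> F c differentiable (at x)) \<Longrightarrow> (\<lambda>x. \<Sum>c\<leftarrow>T. F c x) differentiable (at x)"
  by (induction T) auto

lemma partial_sum_list:
  "(\<And>c. c \<in> set T \<Longrightarrow> F c differentiable (at x)) \<Longrightarrow>
    partial i (\<lambda>x. \<Sum>c\<leftarrow>T. F c x) x = (\<Sum>c\<leftarrow>T. partial i (F c) x)"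
  by (induction T) (auto simp: partial_add differentiable_sum_list)

lemma pd_mult:
  assumes "open U" "Ck_on k U f" "Ck_on k U g" "length l \<le> k" "x \<in> U"
  shows "pd l (\<lambda>x. f x * g x) x = (\<Sum>(a, b)\<leftarrow>splits l. pd a f x * pd b g x)"
  using assms(4,5)
proof (induction l arbitrary: x)
  case (Cons i l)
  have da: "pd a f differentiable (at x)" "pd b g differentiable (at x)" if "(a, b) \<in> set (splits l)" for a b
    using splits_length[OF that] Cons.prems assms(1,2,3) by (auto intro: pd_differentiable)
  have "pd (i # l) (\<lambda>x. f x * g x) x = partial i (\<lambda>x. \<Sum>c\<leftarrow>splits l. pd (fst c) f x * pd (snd c) g x) x"
    using Cons by (auto intro!: partial_cong[OF assms(1)] simp: case_prod_beta)
  also have "\<dots> = (\<Sum>c\<leftarrow>splits l. partial i (\<lambda>x. pd (fst c) f x * pd (snd c) g x) x)"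
    by (rule partial_sum_list) (use da in auto)
  also have "\<dots> = (\<Sum>c\<leftarrow>splits l. pd (i # fst c) f x * pd (snd c) g x + pd (fst c) f x * pd (i # snd c) g x)"
    by (rule arg_cong[where f = sum_list]) (auto simp: da partial_mult intro!: map_cong)
  finally show ?case unfolding sum_list_splits_Cons by (simp add: sum_list_addf case_prod_unfold)
qed simp



section \<open>Symmetry of derivatives and multi-indices\<close>

lemma DERIV_along_axis:
  fixes f :: "real^'n::finite \<Rightarrow> real"
  assumes "f differentiable (at (y + t *\<^sub>R axis i 1))"
  shows "((\<lambda>t. f (y + t *\<^sub>R axis i 1)) has_real_derivative partial i f (y + t *\<^sub>R axis i 1)) (at t)"
proof -
  let ?D = "frechet_derivative f (at (y + t *\<^sub>R axis i 1))"
  have "((\<lambda>t. f (y + t *\<^sub>R axis i 1)) has_derivative (\<lambda>h. ?D (h *\<^sub>R axis i 1))) (at t)"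
    by (rule has_derivative_compose[where g = f and f = "\<lambda>t. y + t *\<^sub>R axis i 1" and x = t, OF _ has_derivative_frechet[OF assms]])
      (auto intro!: derivative_eq_intros)
  moreover have "?D (h *\<^sub>R axis i 1) = partial i f (y + t *\<^sub>R axis i 1) * h" for h
    using linear_scale[OF linear_frechet_derivative[OF assms], of h] by (simp add: partial_def)
  ultimately show ?thesis by (simp add: has_field_derivative_def)
qed

text \<open>The mean value theorem is applied along direction \<open>i\<close> and then along
  \<open>j\<close>, so only one of the mixed derivatives appears. The second difference is symmetric
  in \<open>i\<close> and \<open>j\<close>, hence exchanging them yields the other one.\<close>

lemma second_difference_mean_value:
  fixes f :: "real^'n::finite \<Rightarrow> real"
  assumes f: "open U" "Ck_on 2 U f" and h: "0 < h"
    and U: "\<And>s t. \<lbrakk>0 \<le> s; s \<le> h; 0 \<le> t; t \<le> h\<rbrakk> \<Longrightarrow> x + s *\<^sub>R axis i 1 + t *\<^sub>R axis j 1 \<in> U"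
  obtains s t where "0 < s" "s < h" "0 < t" "t < h"
    "f (x + h *\<^sub>R axis i 1 + h *\<^sub>R axis j 1) - f (x + h *\<^sub>R axis i 1) - f (x + h *\<^sub>R axis j 1) + f x
      = h\<^sup>2 * partial j (partial i f) (x + s *\<^sub>R axis i 1 + t *\<^sub>R axis j 1)"
proof -
  have d1: "f differentiable (at y)" "partial i f differentiable (at y)" if "y \<in> U" for y
    using f that by (auto simp: numeral_2_eq_2 intro: open_differentiable_onD)
  define F where "F s = f (x + h *\<^sub>R axis j 1 + s *\<^sub>R axis i 1) - f (x + s *\<^sub>R axis i 1)" for s
  have F': "(F has_real_derivative partial i f (x + h *\<^sub>R axis j 1 + s *\<^sub>R axis i 1) - partial i f (x + s *\<^sub>R axis i 1)) (at s)"
    if "0 \<le> s" "s \<le> h" for s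
    unfolding F_def using U[OF that, of h] U[OF that, of 0] h
    by (intro DERIV_diff DERIV_along_axis d1) (auto simp: algebra_simps)
  obtain s where s: "0 < s" "s < h"
    "F h - F 0 = (h - 0) * (partial i f (x + h *\<^sub>R axis j 1 + s *\<^sub>R axis i 1) - partial i f (x + s *\<^sub>R axis i 1))"
    using MVT2[OF h F'] by blast
  define G where "G t = partial i f (x + s *\<^sub>R axis i 1 + t *\<^sub>R axis j 1)" for t
  have G': "(G has_real_derivative partial j (partial i f) (x + s *\<^sub>R axis i 1 + t *\<^sub>R axis j 1)) (at t)"
    if "0 \<le> t" "t \<le> h" for t
    unfolding G_def using U[of s t] s that by (intro DERIV_along_axis d1) auto
  obtain t where t: "0 < t" "t < h"
    "G h - G 0 = (h - 0) * partial j (partial i f) (x + s *\<^sub>R axis i 1 + t *\<^sub>R axis j 1)"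
    using MVT2[OF h G'] by blast
  have "F h - F 0 = h * (G h - G 0)"
    using s(3) by (simp add: G_def algebra_simps)
  then have "F h - F 0 = h\<^sup>2 * partial j (partial i f) (x + s *\<^sub>R axis i 1 + t *\<^sub>R axis j 1)"
    using t(3) by (simp add: power2_eq_square)
  then show ?thesis
    using that[OF s(1,2) t(1,2)] by (simp add: F_def algebra_simps)
qed

text \<open>Both mixed derivatives reproduce the same second difference over arbitrarily small
  squares, at points that may differ; continuity at \<open>x\<close> then rules out distinct values
  there.\<close>

lemma partial_commute:
  fixes f :: "real^'n::finite \<Rightarrow> real"
  assumes "open U" "Ck_on 2 U f" "x \<in> U"
  shows "partial i (partial j f) x = partial j (partial i f) x"
proof (rule ccontr)
  let ?P = "partial i (partial j f)" and ?Q = "partial j (partial i f)"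
  assume "?P x \<noteq> ?Q x"
  \<comment> \<open>Half the gap: a number closer than \<open>e\<close> to \<open>?P x\<close>
    cannot also be closer than \<open>e\<close> to \<open>?Q x\<close>.\<close>
  define e where "e = \<bar>?P x - ?Q x\<bar> / 2"
  have e: "e > 0" using \<open>?P x \<noteq> ?Q x\<close> by (simp add: e_def)
  have "continuous_on U ?P" "continuous_on U ?Q"
    using assms(2) by (auto simp: numeral_2_eq_2)
  then have "isCont ?P x" "isCont ?Q x"
    using assms by (auto simp: continuous_on_eq_continuous_at)
  then obtain d1 d2 where d: "d1 > 0" "d2 > 0"
    "\<And>y. dist y x < d1 \<Longrightarrow> dist (?P y) (?P x) < e" "\<And>y. dist y x < d2 \<Longrightarrow> dist (?Q y) (?Q x) < e"
    using e unfolding continuous_at by (metis (no_types, lifting) continuous_at continuous_at_eps_delta)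
  obtain d3 where d3: "d3 > 0" "ball x d3 \<subseteq> U"
    using assms openE by blast
  \<comment> \<open>Points of the square lie within \<open>2 * h\<close> of \<open>x\<close>; the
    divisor 3 makes the bound strict.\<close>
  define h where "h = min d1 (min d2 d3) / 3"
  have h: "h > 0" "3 * h \<le> d1" "3 * h \<le> d2" "3 * h \<le> d3" using d d3 by (auto simp: h_def)
  have near: "dist (x + s *\<^sub>R axis a 1 + t *\<^sub>R axis b 1) x < 3 * h"
    if "0 \<le> s" "s \<le> h" "0 \<le> t" "t \<le> h" for s t and a b :: 'n
  proof -
    have "dist (x + s *\<^sub>R axis a 1 + t *\<^sub>R axis b 1) x = norm (s *\<^sub>R (axis a 1::real^'n) + t *\<^sub>R axis b 1)"
      by (simp add: dist_norm)
    also have "\<dots> \<le> norm (s *\<^sub>R (axis a 1::real^'n)) + norm (t *\<^sub>R (axis b 1 :: real^'n))"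
      by (rule norm_triangle_ineq)
    also have "\<dots> < 3 * h" using that h(1) by simp
    finally show ?thesis .
  qed
  have inU: "x + s *\<^sub>R axis a 1 + t *\<^sub>R axis b 1 \<in> U"
    if "0 \<le> s" "s \<le> h" "0 \<le> t" "t \<le> h" for s t and a b :: 'n
    using near[OF that, of a b] h(4) d3(2) by (force simp: dist_commute)
  obtain s t where st: "0 < s" "s < h" "0 < t" "t < h"
    "f (x + h *\<^sub>R axis i 1 + h *\<^sub>R axis j 1) - f (x + h *\<^sub>R axis i 1) - f (x + h *\<^sub>R axis j 1) + f x
      = h\<^sup>2 * ?Q (x + s *\<^sub>R axis i 1 + t *\<^sub>R axis j 1)"
    by (rule second_difference_mean_value[OF assms(1,2) h(1) inU[of _ _ i j]])
  obtain s' t' where st': "0 < s'" "s' < h" "0 < t'" "t' < h"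
    "f (x + h *\<^sub>R axis j 1 + h *\<^sub>R axis i 1) - f (x + h *\<^sub>R axis j 1) - f (x + h *\<^sub>R axis i 1) + f x
      = h\<^sup>2 * ?P (x + s' *\<^sub>R axis j 1 + t' *\<^sub>R axis i 1)"
    by (rule second_difference_mean_value[OF assms(1,2) h(1) inU[of _ _ j i]])
  have "h\<^sup>2 * ?Q (x + s *\<^sub>R axis i 1 + t *\<^sub>R axis j 1) = h\<^sup>2 * ?P (x + s' *\<^sub>R axis j 1 + t' *\<^sub>R axis i 1)"
    using st(5) st'(5) by (simp only: add.commute[of "x + h *\<^sub>R axis i 1"] add.left_commute[of _ x] add.assoc add.commute[of "h *\<^sub>R axis j 1"])
  then have "?Q (x + s *\<^sub>R axis i 1 + t *\<^sub>R axis j 1) = ?P (x + s' *\<^sub>R axis j 1 + t' *\<^sub>R axis i 1)"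
    using h(1) by simp
  moreover have "dist (?Q (x + s *\<^sub>R axis i 1 + t *\<^sub>R axis j 1)) (?Q x) < e"
    using near[of s t i j] st h by (intro d) auto
  moreover have "dist (?P (x + s' *\<^sub>R axis j 1 + t' *\<^sub>R axis i 1)) (?P x) < e"
    using near[of s' t' j i] st' h by (intro d) auto
  ultimately show False unfolding dist_real_def e_def by argo
qed

lemma pd_move_front:
  assumes "open U" "Ck_on k U f" "length a < k" "x \<in> U"
  shows "pd (a @ [i]) f x = pd (i # a) f x"
  using assms(3,4)
proof (induction a arbitrary: x)
  case (Cons j a)
  have "pd ((j # a) @ [i]) f x = partial j (pd (i # a) f) x"
    using Cons by (auto intro!: partial_cong[OF assms(1)])
  also have "\<dots> = partial i (partial j (pd a f)) x"
    using partial_commute[OF assms(1), of "pd a f" x j i] Ck_on_pd[OF assms(2), of a 2] Cons.prems by auto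
  finally show ?case by simp
qed simp

text \<open>The last letter acts first. It also occurs in \<open>l'\<close>, where it can be moved
  to the end; the remaining letters are permutations of each other and act on
  \<open>partial i f\<close>, which has one derivative fewer.\<close>

lemma pd_perm:
  assumes "open U" "Ck_on k U f" "length l \<le> k" "mset l = mset l'" "x \<in> U"
  shows "pd l f x = pd l' f x"
  using assms(2-5)
proof (induction l arbitrary: l' f k rule: rev_induct)
  case (snoc i l)
  then have "i \<in> set l'" by (metis last_in_set last_snoc mset_eq_setD snoc_eq_iff_butlast)
  then obtain b c where l': "l' = b @ i # c" by (metis split_list)
  have k: "length (b @ i # c) \<le> k" using snoc.prems l' by (metis size_mset)
  have "pd (l @ [i]) f x = pd l (partial i f) x" by (simp add: pd_append)
  also have "\<dots> = pd (b @ c) (partial i f) x"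
  proof (rule snoc.IH)
    show "Ck_on (k - 1) U (partial i f)"
      using Ck_on_pd[OF snoc.prems(1), of "[i]" "k - 1"] snoc.prems by simp
  qed (use snoc.prems l' in auto)
  also have "\<dots> = pd b (pd (c @ [i]) f) x" by (simp add: pd_append)
  also have "\<dots> = pd b (pd (i # c) f) x"
    by (rule pd_cong[OF assms(1)]) (use pd_move_front[OF assms(1) snoc.prems(1)] k snoc.prems in auto)
  finally show ?case using l' by (simp add: pd_append)
qed simp

section \<open>Words and multi-indices\<close>

definition mi :: "'n list \<Rightarrow> 'n mindex" where
  "mi l = count (mset l)"

text \<open>Follows the coordinate choice of \<open>mderiv_aux\<close> literally, so that
  \<open>mderiv\<close> is \<open>pd\<close> along this word without any appeal to symmetry.\<close>

primrec word_aux :: "nat \<Rightarrow> 'n mindex \<Rightarrow> 'n list" where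
  "word_aux 0 \<alpha> = []"
| "word_aux (Suc k) \<alpha> = (let i = SOME i. \<alpha> i \<noteq> 0 in i # word_aux k (\<alpha>(i := \<alpha> i - 1)))"

definition word :: "'n::finite mindex \<Rightarrow> 'n list" where
  "word \<alpha> = word_aux (mi_abs \<alpha>) \<alpha>"

lemma mderiv_eq_pd_word: "mderiv \<alpha> f = pd (word \<alpha>) f"
proof -
  have "mderiv_aux k \<alpha> f = pd (word_aux k \<alpha>) f" for k
    by (induction k arbitrary: \<alpha>) (auto simp: Let_def)
  then show ?thesis by (simp add: mderiv_def word_def)
qed

lemma mi_Nil [simp]: "mi [] = (\<lambda>_. 0)" by (auto simp: mi_def)

lemma mi_Cons: "mi (i # l) = (mi l)(i := Suc (mi l i))"
  by (auto simp: mi_def)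

lemma mi_abs_upd_Suc: "mi_abs (\<alpha>(i := Suc (\<alpha> i))) = Suc (mi_abs \<alpha>)"
  by (simp add: mi_abs_def sum.remove[of UNIV i])

lemma mi_abs_mi [simp]: "mi_abs (mi l) = length l"
  by (induction l) (simp_all add: mi_Cons mi_abs_upd_Suc del: fun_upd_apply, simp add: mi_abs_def)

lemma mi_abs_zero_iff: "mi_abs \<alpha> = 0 \<longleftrightarrow> \<alpha> = (\<lambda>_. 0)"
  by (auto simp: mi_abs_def)

lemma mi_word [simp]: "mi (word \<alpha>) = \<alpha>"
proof -
  have "mi (word_aux k \<alpha>) = \<alpha>" if "mi_abs \<alpha> = k" for k
    using that
  proof (induction k arbitrary: \<alpha>)
    case 0
    then show ?case by (auto simp: mi_abs_zero_iff)
  next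
    case (Suc k)
    define i where "i = (SOME i. \<alpha> i \<noteq> 0)"
    have "\<exists>i. \<alpha> i \<noteq> 0" using Suc.prems by (metis mi_abs_zero_iff nat.distinct(1))
    then have i: "\<alpha> i \<noteq> 0" unfolding i_def by (rule someI_ex)
    have "mi_abs \<alpha> = Suc (mi_abs (\<alpha>(i := \<alpha> i - 1)))"
      using mi_abs_upd_Suc[of "\<alpha>(i := \<alpha> i - 1)" i] i by simp
    then have "mi (word_aux k (\<alpha>(i := \<alpha> i - 1))) = \<alpha>(i := \<alpha> i - 1)"
      using Suc.IH Suc.prems by (metis nat.inject)
    then have "mi (i # word_aux k (\<alpha>(i := \<alpha> i - 1))) = \<alpha>" using i by (auto simp: mi_Cons)
    then show ?case by (simp add: Let_def i_def)
  qed
  then show ?thesis by (simp add: word_def)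
qed

lemma length_word [simp]: "length (word \<alpha>) = mi_abs \<alpha>"
  by (metis mi_abs_mi mi_word)

lemma pd_mi_cong:
  assumes "open U" "Ck_on k U f" "length l \<le> k" "mi l = mi l'" "x \<in> U"
  shows "pd l f x = pd l' f x"
  using pd_perm[OF assms(1-3) _ assms(5)] assms(4) by (simp add: mi_def multiset_eq_iff fun_eq_iff)

lemma pd_eq_mderiv:
  assumes "open U" "Ck_on k U f" "length l \<le> k" "x \<in> U"
  shows "pd l f x = mderiv (mi l) f x"
  unfolding mderiv_eq_pd_word using pd_mi_cong[OF assms(1-3) _ assms(4), of "word (mi l)"] by simp

lemma mi_splits: "(a, b) \<in> set (splits l) \<Longrightarrow> mi l = (\<lambda>i. mi a i + mi b i)"
  using splits_mset[of a b l] by (auto simp: mi_def fun_eq_iff simp flip: count_union)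

text \<open>The Leibniz formula solved for \<open>z * pd l \<psi>\<close>: the right-hand side consists of full derivatives, against
  which the weak derivatives of \<open>f\<close> can be tested.\<close>

lemma mult_pd_eq_sum_pd:
  assumes "open U"
  shows "Ck_on k U z \<Longrightarrow> Ck_on k U \<psi> \<Longrightarrow> length l \<le> k \<Longrightarrow> x \<in> U \<Longrightarrow>
    z x * pd l \<psi> x = (\<Sum>(a, b)\<leftarrow>splits l. (- 1) ^ length a * pd b (\<lambda>y. \<psi> y * pd a z y) x)"
proof (induction l arbitrary: z x k)
  case (Cons i l)
  then obtain k' where k: "k = Suc k'" by (cases k) auto
  have z': "Ck_on k' U z" "Ck_on k' U \<psi>" "Ck_on k' U (partial i z)" "length l \<le> k'"
    using Cons.prems Ck_on_Suc_imp unfolding k by auto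
  have d: "pd b (\<lambda>y. \<psi> y * pd a z y) differentiable (at x)" if "(a, b) \<in> set (splits l)" for a b
  proof (rule pd_differentiable[OF _ _ assms Cons.prems(4)])
    show "Ck_on (Suc (length b)) U (\<lambda>y. \<psi> y * pd a z y)"
      using splits_length[OF that] Cons.prems
      by (intro Ck_on_mult[OF assms] Ck_on_mono[OF Cons.prems(2)] Ck_on_pd[OF Cons.prems(1)]) auto
  qed simp
  have 1: "partial i (\<lambda>y. z y * pd l \<psi> y) x = (\<Sum>(a, b)\<leftarrow>splits l. (- 1) ^ length a * pd (i # b) (\<lambda>y. \<psi> y * pd a z y) x)"
  proof -
    have "partial i (\<lambda>y. z y * pd l \<psi> y) x
      = partial i (\<lambda>y. \<Sum>c\<leftarrow>splits l. (- 1) ^ length (fst c) * pd (snd c) (\<lambda>y. \<psi> y * pd (fst c) z y) y) x"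
      using Cons.IH[OF z'(1,2,4)] Cons.prems(4)
      by (intro partial_cong[OF assms]) (auto simp: case_prod_unfold)
    also have "\<dots> = (\<Sum>c\<leftarrow>splits l. partial i (\<lambda>y. (- 1) ^ length (fst c) * pd (snd c) (\<lambda>y. \<psi> y * pd (fst c) z y) y) x)"
      by (rule partial_sum_list) (use d in auto)
    also have "\<dots> = (\<Sum>c\<leftarrow>splits l. (- 1) ^ length (fst c) * pd (i # snd c) (\<lambda>y. \<psi> y * pd (fst c) z y) x)"
      by (rule arg_cong[where f = sum_list]) (auto simp: d partial_cmult intro!: map_cong)
    finally show ?thesis by (simp add: case_prod_unfold)
  qed
  \<comment> \<open>The induction hypothesis is used a second time, for \<open>partial i z\<close>.
    This produces the words \<open>a @ [i]\<close>, and symmetry brings the new letter to the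
    front.\<close>
  have 2: "partial i z x * pd l \<psi> x = (\<Sum>(a, b)\<leftarrow>splits l. (- 1) ^ length a * pd b (\<lambda>y. \<psi> y * pd (i # a) z y) x)"
  proof -
    have "pd b (\<lambda>y. \<psi> y * pd a (partial i z) y) x = pd b (\<lambda>y. \<psi> y * pd (i # a) z y) x"
      if "(a, b) \<in> set (splits l)" for a b
      using pd_move_front[OF assms Cons.prems(1), of a] splits_length[OF that] Cons.prems
      by (intro pd_cong[OF assms]) (auto simp: pd_append)
    then show ?thesis
      unfolding Cons.IH[OF z'(3,2,4) Cons.prems(4)]
      by (intro arg_cong[where f = sum_list] map_cong) auto
  qed
  \<comment> \<open>Product rule, to be solved for the last summand; the minus sign is the extra
    factor \<open>- 1\<close> that belongs to the longer word \<open>i # a\<close>.\<close>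
  have "partial i (\<lambda>y. z y * pd l \<psi> y) x = partial i z x * pd l \<psi> x + z x * pd (i # l) \<psi> x"
    using Cons.prems by (simp add: partial_mult Ck_on_differentiable[OF _ _ assms] pd_differentiable[OF _ _ assms])
  then have "z x * pd (i # l) \<psi> x = partial i (\<lambda>y. z y * pd l \<psi> y) x - partial i z x * pd l \<psi> x"
    by simp
  then show ?case
    unfolding sum_list_splits_Cons 1 2
    by (simp add: case_prod_unfold uminus_sum_list_map o_def)
qed simp

section \<open>Derivatives of the cut-off functions\<close>

lemma admissible_superadditive:
  assumes "admissible m s" "(a, b) \<in> set (splits l)" "length l \<le> m"
  shows "s (mi a) + s (mi b) \<le> s (mi l)"
proof -
  have l: "mi l = (\<lambda>i. mi a i + mi b i)" by (rule mi_splits[OF assms(2)])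
  then have "mi b \<le> mi l" "(\<lambda>i. mi l i - mi b i) = mi a" by (auto simp: le_fun_def)
  moreover have "mi_abs (mi l) \<le> m" using assms(3) by simp
  ultimately show ?thesis using assms(1) unfolding admissible_def by metis
qed

lemma admissible_bounds:
  assumes "admissible m s" "length l \<le> m"
  shows "0 \<le> s (mi l)" "s (mi l) \<le> length l"
  using assms unfolding admissible_def by (metis mi_abs_mi)+

text \<open>The innermost derivative is taken out because the chain rule then leaves
  \<open>deriv h (r * v y)\<close>, a function of the same shape. Inductions over the word can
  therefore generalise over \<open>h\<close>.\<close>

lemma pd_compose_snoc:
  assumes "open U" "Ck_on k U v" "smooth_real h" "length c < k" "x \<in> U"
  shows "pd (c @ [i]) (\<lambda>y. h (r * v y)) x
    = (\<Sum>(a, b)\<leftarrow>splits c. r * (pd a (\<lambda>y. deriv h (r * v y)) x * pd (b @ [i]) v x))"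
proof -
  have k: "Ck_on (length c) U v" "Ck_on (length c) U (partial i v)"
    using Ck_on_mono[OF assms(2), of "length c"] Ck_on_pd[OF assms(2), of "[i]" "length c"] assms(4) by simp_all
  have H: "Ck_on (length c) U (\<lambda>y. deriv h (r * v y))"
    by (rule Ck_on_compose[OF assms(1) Ck_on_cmult[OF assms(1) k(1)] smooth_real_deriv[OF assms(3)]])
  have "partial i (\<lambda>y. h (r * v y)) y = r * (deriv h (r * v y) * partial i v y)" if "y \<in> U" for y
  proof -
    have d: "v differentiable (at y)" using Ck_on_differentiable[OF assms(2) _ assms(1) that] assms(4) by simp
    have "partial i (\<lambda>y. h (r * v y)) y = deriv h (r * v y) * partial i (\<lambda>y. r * v y) y"
      by (rule partial_compose) (use d smooth_real_has_deriv[OF assms(3)] in auto)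
    then show ?thesis using d by (simp add: partial_cmult)
  qed
  then have "pd (c @ [i]) (\<lambda>y. h (r * v y)) x = pd c (\<lambda>y. r * (deriv h (r * v y) * partial i v y)) x"
    unfolding pd_append using assms(5) by (intro pd_cong[OF assms(1)]) auto
  also have "\<dots> = r * pd c (\<lambda>y. deriv h (r * v y) * partial i v y) x"
    using H k assms by (intro pd_cmult[where k = "length c"] Ck_on_mult) auto
  also have "pd c (\<lambda>y. deriv h (r * v y) * partial i v y) x
    = (\<Sum>(a, b)\<leftarrow>splits c. pd a (\<lambda>y. deriv h (r * v y)) x * pd b (partial i v) x)"
    by (rule pd_mult[OF assms(1) H k(2) _ assms(5)]) simp
  finally show ?thesis by (simp add: sum_list_const_mult case_prod_unfold pd_append)
qed

text \<open>Every summand of the chain rule contains some derivative of \<open>h\<close> at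
  \<open>r * v x\<close>. A statement at a single point is needed because it serves on all of
  \<open>Mset U v (2 * n)\<close>, whose boundary points need not have a neighbourhood on which the
  cut-off vanishes.\<close>

lemma pd_compose_flat:
  assumes "open U" "Ck_on k U v" "x \<in> U"
  shows "smooth_real h \<Longrightarrow> (\<And>j. (deriv ^^ j) h (r * v x) = 0) \<Longrightarrow> length a \<le> k \<Longrightarrow>
    pd a (\<lambda>y. h (r * v y)) x = 0"
proof (induction "length a" arbitrary: a h rule: less_induct)
  case less
  show ?case
  proof (cases a rule: rev_cases)
    case Nil
    then show ?thesis using less.prems(2)[of 0] by simp
  next
    case (snoc c i)
    have "(deriv ^^ j) (deriv h) (r * v x) = 0" for j
      using less.prems(2)[of "Suc j"] by (simp add: funpow_swap1)
    then have van: "pd a' (\<lambda>y. deriv h (r * v y)) x = 0" if "(a', b) \<in> set (splits c)" for a' b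
      using splits_length[OF that] less.prems snoc smooth_real_deriv by (intro less.hyps) auto
    have "(\<Sum>(a, b)\<leftarrow>splits c. r * (pd a (\<lambda>y. deriv h (r * v y)) x * pd (b @ [i]) v x)) = (\<Sum>_\<leftarrow>splits c. 0)"
      by (rule arg_cong[where f = sum_list], rule map_cong) (auto simp: van)
    then show ?thesis
      unfolding snoc using pd_compose_snoc[OF assms(1,2) less.prems(1) _ assms(3), of c i r] less.prems snoc
      by simp
  qed
qed

text \<open>In each summand of \<open>pd_compose_snoc\<close> the factor \<open>n\<close> meets a
  derivative of \<open>v\<close> of size \<open>n powr (s (mi (b @ [i])) - 1)\<close> and a shorter
  derivative of \<open>deriv h (n * v y)\<close> of size \<open>n powr s (mi a')\<close>.
  Superadditivity bounds the total exponent by \<open>s (mi a)\<close>.\<close>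

lemma pd_compose_bound:
  fixes v :: "real^'n::finite \<Rightarrow> real" and s :: "'n mindex \<Rightarrow> real"
  assumes "open U" "Ck_on m U v" "admissible m s" "0 \<le> C"
    and hyp: "\<And>n \<sigma> x. \<lbrakk>1 \<le> n; 1 \<le> mi_abs \<sigma>; mi_abs \<sigma> \<le> m; x \<in> Mset U v n - Mset U v (2 * n)\<rbrakk> \<Longrightarrow>
      \<bar>mderiv \<sigma> v x\<bar> \<le> C * real n powr (s \<sigma> - 1)"
  shows "smooth_real h \<Longrightarrow> length a \<le> m \<Longrightarrow>
    \<exists>B\<ge>0. \<forall>n\<ge>1. \<forall>x\<in>Mset U v n - Mset U v (2 * n). \<bar>pd a (\<lambda>y. h (real n * v y)) x\<bar> \<le> B * real n powr s (mi a)"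
proof (induction "length a" arbitrary: a h rule: less_induct)
  case less
  show ?case
  proof (cases a rule: rev_cases)
    case Nil
    \<comment> \<open>On \<open>Mset U v n\<close> the argument \<open>n * v x\<close> stays in this
      interval, whence a bound that does not depend on \<open>n\<close>.\<close>
    have "compact (h ` {-1..1})"
      using continuous_on_subset[OF smooth_real_continuous[OF less.prems(1)]] by (intro compact_continuous_image) auto
    then obtain B where B: "\<And>t. t \<in> {-1..1} \<Longrightarrow> \<bar>h t\<bar> \<le> B"
      using compact_imp_bounded bounded_iff by (metis imageI real_norm_def)
    have "0 \<le> B" using B[of 0] by simp
    \<comment> \<open>Admissibility squeezes \<open>s\<close> at the zero multi-index between 0 and
      the length of the empty word.\<close>
    moreover have "s (mi a) = 0" using admissible_bounds[OF assms(3), of a] Nil by simp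
    moreover have "real n * v x \<in> {-1..1}" if "n \<ge> 1" "x \<in> Mset U v n" for n x
    proof -
      have "\<bar>real n * v x\<bar> \<le> 1" using that by (simp add: Mset_def abs_mult field_simps)
      then show ?thesis by auto
    qed
    ultimately show ?thesis using Nil B by (intro exI[of _ B]) auto
  next
    case (snoc c i)
    have "\<forall>a'. length a' \<le> length c \<longrightarrow> (\<exists>B\<ge>0. \<forall>n\<ge>1. \<forall>x\<in>Mset U v n - Mset U v (2 * n).
      \<bar>pd a' (\<lambda>y. deriv h (real n * v y)) x\<bar> \<le> B * real n powr s (mi a'))"
      using less snoc smooth_real_deriv by (auto intro!: less.hyps)
    then obtain B where B: "\<And>a'. length a' \<le> length c \<Longrightarrow> 0 \<le> B a'"
      "\<And>a' n x. \<lbrakk>length a' \<le> length c; n \<ge> 1; x \<in> Mset U v n - Mset U v (2 * n)\<rbrakk> \<Longrightarrow>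
        \<bar>pd a' (\<lambda>y. deriv h (real n * v y)) x\<bar> \<le> B a' * real n powr s (mi a')"
      by metis
    let ?B = "\<Sum>(a', b)\<leftarrow>splits c. B a' * C"
    have bnd: "\<bar>real n * (pd a' (\<lambda>y. deriv h (real n * v y)) x * pd (b @ [i]) v x)\<bar> \<le> B a' * C * real n powr s (mi a)"
      if "n \<ge> 1" "x \<in> Mset U v n - Mset U v (2 * n)" "(a', b) \<in> set (splits c)" for n x a' b
    proof -
      have len: "length a' + length b = length c" by (rule splits_length[OF that(3)])
      have x: "x \<in> U" using that by (simp add: Mset_def)
      have "(a', b @ [i]) \<in> set (splits (c @ [i]))"
      proof -
        have "(a', b) \<in> set (splits c) \<Longrightarrow> (a', b @ [i]) \<in> set (splits (c @ [i]))" for a' b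
          by (induction c arbitrary: a' b) force+
        then show ?thesis using that(3) by simp
      qed
      then have sup: "s (mi a') + s (mi (b @ [i])) \<le> s (mi a)"
        using admissible_superadditive[OF assms(3)] less.prems snoc by blast
      have "\<bar>pd (b @ [i]) v x\<bar> \<le> C * real n powr (s (mi (b @ [i])) - 1)"
        using hyp[OF that(1), of "mi (b @ [i])" x] pd_eq_mderiv[OF assms(1,2), of "b @ [i]" x] len less.prems snoc that x
        by simp
      then have "\<bar>real n * (pd a' (\<lambda>y. deriv h (real n * v y)) x * pd (b @ [i]) v x)\<bar>
        \<le> real n * ((B a' * real n powr s (mi a')) * (C * real n powr (s (mi (b @ [i])) - 1)))"
        unfolding abs_mult using B len that by (intro mult_mono) auto
      also have "\<dots> = B a' * C * (real n powr s (mi a') * (real n powr 1 * real n powr (s (mi (b @ [i])) - 1)))"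
        using that(1) by simp
      also have "\<dots> = B a' * C * real n powr (s (mi a') + s (mi (b @ [i])))"
        unfolding powr_add[symmetric] by simp
      also have "\<dots> \<le> B a' * C * real n powr s (mi a)"
        using that(1) sup B(1)[of a'] len assms(4) by (intro mult_left_mono powr_mono) auto
      finally show ?thesis .
    qed
    show ?thesis
    proof (intro exI[of _ ?B] conjI allI impI ballI)
      show "0 \<le> ?B" using B(1) splits_length assms(4) by (fastforce intro!: sum_list_nonneg)
      fix n :: nat and x assume n: "1 \<le> n" "x \<in> Mset U v n - Mset U v (2 * n)"
      have "\<bar>pd a (\<lambda>y. h (real n * v y)) x\<bar>
        = \<bar>\<Sum>(a', b)\<leftarrow>splits c. real n * (pd a' (\<lambda>y. deriv h (real n * v y)) x * pd (b @ [i]) v x)\<bar>"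
        unfolding snoc using pd_compose_snoc[OF assms(1,2) less.prems(1), of c x i] less.prems snoc n by (simp add: Mset_def)
      also have "\<dots> \<le> (\<Sum>(a', b)\<leftarrow>splits c. \<bar>real n * (pd a' (\<lambda>y. deriv h (real n * v y)) x * pd (b @ [i]) v x)\<bar>)"
        using sum_list_abs[of "map (\<lambda>(a', b). real n * (pd a' (\<lambda>y. deriv h (real n * v y)) x * pd (b @ [i]) v x)) (splits c)"]
        by (simp add: case_prod_unfold o_def)
      also have "\<dots> \<le> (\<Sum>(a', b)\<leftarrow>splits c. B a' * C * real n powr s (mi a))"
        by (rule sum_list_mono) (use bnd[OF n] in auto)
      also have "\<dots> = ?B * real n powr s (mi a)"
        by (simp add: case_prod_unfold flip: sum_list_mult_const)
      finally show "\<bar>pd a (\<lambda>y. h (real n * v y)) x\<bar> \<le> ?B * real n powr s (mi a)" .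
    qed
  qed
qed

text \<open>In the open interval one differentiates the zero function; the end points, which
  correspond to \<open>|v x| = 1 / (2 * n)\<close>, follow by continuity of the derivatives.\<close>

lemma cutoff_profile_flat:
  assumes "cutoff_profile \<eta>" "t \<in> {-1/2..1/2}"
  shows "(deriv ^^ j) \<eta> t = 0"
  using assms(2)
proof (induction j arbitrary: t)
  case 0
  then show ?case using assms(1) by (auto simp: cutoff_profile_def)
next
  case (Suc j)
  have open0: "(deriv ^^ Suc j) \<eta> t = 0" if "t \<in> {-1/2<..<1/2}" for t
  proof -
    have "((deriv ^^ j) \<eta> has_real_derivative 0) (at t)"
      by (rule has_field_derivative_transform_within_open[of "\<lambda>_. 0" _ _ "{-1/2<..<1/2}"])
        (use that Suc.IH in auto)
    then show ?thesis by (simp add: DERIV_imp_deriv)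
  qed
  have "continuous_on UNIV ((deriv ^^ Suc j) \<eta>)"
    using assms(1) unfolding cutoff_profile_def smooth_real_def
    by (metis differentiable_imp_continuous_on differentiable_at_imp_differentiable_on)
  then have "continuous_on (closure {-1/2<..<1/2}) ((deriv ^^ Suc j) \<eta>)"
    by (rule continuous_on_subset) auto
  moreover have "t \<in> closure {-1/2<..<1/2}" using Suc.prems by simp
  ultimately show ?case using continuous_constant_on_closure[of _ _ 0 t] open0 by blast
qed



section \<open>Approximation by smooth test functions\<close>

text \<open>Analogue of \<open>test_fun\<close> of finite smoothness. Any compact set outside which
  the function vanishes takes the place of the closed support, because the same set then serves for
  products and derivatives.\<close>

definition Ckc :: "nat \<Rightarrow> (real^'n::finite) set \<Rightarrow> (real^'n \<Rightarrow> real) \<Rightarrow> bool" where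
  "Ckc k U \<psi> \<longleftrightarrow> Ck_on k UNIV \<psi> \<and> (\<exists>K. compact K \<and> K \<subseteq> U \<and> (\<forall>x. x \<notin> K \<longrightarrow> \<psi> x = 0))"

text \<open>\<open>U\<close> and the complement of \<open>K\<close> are open and cover the space,
  and on the complement the function is constant.\<close>

lemma CkcI:
  assumes "open U" "Ck_on k U \<psi>" "compact K" "K \<subseteq> U" "\<And>x. x \<notin> K \<Longrightarrow> \<psi> x = 0"
  shows "Ckc k U \<psi>"
proof -
  have o: "open (- K)" using assms(3) by (simp add: compact_imp_closed open_Compl)
  have "Ck_on k (- K) \<psi>" by (rule Ck_on_cong[OF o Ck_on_const[of k _ 0]]) (use assms(5) in auto)
  then have "Ck_on k (U \<union> - K) \<psi>" using Ck_on_Un[OF assms(1) o assms(2)] by blast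
  moreover have "U \<union> - K = UNIV" using assms(4) by auto
  ultimately show ?thesis using assms unfolding Ckc_def by auto
qed

lemma Ckc_mono: "Ckc k U \<psi> \<Longrightarrow> j \<le> k \<Longrightarrow> Ckc j U \<psi>"
  unfolding Ckc_def using Ck_on_mono by blast

lemma Ckc_mult:
  assumes "open U" "Ck_on k U g" "Ckc k U \<psi>"
  shows "Ckc k U (\<lambda>x. g x * \<psi> x)"
proof -
  obtain K where K: "compact K" "K \<subseteq> U" "\<And>x. x \<notin> K \<Longrightarrow> \<psi> x = 0"
    using assms(3) unfolding Ckc_def by blast
  have "Ck_on k U \<psi>" using assms(3) Ck_on_subset[of k UNIV \<psi> U] by (simp add: Ckc_def)
  from CkcI[OF assms(1) Ck_on_mult[OF assms(1,2) this] K(1,2)] show ?thesis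
    using K(3) by simp
qed

lemma test_fun_imp_Ckc: "test_fun U \<phi> \<Longrightarrow> Ckc k U \<phi>"
  unfolding test_fun_def Ckc_def
  using closure_subset[of "{x. \<phi> x \<noteq> 0}"] by blast

lemma test_funI:
  assumes "\<And>k. Ck_on k UNIV \<phi>" "compact K" "K \<subseteq> U" "\<And>x. x \<notin> K \<Longrightarrow> \<phi> x = 0"
  shows "test_fun U \<phi>"
proof -
  have "closure {x. \<phi> x \<noteq> 0} \<subseteq> K"
    using assms(2,4) by (intro closure_minimal) (auto simp: compact_imp_closed)
  then show ?thesis
    unfolding test_fun_def using assms compact_Int_closed[OF assms(2), of "closure {x. \<phi> x \<noteq> 0}"]
    by (auto simp: inf.absorb2)
qed

text \<open>Both forms of a mollification are instances: \<open>c = 1, d = 1 / r\<close> with \<open>w\<close> the kernel, and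
  \<open>c = - r, d = r\<close> with \<open>h\<close> the kernel, where differentiation acts on the kernel.\<close>

definition avg :: "real^'n::finite \<Rightarrow> real^'n \<Rightarrow> (real^'n \<Rightarrow> real) \<Rightarrow> real \<Rightarrow> real \<Rightarrow> (real^'n \<Rightarrow> real) \<Rightarrow> real^'n \<Rightarrow> real" where
  "avg a b w c d h x = integral (cbox a b) (\<lambda>y. w y * h (c *\<^sub>R x + d *\<^sub>R y))"

section \<open>Regularity of averages and the two forms of mollification\<close>

lemma avg_continuous:
  assumes "continuous_on UNIV w" "continuous_on UNIV h"
  shows "continuous_on UNIV (avg a b w c d h)"
  unfolding avg_def
  by (rule integral_continuous_on_param)
    (auto simp: case_prod_unfold intro!: continuous_intros continuous_on_compose2[OF assms(1)] continuous_on_compose2[OF assms(2)])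

lemma avg_has_derivative:
  fixes h :: "real^'n::finite \<Rightarrow> real"
  assumes w: "continuous_on UNIV w" and h: "Ck_on 1 UNIV h"
  shows "avg a b w c d h differentiable (at x)"
    and "partial i (avg a b w c d h) x = c * avg a b w c d (partial i h) x"
proof -
  \<comment> \<open>The derivative as a bounded linear map, written through coordinate functionals
    so that its joint continuity, required for differentiation under the integral, reduces to that
    of the partial derivatives.\<close>
  define D where "D x y = (\<Sum>i\<in>UNIV. (w y * (c * partial i h (c *\<^sub>R x + d *\<^sub>R y))) *\<^sub>R blinfun_inner_left (axis i 1 :: real^'n))"
    for x y :: "real^'n"
  have dh: "h differentiable (at y)" for y using h by (auto intro: open_differentiable_onD)
  have ch: "continuous_on UNIV (partial i h)" for i using h by simp
  have ch0: "continuous_on UNIV h" using h by simp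
  have D: "((\<lambda>x. w y * h (c *\<^sub>R x + d *\<^sub>R y)) has_derivative blinfun_apply (D x y)) (at x)" for x y
  proof -
    have "((\<lambda>x. c *\<^sub>R x + d *\<^sub>R y) has_derivative (\<lambda>u. c *\<^sub>R u)) (at x)"
      by (auto intro!: derivative_eq_intros)
    from has_derivative_compose[where g = h, OF this has_derivative_frechet[OF dh]]
    have "((\<lambda>x. w y * h (c *\<^sub>R x + d *\<^sub>R y)) has_derivative
      (\<lambda>u. w y * frechet_derivative h (at (c *\<^sub>R x + d *\<^sub>R y)) (c *\<^sub>R u))) (at x)"
      by (rule has_derivative_mult_right)
    moreover have "w y * frechet_derivative h (at (c *\<^sub>R x + d *\<^sub>R y)) (c *\<^sub>R u) = blinfun_apply (D x y) u" for u
      unfolding frechet_eq_sum_partial[OF dh] D_def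
      by (simp add: blinfun.sum_left blinfun.scaleR_left inner_axis sum_distrib_left mult_ac)
    ultimately show ?thesis by simp
  qed
  have int: "(\<lambda>y. w y * h (c *\<^sub>R x + d *\<^sub>R y)) integrable_on cbox a b" for x
    by (intro integrable_continuous continuous_intros continuous_on_compose2[OF w] continuous_on_compose2[OF ch0]) auto
  have cD: "continuous_on (UNIV \<times> cbox a b) (\<lambda>(x, y). D x y)"
    unfolding D_def case_prod_unfold
    by (intro continuous_intros continuous_on_compose2[OF w] continuous_on_compose2[OF ch]) auto
  have der: "(avg a b w c d h has_derivative integral (cbox a b) (D x)) (at x)"
    unfolding avg_def
    by (rule leibniz_rule[of UNIV a b _ D x]) (use D int cD in auto)
  then show "avg a b w c d h differentiable (at x)" unfolding differentiable_def by blast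
  have cDx: "continuous_on (cbox a b) (D x)"
    using continuous_on_compose2[OF cD, of "cbox a b" "Pair x"] continuous_on_Pair[OF continuous_on_const continuous_on_id]
    by (auto simp: image_subset_iff)
  have "partial i (avg a b w c d h) x = blinfun_apply (integral (cbox a b) (D x)) (axis i 1)"
    by (rule partial_eqI[OF der])
  also have "\<dots> = integral (cbox a b) (\<lambda>y. blinfun_apply (D x y) (axis i 1))"
    using integral_linear[OF integrable_continuous[OF cDx], of "\<lambda>b. blinfun_apply b (axis i 1)"]
      blinfun.bounded_linear_left by (simp add: o_def)
  also have "(\<lambda>y. blinfun_apply (D x y) (axis i 1)) = (\<lambda>y. c * (w y * partial i h (c *\<^sub>R x + d *\<^sub>R y)))"
  proof
    fix y
    show "blinfun_apply (D x y) (axis i 1) = c * (w y * partial i h (c *\<^sub>R x + d *\<^sub>R y))"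
      by (simp add: D_def blinfun.sum_left blinfun.scaleR_left inner_axis_axis of_bool_def[symmetric] mult_ac
        flip: sum_distrib_left) (simp add: of_bool_def if_distrib[of "\<lambda>t. t * _"] cong: if_cong)
  qed
  also have "integral (cbox a b) \<dots> = c * avg a b w c d (partial i h) x"
    by (simp add: avg_def)
  finally show "partial i (avg a b w c d h) x = c * avg a b w c d (partial i h) x" .
qed

lemma Ck_on_avg:
  assumes "continuous_on UNIV w"
  shows "Ck_on k UNIV h \<Longrightarrow> Ck_on k UNIV (avg a b w c d h)"
proof (induction k arbitrary: h)
  case 0
  then show ?case using avg_continuous[OF assms] by simp
next
  case (Suc k)
  have 1: "Ck_on 1 UNIV h" by (rule Ck_on_mono[OF Suc.prems]) simp
  have "Ck_on k UNIV (partial i (avg a b w c d h))" for i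
  proof -
    have "partial i (avg a b w c d h) = (\<lambda>x. c * avg a b w c d (partial i h) x)"
      using avg_has_derivative(2)[OF assms 1] by blast
    then show ?thesis using Suc by (simp add: Ck_on_cmult)
  qed
  then show ?case
    using avg_has_derivative(1)[OF assms 1] avg_continuous[OF assms] Ck_on_cont[OF Suc.prems]
    by (auto intro!: open_differentiable_onI)
qed

lemma pd_avg:
  assumes "continuous_on UNIV w" "Ck_on k UNIV h" "length l \<le> k"
  shows "pd l (avg a b w c d h) = (\<lambda>x. c ^ length l * avg a b w c d (pd l h) x)"
  using assms(3)
proof (induction l)
  case (Cons i l)
  have 1: "Ck_on 1 UNIV (pd l h)" by (rule Ck_on_pd[OF assms(2)]) (use Cons.prems in simp)
  have "partial i (\<lambda>x. c ^ length l * avg a b w c d (pd l h) x) x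
    = c ^ length (i # l) * avg a b w c d (pd (i # l) h) x" for x
    using partial_cmult[OF avg_has_derivative(1)[OF assms(1) 1]] avg_has_derivative(2)[OF assms(1) 1]
    by simp
  then show ?case using Cons by auto
qed simp

text \<open>Substitution \<open>y = r * (z - x)\<close>, with Jacobian \<open>r ^ CARD('n)\<close>.
  It moves the parameter \<open>x\<close> from \<open>h\<close> to \<open>w\<close>, so that
  smoothness of \<open>w\<close> makes the average smooth.\<close>

lemma avg_change_variables:
  fixes w h :: "real^'n::finite \<Rightarrow> real"
  assumes w: "continuous_on UNIV w" "\<And>y. y \<notin> cbox a b \<Longrightarrow> w y = 0"
    and h: "continuous_on UNIV h" "\<And>y. y \<notin> cbox a' b' \<Longrightarrow> h y = 0"
    and r: "0 < r"
  shows "avg a b w 1 (1 / r) h x = r ^ CARD('n) * avg a' b' h (- r) r w x"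
proof -
  let ?F = "\<lambda>y. w y * h (x + (1 / r) *\<^sub>R y)"
  have "?F integrable_on cbox a b"
    by (intro integrable_continuous continuous_intros continuous_on_compose2[OF w(1)] continuous_on_compose2[OF h(1)]) auto
  then have "(?F has_integral avg a b w 1 (1 / r) h x) (cbox a b)"
    by (simp add: avg_def integrable_integral)
  then have G: "((\<lambda>z. ?F (r *\<^sub>R z + (- r *\<^sub>R x))) has_integral (1 / \<bar>r\<bar> ^ DIM(real^'n)) *\<^sub>R avg a b w 1 (1 / r) h x)
    ((\<lambda>z. (1 / r) *\<^sub>R z + - ((1 / r) *\<^sub>R (- r *\<^sub>R x))) ` cbox a b)" (is "(?G has_integral ?I) ?S")
    by (rule has_integral_affinity) (use r in simp)
  have G_eq: "?G z = h z * w (- r *\<^sub>R x + r *\<^sub>R z)" for z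
    using r by (simp add: algebra_simps)
  have w0: "w (- r *\<^sub>R x + r *\<^sub>R z) = 0" if "z \<notin> ?S" for z
  proof (rule w(2))
    show "- r *\<^sub>R x + r *\<^sub>R z \<notin> cbox a b"
    proof
      assume "- r *\<^sub>R x + r *\<^sub>R z \<in> cbox a b"
      moreover have "z = (1 / r) *\<^sub>R (- r *\<^sub>R x + r *\<^sub>R z) + - ((1 / r) *\<^sub>R (- r *\<^sub>R x))"
        using r by (simp add: algebra_simps)
      ultimately show False using that by blast
    qed
  qed
  then have van: "h z * w (- r *\<^sub>R x + r *\<^sub>R z) = 0" if "z \<notin> ?S" for z
    by (simp only: w0[OF that] mult_zero_right)
  have G': "((\<lambda>z. h z * w (- r *\<^sub>R x + r *\<^sub>R z)) has_integral ?I) ?S"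
    using G by (simp only: G_eq)
  \<comment> \<open>The affine image of one box is not the other box; both integrals are extended by
    zero to the whole space, where they coincide.\<close>
  have 1: "((\<lambda>z. h z * w (- r *\<^sub>R x + r *\<^sub>R z)) has_integral ?I) UNIV"
    by (rule has_integral_on_superset[OF G' van subset_UNIV])
  have "(\<lambda>z. h z * w (- r *\<^sub>R x + r *\<^sub>R z)) integrable_on cbox a' b'"
    by (intro integrable_continuous continuous_intros continuous_on_compose2[OF w(1)] continuous_on_compose2[OF h(1)]) auto
  then have "((\<lambda>z. h z * w (- r *\<^sub>R x + r *\<^sub>R z)) has_integral avg a' b' h (- r) r w x) (cbox a' b')"
    by (simp add: avg_def integrable_integral)
  then have "((\<lambda>z. h z * w (- r *\<^sub>R x + r *\<^sub>R z)) has_integral avg a' b' h (- r) r w x) UNIV"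
    by (rule has_integral_on_superset) (use h(2) in auto)
  with 1 have "?I = avg a' b' h (- r) r w x" by (rule has_integral_unique)
  then show ?thesis using r by (simp add: field_simps)
qed

lemma Ck_on_component: "Ck_on k UNIV (\<lambda>x::real^'n::finite. x $ i)"
proof (cases k)
  case (Suc j)
  have d: "((\<lambda>x::real^'n. x $ i) has_derivative (\<lambda>x. x $ i)) (at x)" for x
    by (rule bounded_linear_imp_has_derivative) (rule bounded_linear_vec_nth)
  then have "partial j (\<lambda>x::real^'n. x $ i) = (\<lambda>_. axis j 1 $ i)" for j
    using partial_eqI[OF d] by auto
  moreover have "(\<lambda>x::real^'n. x $ i) differentiable_on UNIV"
    using d by (intro open_differentiable_onI) (metis differentiable_def)
  ultimately show ?thesis using Suc by (auto intro!: continuous_intros)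
qed (auto intro!: continuous_intros)

text \<open>The mollifier is the radial bump \<open>1 - \<eta> (x \<bullet> x)\<close>, so that the given cut-off profile
  is the only smooth function needed.\<close>

lemma test_fun_approximation:
  fixes \<phi> :: "real^'n::finite \<Rightarrow> real"
  assumes U: "open U" and \<eta>: "cutoff_profile \<eta>" and \<phi>: "Ckc k U \<phi>"
  obtains \<Phi> K where "compact K" "K \<subseteq> U" "\<And>j::nat. test_fun U (\<Phi> j)"
    "\<And>j x. x \<notin> K \<Longrightarrow> \<Phi> j x = 0" "\<And>x. x \<notin> K \<Longrightarrow> \<phi> x = 0"
    "\<And>l. length l \<le> k \<Longrightarrow> uniform_limit K (\<lambda>j. pd l (\<Phi> j)) (pd l \<phi>) sequentially"
proof -
  obtain K0 where K0: "compact K0" "K0 \<subseteq> U" "\<And>x. x \<notin> K0 \<Longrightarrow> \<phi> x = 0" and C\<phi>: "Ck_on k UNIV \<phi>"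
    using \<phi> unfolding Ckc_def by blast
  obtain e where e: "e > 0" "(\<Union>x\<in>K0. cball x e) \<subseteq> U"
    using compact_subset_open_imp_cball_epsilon_subset[OF K0(1) U K0(2)] by blast
  \<comment> \<open>One compact set for the supports of all approximants, whose mollification radii
    will not exceed \<open>e\<close>.\<close>
  define K where "K = {x + y | x y. x \<in> K0 \<and> y \<in> cball 0 e}"
  have K: "compact K" unfolding K_def by (rule compact_sums[OF K0(1) compact_cball])
  have KU: "K \<subseteq> U"
  proof
    fix z assume "z \<in> K"
    then obtain x y where "z = x + y" "x \<in> K0" "y \<in> cball 0 e" unfolding K_def by blast
    then have "z \<in> cball x e" by (simp add: dist_norm)
    then show "z \<in> U" using e(2) \<open>x \<in> K0\<close> by blast
  qed
  have K0K: "K0 \<subseteq> K" unfolding K_def using e(1) by force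
  define \<rho> where "\<rho> x = 1 - \<eta> (x \<bullet> x)" for x :: "real^'n"
  have C\<rho>: "Ck_on j UNIV \<rho>" for j
  proof -
    have "Ck_on j UNIV (\<lambda>x::real^'n. \<Sum>i\<in>UNIV. x $ i * x $ i)"
      by (intro Ck_on_sum Ck_on_mult Ck_on_component) auto
    then have "Ck_on j UNIV (\<lambda>x::real^'n. x \<bullet> x)" by (simp add: inner_vec_def)
    then have "Ck_on j UNIV (\<lambda>x::real^'n. \<eta> (x \<bullet> x))"
      using \<eta> by (auto simp: cutoff_profile_def intro: Ck_on_compose[OF open_UNIV])
    from Ck_on_add[OF open_UNIV Ck_on_const[where c = 1] Ck_on_cmult[OF open_UNIV this, of "- 1"]]
     show ?thesis by (simp add: \<rho>_def[abs_def])
  qed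
  have \<rho>c: "continuous_on UNIV \<rho>" by (rule Ck_on_cont[OF C\<rho>])
  have \<rho>0: "0 \<le> \<rho> x" for x using \<eta> by (simp add: \<rho>_def cutoff_profile_def)
  have \<rho>s: "\<rho> x = 0" if "norm x > 1" for x
  proof -
    have "x \<bullet> x > 1" using that by (simp add: dot_square_norm one_less_power)
    then show ?thesis using \<eta> by (simp add: \<rho>_def cutoff_profile_def)
  qed
  have \<rho>1: "\<rho> 0 = 1" using \<eta> by (simp add: \<rho>_def cutoff_profile_def)
  define B :: "real^'n" where "B = 1"
  have nb: "x \<in> cbox (- B) B" if "norm x \<le> 1" for x :: "real^'n"
  proof -
    have "x $ i \<le> 1 \<and> - 1 \<le> x $ i" for i
      using that component_le_norm_cart[of x i] by linarith
    then show ?thesis by (simp add: B_def mem_box_cart)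
  qed
  have \<rho>B: "\<rho> y = 0" if "y \<notin> cbox (- B) B" for y using nb[of y] \<rho>s[of y] that by fastforce
  define c0 where "c0 = integral (cbox (- B) B) \<rho>"
  have \<rho>i: "\<rho> integrable_on cbox (- B) B"
    by (rule integrable_continuous) (rule continuous_on_subset[OF \<rho>c], simp)
  \<comment> \<open>A continuous nonnegative function with integral zero over the box would vanish
    at the origin, where \<open>\<rho>\<close> is 1.\<close>
  have c0: "c0 > 0"
  proof -
    have "c0 \<ge> 0" unfolding c0_def by (rule integral_nonneg[OF \<rho>i]) (rule \<rho>0)
    moreover have "c0 \<noteq> 0"
    proof
      assume "c0 = 0"
      then have "(\<rho> has_integral 0) (cbox (- B) B)" using \<rho>i by (simp add: c0_def has_integral_integral)
      then have "\<rho> 0 = 0"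
        using nb[of 0] by (intro has_integral_0_cbox_imp_0[of "- B" B \<rho>] \<rho>0 continuous_on_subset[OF \<rho>c])
          (auto simp: B_def interval_ne_empty_cart)
      then show False using \<rho>1 by simp
    qed
    ultimately show ?thesis by simp
  qed
  obtain N where N: "N > 0" "1 / real N \<le> min e 1"
    using e(1) by (metis ex_inverse_of_nat_less inverse_eq_divide less_imp_le min_less_iff_conj zero_less_one min_def)
  \<comment> \<open>The mollification radius is \<open>1 / r j\<close>. From \<open>j = 0\<close> on
    it is at most \<open>e\<close>, to stay inside \<open>K\<close>, and at most 1, to stay inside
    \<open>K1\<close> below.\<close>
  define r where "r j = real (N + j)" for j
  have r: "r j > 0" "1 / r j \<le> e" "1 / r j \<le> 1" for j
  proof -
    show "r j > 0" using N by (simp add: r_def)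
    have "1 / r j \<le> 1 / real N" using N(1) by (auto simp: r_def intro!: divide_left_mono)
    then show "1 / r j \<le> e" "1 / r j \<le> 1" using N(2) by linarith+
  qed
  define \<Phi> where "\<Phi> j x = (1 / c0) * avg (- B) B \<rho> 1 (1 / r j) \<phi> x" for j x
  obtain a b where ab: "K0 \<subseteq> cbox a b"
    using bounded_subset_cbox_symmetric[OF compact_imp_bounded[OF K0(1)]] by metis
  have \<phi>c: "continuous_on UNIV \<phi>" by (rule Ck_on_cont[OF C\<phi>])
  \<comment> \<open>In this form the variable sits in \<open>\<rho>\<close>, so
    \<open>\<Phi> j\<close> is smooth although \<open>\<phi>\<close> is only \<open>k\<close> times
    differentiable.\<close>
  have \<Phi>alt: "\<Phi> j = (\<lambda>x. (r j ^ CARD('n) / c0) * avg a b \<phi> (- r j) (r j) \<rho> x)" for j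
  proof -
    have "avg (- B) B \<rho> 1 (1 / r j) \<phi> x = r j ^ CARD('n) * avg a b \<phi> (- r j) (r j) \<rho> x" for x
      by (rule avg_change_variables[OF \<rho>c \<rho>B \<phi>c _ r(1)]) (use ab K0(3) in auto)
    then show ?thesis by (simp add: \<Phi>_def fun_eq_iff)
  qed
  have \<Phi>smooth: "Ck_on i UNIV (\<Phi> j)" for i j
    unfolding \<Phi>alt by (intro Ck_on_cmult Ck_on_avg \<phi>c C\<rho>) simp
  have shift: "norm ((1 / r j) *\<^sub>R y) \<le> 1 / r j" if "norm y \<le> 1" for j and y :: "real^'n"
    using that r(1)[of j] by (simp add: divide_right_mono)
  have \<Phi>0: "\<Phi> j x = 0" if "x \<notin> K" for j x
  proof -
    have "\<rho> y * \<phi> (1 *\<^sub>R x + (1 / r j) *\<^sub>R y) = 0" for y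
    proof (cases "norm y \<le> 1")
      case True
      have "x + (1 / r j) *\<^sub>R y \<notin> K0"
      proof
        assume "x + (1 / r j) *\<^sub>R y \<in> K0"
        moreover have "x = (x + (1 / r j) *\<^sub>R y) + (- (1 / r j) *\<^sub>R y)" by simp
        moreover have "- (1 / r j) *\<^sub>R y \<in> cball 0 e"
          using shift[OF True, of j] r(2)[of j] by simp
        ultimately show False using that unfolding K_def by blast
      qed
      then show ?thesis using K0(3) by simp
    qed (use \<rho>s in auto)
    then have "(\<lambda>y. \<rho> y * \<phi> (1 *\<^sub>R x + (1 / r j) *\<^sub>R y)) = (\<lambda>_. 0)" by blast
    then show ?thesis by (simp add: \<Phi>_def avg_def)
  qed
  have lim: "uniform_limit K (\<lambda>j. pd l (\<Phi> j)) (pd l \<phi>) sequentially" if l: "length l \<le> k" for l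
  proof -
    define u where "u = pd l \<phi>"
    have uc: "continuous_on UNIV u" unfolding u_def by (rule pd_continuous_on[OF C\<phi> l])
    \<comment> \<open>In the original form the factor \<open>c\<close> is 1 and derivatives pass to
      \<open>\<phi>\<close>; convergence then follows from uniform continuity of
      \<open>pd l \<phi>\<close> on a compact set.\<close>
    have pdl: "pd l (\<Phi> j) x = (1 / c0) * avg (- B) B \<rho> 1 (1 / r j) u x" for j x
      unfolding \<Phi>_def[abs_def] u_def
      using pd_cmult[OF open_UNIV Ck_on_avg[OF \<rho>c C\<phi>] l, of x "1 / c0"] pd_avg[OF \<rho>c C\<phi> l] by simp
    define K1 where "K1 = {x + y | x y. x \<in> K \<and> y \<in> cball (0::real^'n) 1}"
    have "compact K1" unfolding K1_def by (rule compact_sums[OF K compact_cball])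
    then have uu: "uniformly_continuous_on K1 u"
      by (rule compact_uniformly_continuous[rotated]) (rule continuous_on_subset[OF uc], simp)
    show ?thesis unfolding u_def[symmetric]
    proof (rule uniform_limitI)
      fix \<epsilon> :: real assume \<epsilon>: "\<epsilon> > 0"
      obtain \<delta> where \<delta>: "\<delta> > 0" "\<And>x y. \<lbrakk>x \<in> K1; y \<in> K1; dist y x < \<delta>\<rbrakk> \<Longrightarrow> dist (u y) (u x) < \<epsilon> / 2"
        using uu \<epsilon> unfolding uniformly_continuous_on_def by (metis half_gt_zero)
      have "(\<lambda>j. 1 / r j) \<longlonglongrightarrow> 0"
        unfolding r_def using LIMSEQ_ignore_initial_segment[OF lim_1_over_n[where 'a = real], of N] by (simp add: add.commute)
      then have "\<forall>\<^sub>F j in sequentially. 1 / r j < \<delta>"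
        using \<delta>(1) by (simp add: order_tendstoD(2))
      then show "\<forall>\<^sub>F j in sequentially. \<forall>x\<in>K. dist (pd l (\<Phi> j) x) (u x) < \<epsilon>"
      proof eventually_elim
        case (elim j)
        show ?case
        proof
          fix x assume x: "x \<in> K"
          let ?F = "\<lambda>y. \<rho> y * u (1 *\<^sub>R x + (1 / r j) *\<^sub>R y)"
          have Fi: "?F integrable_on cbox (- B) B"
            by (intro integrable_continuous continuous_intros continuous_on_compose2[OF \<rho>c] continuous_on_compose2[OF uc]) auto
          have "(x + 0) \<in> K1" unfolding K1_def using x by force
          then have xK1: "x \<in> K1" by simp
          \<comment> \<open>Outside the unit ball \<open>\<rho>\<close> vanishes, so only values of
            \<open>u\<close> at points closer than \<open>\<delta>\<close> to \<open>x\<close>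
            count. Integrating and dividing by \<open>c0\<close> leaves
            \<open>\<epsilon> / 2\<close>.\<close>
          have "\<bar>?F y - \<rho> y * u x\<bar> \<le> \<rho> y * (\<epsilon> / 2)" for y
          proof (cases "norm y \<le> 1")
            case True
            have "norm ((1 / r j) *\<^sub>R y) < \<delta>" "norm ((1 / r j) *\<^sub>R y) \<le> 1"
              using shift[OF True, of j] elim r(3)[of j] by linarith+
            moreover from this have "x + (1 / r j) *\<^sub>R y \<in> K1"
              using x unfolding K1_def mem_Collect_eq by (metis mem_cball_0)
            ultimately have "dist (u (x + (1 / r j) *\<^sub>R y)) (u x) < \<epsilon> / 2"
              by (intro \<delta>(2) xK1) (auto simp: dist_norm)
            then have "\<rho> y * \<bar>u (x + (1 / r j) *\<^sub>R y) - u x\<bar> \<le> \<rho> y * (\<epsilon> / 2)"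
              by (intro mult_left_mono \<rho>0) (simp add: dist_real_def)
            then show ?thesis
              using \<rho>0[of y] by (simp add: abs_mult flip: right_diff_distrib)
          qed (use \<rho>s in auto)
          then have "norm (integral (cbox (- B) B) (\<lambda>y. ?F y - \<rho> y * u x)) \<le> integral (cbox (- B) B) (\<lambda>y. \<rho> y * (\<epsilon> / 2))"
            using Fi \<rho>i by (intro integral_norm_bound_integral integrable_diff integrable_on_mult_left) auto
          then have "\<bar>avg (- B) B \<rho> 1 (1 / r j) u x - c0 * u x\<bar> \<le> c0 * (\<epsilon> / 2)"
            using Fi \<rho>i by (simp add: integral_diff integrable_on_mult_left avg_def c0_def)
          moreover have "pd l (\<Phi> j) x - u x = (1 / c0) * (avg (- B) B \<rho> 1 (1 / r j) u x - c0 * u x)"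
            using c0 by (simp add: pdl field_simps)
          ultimately have "\<bar>pd l (\<Phi> j) x - u x\<bar> \<le> (1 / c0) * (c0 * (\<epsilon> / 2))"
            using c0 by (simp only: abs_mult) (intro mult_mono, auto)
          also have "\<dots> = \<epsilon> / 2" using c0 by simp
          finally have "\<bar>pd l (\<Phi> j) x - u x\<bar> \<le> \<epsilon> / 2" .
          then show "dist (pd l (\<Phi> j) x) (u x) < \<epsilon>" using \<epsilon> by (simp add: dist_real_def)
        qed
      qed
    qed
  qed
  show ?thesis
    by (rule that[of K \<Phi>, OF K KU _ \<Phi>0 _ lim]) (use K0K K0(3) in \<open>auto intro: test_funI[OF \<Phi>smooth K KU \<Phi>0]\<close>)
qed



section \<open>The fundamental lemma of the calculus of variations\<close>

definition locint :: "(real^'n::finite) set \<Rightarrow> (real^'n \<Rightarrow> real) \<Rightarrow> bool" where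
  "locint U f \<longleftrightarrow> (\<forall>K. compact K \<and> K \<subseteq> U \<longrightarrow> set_integrable lebesgue K f)"

lemma compact_sets_lebesgue: "compact (K :: 'a::euclidean_space set) \<Longrightarrow> K \<in> sets lebesgue"
  by (simp add: compact_imp_closed)

lemma set_borel_measurable_continuous:
  fixes g :: "'a::euclidean_space \<Rightarrow> real"
  assumes "A \<in> sets borel" "continuous_on A g"
  shows "set_borel_measurable lebesgue A g"
  unfolding set_borel_measurable_def
  using borel_measurable_continuous_on_indicator[OF assms] by (simp add: measurable_completion)

lemma set_borel_measurable_times:
  fixes f g :: "'a \<Rightarrow> real"
  assumes "set_borel_measurable M A f" "set_borel_measurable M A g"
  shows "set_borel_measurable M A (\<lambda>x. f x * g x)"
proof -
  have "(\<lambda>x. indicator A x *\<^sub>R (f x * g x)) = (\<lambda>x. (indicator A x *\<^sub>R f x) * (indicator A x *\<^sub>R g x))"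
    by (auto simp: indicator_def)
  then show ?thesis using assms unfolding set_borel_measurable_def by simp
qed

lemma Lp_w_one_iff: "Lp_w K 1 u f \<longleftrightarrow> set_integrable lebesgue K (\<lambda>x. f x * u x)"
proof -
  have "ennreal (\<bar>f x * u x\<bar> powr 1) * indicator K x = ennreal (norm (indicator K x *\<^sub>R (f x * u x)))" for x
    by (auto simp: indicator_def)
  then show ?thesis
    unfolding Lp_w_def set_integrable_def set_borel_measurable_def integrable_iff_bounded by simp
qed

lemma Lp_w_loc_one_iff: "Lp_w_loc U 1 u f \<longleftrightarrow> locint U (\<lambda>x. f x * u x)"
  unfolding Lp_w_loc_def locint_def Lp_w_one_iff ..

lemma set_integral_eq_subset:
  fixes F :: "'a \<Rightarrow> real"
  assumes "K \<subseteq> U" "\<And>x. x \<in> U \<Longrightarrow> x \<notin> K \<Longrightarrow> F x = 0"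
  shows "(LINT x:U|M. F x) = (LINT x:K|M. F x)" "set_integrable M U F \<longleftrightarrow> set_integrable M K F"
proof -
  have "(\<lambda>x. indicator U x *\<^sub>R F x) = (\<lambda>x. indicator K x *\<^sub>R F x)"
    using assms by (intro ext) (auto simp: indicator_def)
  then show "(LINT x:U|M. F x) = (LINT x:K|M. F x)" "set_integrable M U F \<longleftrightarrow> set_integrable M K F"
    by (simp_all add: set_lebesgue_integral_def set_integrable_def)
qed

lemma set_integrable_mult_continuous:
  fixes F g :: "'a::euclidean_space \<Rightarrow> real"
  assumes "set_integrable lebesgue K F" "compact K" "continuous_on K g"
  shows "set_integrable lebesgue K (\<lambda>x. F x * g x)"
proof -
  obtain B where B: "\<And>x. x \<in> K \<Longrightarrow> \<bar>g x\<bar> \<le> B"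
    using compact_imp_bounded[OF compact_continuous_image[OF assms(3,2)]] unfolding bounded_iff by auto
  show ?thesis
  proof (rule set_integrable_bound)
    show "set_integrable lebesgue K (\<lambda>x. B * F x)" using assms(1) by simp
    have "set_borel_measurable lebesgue K g"
      using assms(2,3) by (intro set_borel_measurable_continuous) (auto intro: borel_compact)
    moreover have "set_borel_measurable lebesgue K F"
      using assms(1) unfolding set_integrable_def set_borel_measurable_def by (rule borel_measurable_integrable)
    ultimately show "set_borel_measurable lebesgue K (\<lambda>x. F x * g x)"
      by (rule set_borel_measurable_times[rotated])
    have "\<bar>F x * g x\<bar> \<le> \<bar>B * F x\<bar>" if "x \<in> K" for x
      unfolding abs_mult using B[OF that] by (subst mult.commute) (intro mult_right_mono, auto)
    then show "AE x in lebesgue. x \<in> K \<longrightarrow> norm (F x * g x) \<le> norm (B * F x)" by auto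
  qed
qed

lemma locint_mult_continuous:
  "locint U f \<Longrightarrow> continuous_on U g \<Longrightarrow> locint U (\<lambda>x. f x * g x)"
  unfolding locint_def by (blast intro: set_integrable_mult_continuous continuous_on_subset)

lemma locint_subset: "locint U f \<Longrightarrow> W \<subseteq> U \<Longrightarrow> locint W f"
  unfolding locint_def by blast

lemma locint_cong: "(\<And>x. x \<in> U \<Longrightarrow> f x = g x) \<Longrightarrow> locint U f \<longleftrightarrow> locint U g"
  unfolding locint_def using set_integrable_cong[of lebesgue lebesgue _ _ f g] by (metis subset_iff)

lemma locint_add: "locint U f \<Longrightarrow> locint U g \<Longrightarrow> locint U (\<lambda>x. f x + g x)"
  unfolding locint_def by (simp add: set_integral_add)

lemma locint_diff: "locint U f \<Longrightarrow> locint U g \<Longrightarrow> locint U (\<lambda>x. f x - g x)"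
  unfolding locint_def by (simp add: set_integral_diff)

lemma locint_zero: "locint U (\<lambda>_. 0)"
  unfolding locint_def by (simp add: set_integrable_def)

lemma locint_sum_list: "(\<And>c. c \<in> set T \<Longrightarrow> locint U (F c)) \<Longrightarrow> locint U (\<lambda>x. \<Sum>c\<leftarrow>T. F c x)"
  by (induction T) (auto intro: locint_add locint_zero)

lemma locint_integrable_Ckc:
  assumes "locint U f" "Ckc 0 U \<psi>"
  shows "set_integrable lebesgue U (\<lambda>x. f x * \<psi> x)"
proof -
  obtain K where K: "compact K" "K \<subseteq> U" "\<And>x. x \<notin> K \<Longrightarrow> \<psi> x = 0" and c: "continuous_on UNIV \<psi>"
    using assms(2) unfolding Ckc_def by auto
  have "set_integrable lebesgue K (\<lambda>x. f x * \<psi> x)"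
    using assms(1) K(1,2) continuous_on_subset[OF c] unfolding locint_def
    by (blast intro: set_integrable_mult_continuous)
  then show ?thesis using set_integral_eq_subset(2)[OF K(2), of "\<lambda>x. f x * \<psi> x"] K(3) by simp
qed

lemma uniform_limit_sum_list:
  fixes F :: "'c \<Rightarrow> nat \<Rightarrow> 'a \<Rightarrow> real"
  shows "(\<And>c. c \<in> set T \<Longrightarrow> uniform_limit K (F c) (G c) sequentially) \<Longrightarrow>
    uniform_limit K (\<lambda>j x. \<Sum>c\<leftarrow>T. F c j x) (\<lambda>x. \<Sum>c\<leftarrow>T. G c x) sequentially"
  by (induction T) (auto intro: uniform_limit_add uniform_limit_const)

lemma set_integral_uniform_limit:
  fixes F :: "'a::euclidean_space \<Rightarrow> real"
  assumes F: "set_integrable lebesgue K F" and K: "compact K"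
    and u: "\<And>j. continuous_on K (u j)" "uniform_limit K u w sequentially"
  shows "(\<lambda>j::nat. LINT x:K|lebesgue. F x * u j x) \<longlonglongrightarrow> (LINT x:K|lebesgue. F x * w x)"
proof -
  have w: "continuous_on K w"
    by (rule uniform_limit_theorem[OF _ u(2)]) (use u(1) in auto)
  define I where "I = (LINT x:K|lebesgue. \<bar>F x\<bar>)"
  have I: "0 \<le> I" unfolding I_def set_lebesgue_integral_def by (rule integral_nonneg_AE) auto
  have Fa: "set_integrable lebesgue K (\<lambda>x. \<bar>F x\<bar>)" using F by (rule set_integrable_abs)
  have iu: "set_integrable lebesgue K (\<lambda>x. F x * u j x)" "set_integrable lebesgue K (\<lambda>x. F x * w x)" for j
    using set_integrable_mult_continuous[OF F K] u(1) w by auto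
  show ?thesis
  proof (rule tendstoI)
    fix e :: real assume e: "e > 0"
    \<comment> \<open>Adding 1 to \<open>I\<close> keeps the tolerance positive even when
      \<open>I\<close> is 0, and makes the final inequality strict.\<close>
    have "\<forall>\<^sub>F j in sequentially. \<forall>x\<in>K. dist (u j x) (w x) < e / (I + 1)"
      using uniform_limitD[OF u(2), of "e / (I + 1)"] e I by simp
    then show "\<forall>\<^sub>F j in sequentially. dist (LINT x:K|lebesgue. F x * u j x) (LINT x:K|lebesgue. F x * w x) < e"
    proof eventually_elim
      case (elim j)
      have d: "\<bar>F x * u j x - F x * w x\<bar> \<le> (e / (I + 1)) * \<bar>F x\<bar>" if "x \<in> K" for x
      proof -
        have "\<bar>F x\<bar> * \<bar>u j x - w x\<bar> \<le> \<bar>F x\<bar> * (e / (I + 1))"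
          by (rule mult_left_mono) (use elim that in \<open>auto simp: dist_real_def less_imp_le\<close>)
        then show ?thesis by (simp add: abs_mult mult.commute flip: right_diff_distrib)
      qed
      have "(LINT x:K|lebesgue. F x * u j x) - (LINT x:K|lebesgue. F x * w x)
        = (LINT x:K|lebesgue. F x * u j x - F x * w x)"
        using iu by simp
      also have "\<bar>\<dots>\<bar> \<le> (LINT x:K|lebesgue. (e / (I + 1)) * \<bar>F x\<bar>)"
        unfolding set_lebesgue_integral_def
      proof (rule Bochner_Integration.integral_norm_bound_integral[where 'b = real, unfolded real_norm_def])
        show "integrable lebesgue (\<lambda>x. indicat_real K x *\<^sub>R (F x * u j x - F x * w x))"
          using set_integral_diff(1)[OF iu] unfolding set_integrable_def .
        show "integrable lebesgue (\<lambda>x. indicat_real K x *\<^sub>R (e / (I + 1) * \<bar>F x\<bar>))"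
          using set_integrable_mult_right[of "e / (I + 1)", OF Fa] unfolding set_integrable_def .
      qed (use d in \<open>auto simp: indicator_def\<close>)
      also have "\<dots> = (e / (I + 1)) * I" by (simp add: I_def)
      also have "\<dots> < e" using e I by (simp add: field_simps)
      finally show ?case by (simp add: dist_real_def)
    qed
  qed
qed

section \<open>From test functions to vanishing almost everywhere\<close>

lemma integral_test_funs_zero_imp_Ckc:
  fixes h :: "real^'n::finite \<Rightarrow> real"
  assumes U: "open U" and \<eta>: "cutoff_profile \<eta>" and h: "locint U h"
    and z: "\<And>\<phi>. test_fun U \<phi> \<Longrightarrow> (LINT x:U|lebesgue. \<phi> x * h x) = 0"
    and u: "Ckc 0 U u"
  shows "(LINT x:U|lebesgue. h x * u x) = 0"
proof -
  obtain \<Phi> K where K: "compact K" "K \<subseteq> U" and \<Phi>: "\<And>j::nat. test_fun U (\<Phi> j)"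
    "\<And>j x. x \<notin> K \<Longrightarrow> \<Phi> j x = 0" "\<And>x. x \<notin> K \<Longrightarrow> u x = 0"
    "\<And>l. length l \<le> 0 \<Longrightarrow> uniform_limit K (\<lambda>j. pd l (\<Phi> j)) (pd l u) sequentially"
    by (rule test_fun_approximation[OF U \<eta> u]) (rule that; assumption)
  have "(\<lambda>j. LINT x:K|lebesgue. h x * \<Phi> j x) \<longlonglongrightarrow> (LINT x:K|lebesgue. h x * u x)"
  proof (rule set_integral_uniform_limit[OF _ K(1)])
    show "continuous_on K (\<Phi> j)" for j
      using \<Phi>(1)[of j] Ck_on_cont[of 0 UNIV "\<Phi> j"] by (auto simp: test_fun_def intro: continuous_on_subset)
  qed (use h K \<Phi>(4)[of "[]"] in \<open>auto simp: locint_def\<close>)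
  moreover have "(LINT x:K|lebesgue. h x * \<Phi> j x) = 0" for j
  proof -
    have "(LINT x:K|lebesgue. h x * \<Phi> j x) = (LINT x:U|lebesgue. h x * \<Phi> j x)"
      by (rule set_integral_eq_subset(1)[symmetric, OF K(2)]) (use \<Phi>(2) in auto)
    also have "\<dots> = 0" using z[OF \<Phi>(1)[of j]] by (simp add: mult.commute)
    finally show ?thesis .
  qed
  ultimately have "(LINT x:K|lebesgue. h x * u x) = 0"
    by (simp add: tendsto_const_iff)
  then show ?thesis
    using set_integral_eq_subset(1)[OF K(2), of "\<lambda>x. h x * u x"] \<Phi>(3) by simp
qed

text \<open>Tent functions of the distance to \<open>K\<close> decrease to its indicator and vanish
  outside one compact set. They are only continuous, which is why the hypothesis is stated for
  \<open>Ckc 0\<close>.\<close>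

lemma integral_Ckc_zero_imp_compact:
  fixes h :: "real^'n::finite \<Rightarrow> real"
  assumes U: "open U" and h: "locint U h"
    and z: "\<And>u. Ckc 0 U u \<Longrightarrow> (LINT x:U|lebesgue. h x * u x) = 0"
    and K: "compact K" "K \<subseteq> U"
  shows "(LINT x:K|lebesgue. h x) = 0"
proof (cases "K = {}")
  case False
  obtain e where e: "e > 0" "(\<Union>x\<in>K. cball x e) \<subseteq> U"
    using compact_subset_open_imp_cball_epsilon_subset[OF K(1) U K(2)] by blast
  define K1 where "K1 = {x + y | x y. x \<in> K \<and> y \<in> cball 0 e}"
  have K1: "compact K1" unfolding K1_def by (rule compact_sums[OF K(1) compact_cball])
  \<comment> \<open>A closest point of \<open>K\<close> exists only if \<open>K\<close> is nonempty;
    hence the case distinction.\<close>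
  have near: "x \<in> K1 \<and> x \<in> U" if "infdist x K \<le> e" for x
  proof -
    obtain y where y: "y \<in> K" "infdist x K = dist x y"
      using infdist_attains_inf[OF compact_imp_closed[OF K(1)] False] by blast
    have "x = y + (x - y)" "x - y \<in> cball 0 e" using y that by (auto simp: dist_norm norm_minus_commute)
    then have "x \<in> K1" unfolding K1_def using y(1) by blast
    moreover have "x \<in> cball y e" using y that by (simp add: dist_commute)
    then have "x \<in> U" using e(2) y(1) by blast
    ultimately show ?thesis by blast
  qed
  have K1U: "K1 \<subseteq> U"
  proof
    fix z assume "z \<in> K1"
    then obtain x y where "z = x + y" "x \<in> K" "y \<in> cball 0 e" unfolding K1_def by blast
    then have "z \<in> cball x e" by (simp add: dist_norm)
    then show "z \<in> U" using e(2) \<open>x \<in> K\<close> by blast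
  qed
  \<comment> \<open>Equal to 1 on \<open>K\<close> and to 0 at distance at least
    \<open>e / Suc j\<close> from it.\<close>
  define u where "u j x = max 0 (1 - real (Suc j) * (infdist x K / e))" for j x
  have uc: "continuous_on A (u j)" for A j
    unfolding u_def by (intro continuous_intros) (use e in auto)
  have u0: "u j x = 0" if "x \<notin> K1" for j x
  proof -
    have "1 \<le> infdist x K / e" using near[of x] that e(1) by fastforce
    then have "1 * 1 \<le> real (Suc j) * (infdist x K / e)" by (intro mult_mono) auto
    then show ?thesis by (simp add: u_def)
  qed
  have "Ckc 0 U (u j)" for j
    unfolding Ckc_def using uc K1 K1U u0 by auto
  then have "(LINT x:U|lebesgue. h x * u j x) = 0" for j by (rule z)
  then have I0: "(LINT x:K1|lebesgue. h x * u j x) = 0" for j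
    using set_integral_eq_subset(1)[OF K1U, of "\<lambda>x. h x * u j x" lebesgue] u0 by (metis mult_zero_right)
  have h1: "set_integrable lebesgue K1 h" using h K1 K1U unfolding locint_def by blast
  have KK1: "K \<subseteq> K1" using near e(1) by (metis infdist_zero less_imp_le subsetI)
  have "(\<lambda>j. LINT x:K1|lebesgue. h x * u j x) \<longlonglongrightarrow> (LINT x:K|lebesgue. h x)"
    unfolding set_lebesgue_integral_def
  proof (rule integral_dominated_convergence[where w = "\<lambda>x. \<bar>indicator K1 x *\<^sub>R h x\<bar>"])
    show "(\<lambda>x. indicat_real K x *\<^sub>R h x) \<in> borel_measurable lebesgue"
      using set_integrable_subset[OF h1 compact_sets_lebesgue[OF K(1)] KK1] unfolding set_integrable_def
      by (rule borel_measurable_integrable)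
    show "(\<lambda>x. indicat_real K1 x *\<^sub>R (h x * u j x)) \<in> borel_measurable lebesgue" for j
      using set_integrable_mult_continuous[OF h1 K1 uc] unfolding set_integrable_def
      by (rule borel_measurable_integrable)
    show "integrable lebesgue (\<lambda>x. \<bar>indicat_real K1 x *\<^sub>R h x\<bar>)"
      using h1 unfolding set_integrable_def by (rule integrable_abs)
    have "u j x \<in> {0..1}" for j x
      using e(1) infdist_nonneg[of x K] by (auto simp: u_def)
    then have "norm (indicat_real K1 x *\<^sub>R (h x * u j x)) \<le> \<bar>indicat_real K1 x *\<^sub>R h x\<bar>" for j x
      using mult_left_le[of "u j x" "\<bar>h x\<bar>"] by (auto simp: indicator_def abs_mult)
    then show "AE x in lebesgue. norm (indicat_real K1 x *\<^sub>R (h x * u j x)) \<le> \<bar>indicat_real K1 x *\<^sub>R h x\<bar>" for j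
      by simp
    have "(\<lambda>j. indicat_real K1 x *\<^sub>R (h x * u j x)) \<longlonglongrightarrow> indicat_real K x *\<^sub>R h x" for x
    proof (cases "x \<in> K")
      case True
      then have "u j x = 1" for j by (simp add: u_def)
      then show ?thesis using True KK1 by auto
    next
      case False
      then have "infdist x K > 0"
        using K(1) \<open>K \<noteq> {}\<close> compact_imp_closed in_closed_iff_infdist_zero infdist_nonneg
        by (metis less_eq_real_def)
      then have p: "infdist x K / e > 0" using e(1) by simp
      obtain N where N: "1 < real N * (infdist x K / e)" using reals_Archimedean3[OF p] by blast
      have "u j x = 0" if "j \<ge> N" for j
      proof -
        have "1 \<le> real N * (infdist x K / e)" using N by simp
        also have "\<dots> \<le> real (Suc j) * (infdist x K / e)" using p that by (intro mult_right_mono) auto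
        finally show ?thesis by (simp add: u_def)
      qed
      then have "\<forall>\<^sub>F j in sequentially. indicat_real K1 x *\<^sub>R (h x * u j x) = indicat_real K x *\<^sub>R h x"
        using False by (auto simp: eventually_sequentially)
      then show ?thesis by (rule tendsto_eventually)
    qed
    then show "AE x in lebesgue. (\<lambda>j. indicat_real K1 x *\<^sub>R (h x * u j x)) \<longlonglongrightarrow> indicat_real K x *\<^sub>R h x"
      by simp
  qed
  then show ?thesis by (simp add: I0 tendsto_const_iff)
qed (simp add: set_lebesgue_integral_def)

text \<open>Integrability is given on compact subsets only; an exhaustion of \<open>U\<close> by
  compact sets yields the function as a pointwise limit of measurable ones.\<close>

lemma locint_measurable:
  fixes h :: "real^'n::finite \<Rightarrow> real"
  assumes "open U" "locint U h"
  shows "set_borel_measurable lebesgue U h"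
proof -
  obtain D :: "nat \<Rightarrow> (real^'n) set" where D: "\<And>n. compact (D n)" "\<And>n. D n \<subseteq> U" "\<And>K. \<lbrakk>compact K; K \<subseteq> U\<rbrakk> \<Longrightarrow> \<exists>N. \<forall>n\<ge>N. K \<subseteq> D n"
    by (rule open_Union_compact_subsets[OF assms(1)]) (rule that; assumption)
  have "(\<lambda>x. indicator U x *\<^sub>R h x) \<in> borel_measurable lebesgue"
  proof (rule borel_measurable_LIMSEQ_real)
    show "(\<lambda>x. indicator (D n) x *\<^sub>R h x) \<in> borel_measurable lebesgue" for n
      using assms(2) D(1,2) unfolding locint_def set_integrable_def by (blast intro: borel_measurable_integrable)
    fix x
    show "(\<lambda>n. indicator (D n) x *\<^sub>R h x) \<longlonglongrightarrow> indicator U x *\<^sub>R h x"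
    proof (cases "x \<in> U")
      case True
      then obtain N where "\<And>n. n \<ge> N \<Longrightarrow> x \<in> D n" using D(3)[of "{x}"] by auto
      then have "\<forall>\<^sub>F n in sequentially. indicator (D n) x *\<^sub>R h x = indicator U x *\<^sub>R h x"
        using True by (auto simp: eventually_sequentially intro!: exI[of _ N])
      then show ?thesis by (rule tendsto_eventually)
    next
      case False
      then have "x \<notin> D n" for n using D(2) by blast
      then show ?thesis using False by simp
    qed
  qed
  then show ?thesis by (simp add: set_borel_measurable_def)
qed

text \<open>Over a compact subset of \<open>{h > 0}\<close> the integral is zero only if the subset
  is null. By inner regularity a set of positive measure cannot have only null compact
  subsets.\<close>

lemma integral_compact_zero_imp_nonpos:
  fixes h :: "real^'n::finite \<Rightarrow> real"
  assumes U: "open U" and h: "locint U h"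
    and z: "\<And>K. compact K \<Longrightarrow> K \<subseteq> U \<Longrightarrow> (LINT x:K|lebesgue. h x) = 0"
  shows "AE x in lebesgue. x \<in> U \<longrightarrow> h x \<le> 0"
proof -
  define P where "P = {x \<in> U. h x > 0}"
  have "{x \<in> space lebesgue. indicator U x *\<^sub>R h x > 0} \<in> sets lebesgue"
    using locint_measurable[OF U h] unfolding set_borel_measurable_def by measurable
  moreover have "{x \<in> space lebesgue. indicator U x *\<^sub>R h x > 0} = P"
    by (auto simp: P_def indicator_def)
  ultimately have P: "P \<in> sets lebesgue" by simp
  have null: "T \<in> null_sets lebesgue" if T: "compact T" "T \<subseteq> P" for T
  proof -
    have TU: "T \<subseteq> U" using T by (auto simp: P_def)
    have i: "integrable lebesgue (\<lambda>x. indicator T x *\<^sub>R h x)"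
      using h T(1) TU unfolding locint_def set_integrable_def by blast
    have "(LINT x|lebesgue. indicator T x *\<^sub>R h x) = 0"
      using z[OF T(1) TU] by (simp add: set_lebesgue_integral_def)
    then have "AE x in lebesgue. indicator T x *\<^sub>R h x = 0"
    proof (subst (asm) integral_nonneg_eq_0_iff_AE[OF i])
      show "AE x in lebesgue. 0 \<le> indicator T x *\<^sub>R h x"
        by (rule AE_I2) (use T(2) in \<open>auto simp: P_def indicator_def less_imp_le\<close>)
    qed
    then have "AE x in lebesgue. x \<notin> T"
      by eventually_elim (use T(2) in \<open>auto simp: P_def\<close>)
    then show ?thesis using compact_sets_lebesgue[OF T(1)] by (simp add: AE_iff_null_sets)
  qed
  have "emeasure lebesgue P = 0"
  proof (rule ccontr)
    assume ne: "emeasure lebesgue P \<noteq> 0"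
    \<comment> \<open>A finite positive lower bound, because the measure of \<open>P\<close> may be
      infinite.\<close>
    obtain e :: real where e: "e > 0" "ennreal e \<le> emeasure lebesgue P"
    proof (cases "emeasure lebesgue P")
      case (real r)
      then show ?thesis using that[of r] ne by (cases "r = 0") auto
    next
      case top
      then show ?thesis using that[of 1] by simp
    qed
    obtain T where T: "closed T" "T \<subseteq> P" "P - T \<in> lmeasurable" "emeasure lebesgue (P - T) < ennreal e"
      using sets_lebesgue_inner_closed[OF P e(1)] by blast
    \<comment> \<open>A closed set is a countable union of compact ones, and these are null.\<close>
    have "T \<inter> cball 0 (real n) \<in> null_sets lebesgue" for n
      using T by (intro null closed_Int_compact) auto
    then have "(\<Union>n. T \<inter> cball 0 (real n)) \<in> null_sets lebesgue" by (rule null_sets_UN)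
    moreover have "(\<Union>n. T \<inter> cball 0 (real n)) = T"
      by (auto simp: real_arch_simple)
    ultimately have "emeasure lebesgue T = 0" by auto
    moreover have "emeasure lebesgue P \<le> emeasure lebesgue (P - T) + emeasure lebesgue T"
      using emeasure_subadditive[of "P - T" lebesgue T] T P by (simp add: Un_absorb2 fmeasurableD)
    ultimately show False using T(4) e(2) by simp
  qed
  then have "P \<in> null_sets lebesgue" using P by auto
  from AE_not_in[OF this] show ?thesis by eventually_elim (auto simp: P_def not_less)
qed

text \<open>The two inequalities come from \<open>h\<close> and \<open>- h\<close>. The profile
  \<open>\<eta>\<close> enters as the source of a mollifier.\<close>

theorem fundamental_lemma_calculus_of_variations:
  fixes h :: "real^'n::finite \<Rightarrow> real"
  assumes "open U" and "cutoff_profile \<eta>" and h: "locint U h"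
    and z: "\<And>\<phi>. test_fun U \<phi> \<Longrightarrow> (LINT x:U|lebesgue. \<phi> x * h x) = 0"
  shows "AE x in lebesgue. x \<in> U \<longrightarrow> h x = 0"
proof -
  have c: "(LINT x:K|lebesgue. h x) = 0" if "compact K" "K \<subseteq> U" for K
    using integral_Ckc_zero_imp_compact[OF assms(1) h integral_test_funs_zero_imp_Ckc[OF assms] that] .
  have "locint U (\<lambda>x. - h x)" using locint_diff[OF locint_zero h] by simp
  moreover have "(LINT x:K|lebesgue. - h x) = 0" if "compact K" "K \<subseteq> U" for K
    using c[OF that] by (simp add: set_lebesgue_integral_def)
  ultimately have "AE x in lebesgue. x \<in> U \<longrightarrow> - h x \<le> 0"
    by (intro integral_compact_zero_imp_nonpos assms(1))
  moreover have "AE x in lebesgue. x \<in> U \<longrightarrow> h x \<le> 0"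
    by (intro integral_compact_zero_imp_nonpos assms(1) h c)
  ultimately show ?thesis by eventually_elim auto
qed

text \<open>Both candidates are tested against the same left-hand side, so their difference times
  \<open>v ^ (mi_abs \<alpha> + 1)\<close> annihilates all test functions, and \<open>v\<close> can
  be cancelled almost everywhere. As \<open>wdv\<close> is a choice, formulas for it rest on
  this.\<close>

lemma is_wdv_unique:
  assumes "open U" "cutoff_profile \<eta>" "Ck_on m U v" "AE x in lebesgue. x \<in> U \<longrightarrow> v x \<noteq> 0"
    and g: "is_wdv U v \<alpha> f g" and g': "is_wdv U v \<alpha> f g'"
  shows "AE x in lebesgue. x \<in> U \<longrightarrow> g x = g' x"
proof -
  let ?w = "\<lambda>x. v x ^ (mi_abs \<alpha> + 1)"
  have li: "locint U (\<lambda>x. g x * ?w x)" "locint U (\<lambda>x. g' x * ?w x)"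
    using g g' unfolding is_wdv_def Lp_w_loc_one_iff by auto
  have "AE x in lebesgue. x \<in> U \<longrightarrow> g x * ?w x - g' x * ?w x = 0"
  proof (rule fundamental_lemma_calculus_of_variations[OF assms(1,2) locint_diff[OF li]])
    fix \<phi> assume \<phi>: "test_fun U \<phi>"
    have "set_integrable lebesgue U (\<lambda>x. g x * ?w x * \<phi> x)" "set_integrable lebesgue U (\<lambda>x. g' x * ?w x * \<phi> x)"
      using locint_integrable_Ckc[OF _ test_fun_imp_Ckc[OF \<phi>]] li by auto
    then have "(LINT x:U|lebesgue. g x * ?w x * \<phi> x - g' x * ?w x * \<phi> x)
      = (LINT x:U|lebesgue. g x * ?w x * \<phi> x) - (LINT x:U|lebesgue. g' x * ?w x * \<phi> x)"
      by (rule set_integral_diff(2))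
    also have "(LINT x:U|lebesgue. g x * ?w x * \<phi> x) = (LINT x:U|lebesgue. g' x * ?w x * \<phi> x)"
    proof -
      have t: "(LINT x:U|lebesgue. f x * mderiv \<alpha> (\<lambda>y. ?w y * \<phi> y) x)
        = (- 1) ^ mi_abs \<alpha> * (LINT x:U|lebesgue. ?w x * \<phi> x * k x)" if "is_wdv U v \<alpha> f k" for k
        using that \<phi> unfolding is_wdv_def by blast
      from trans[OF t[OF g, symmetric] t[OF g']]
      have "(LINT x:U|lebesgue. ?w x * \<phi> x * g x) = (LINT x:U|lebesgue. ?w x * \<phi> x * g' x)" by simp
      then show ?thesis by (simp only: mult_ac)
    qed
    finally show "(LINT x:U|lebesgue. \<phi> x * (g x * ?w x - g' x * ?w x)) = 0"
      by (simp add: algebra_simps)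
  qed
  with assms(4) show ?thesis by eventually_elim auto
qed



section \<open>Products with a cut-off function\<close>

lemma Ckc_pd:
  assumes "Ckc k U \<psi>" "length l + j \<le> k"
  shows "Ckc j U (pd l \<psi>)"
proof -
  obtain K where K: "compact K" "K \<subseteq> U" "\<And>x. x \<notin> K \<Longrightarrow> \<psi> x = 0" and c: "Ck_on k UNIV \<psi>"
    using assms(1) unfolding Ckc_def by auto
  have "pd l \<psi> x = 0" if "x \<notin> K" for x
    using pd_cong[of "- K" \<psi> "\<lambda>_. 0" x l] K that by (simp add: compact_imp_closed open_Compl)
  then show ?thesis unfolding Ckc_def using Ck_on_pd[OF c assms(2)] K by blast
qed

lemma set_integral_sum_list:
  fixes F :: "'c \<Rightarrow> 'a \<Rightarrow> real"
  assumes "\<And>c. c \<in> set T \<Longrightarrow> set_integrable M A (F c)"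
  shows "set_integrable M A (\<lambda>x. \<Sum>c\<leftarrow>T. F c x)"
    and "(LINT x:A|M. (\<Sum>c\<leftarrow>T. F c x)) = (\<Sum>c\<leftarrow>T. LINT x:A|M. F c x)"
proof -
  have "set_integrable M A (\<lambda>x. \<Sum>c\<leftarrow>T. F c x) \<and> (LINT x:A|M. (\<Sum>c\<leftarrow>T. F c x)) = (\<Sum>c\<leftarrow>T. LINT x:A|M. F c x)"
    using assms
  proof (induction T)
    case Nil
    then show ?case by (simp add: set_integrable_def set_lebesgue_integral_def)
  qed (simp add: set_integral_add)
  then show "set_integrable M A (\<lambda>x. \<Sum>c\<leftarrow>T. F c x)"
    "(LINT x:A|M. (\<Sum>c\<leftarrow>T. F c x)) = (\<Sum>c\<leftarrow>T. LINT x:A|M. F c x)" by auto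
qed

section \<open>Weak derivatives on the set where the weight does not vanish\<close>

lemma open_nonzero_set:
  assumes "open U" "continuous_on U (v :: real^'n::finite \<Rightarrow> real)"
  shows "open {x \<in> U. v x \<noteq> 0}"
proof -
  have "{x \<in> U. v x \<noteq> 0} = U \<inter> v -` (- {0})" by auto
  then show ?thesis using continuous_open_preimage[OF assms(2,1), of "- {0}"] by (simp add: open_Compl)
qed

text \<open>On compact subsets of this open set \<open>v\<close> is bounded away from zero, so the
  power in the definition can be divided out.\<close>

lemma is_wdv_locint_nonzero_set:
  assumes "open U" "Ck_on m U v" "is_wdv U v \<alpha> f g"
  shows "locint {x \<in> U. v x \<noteq> 0} g"
proof -
  let ?W = "{x \<in> U. v x \<noteq> 0}" and ?w = "\<lambda>x. v x ^ (mi_abs \<alpha> + 1)"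
  have "locint U (\<lambda>x. g x * ?w x)" using assms(3) unfolding is_wdv_def Lp_w_loc_one_iff by blast
  then have "locint ?W (\<lambda>x. g x * ?w x)" by (rule locint_subset) auto
  moreover have "continuous_on ?W (\<lambda>x. inverse (?w x))"
    by (intro continuous_intros continuous_on_subset[OF Ck_on_cont[OF assms(2)]]) auto
  ultimately have "locint ?W (\<lambda>x. g x * ?w x * inverse (?w x))" by (rule locint_mult_continuous)
  then show ?thesis by (subst (asm) locint_cong[of _ _ g]) (auto simp: field_simps)
qed

text \<open>On the set where \<open>v \<noteq> 0\<close> one may divide the test function by \<open>v ^ (length l + 1)\<close>. The quotient is
  only finitely often differentiable, so the smooth test functions have to be replaced by \<open>C\<^sup>k\<close> ones first.\<close>

lemma wdv_nonzero_set_weak_deriv: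
  fixes f v :: "real^'n::finite \<Rightarrow> real"
  assumes U: "open U" and \<eta>: "cutoff_profile \<eta>" and v: "Ck_on m U v"
    and W: "W = {x \<in> U. v x \<noteq> 0}" and f: "locint W f" and l: "length l \<le> m"
    and g: "is_wdv U v (mi l) f g" and \<psi>: "Ckc (length l) W \<psi>"
  shows "(LINT x:W|lebesgue. f x * pd l \<psi> x) = (- 1) ^ length l * (LINT x:W|lebesgue. g x * \<psi> x)"
proof -
  let ?k = "length l"
  define w where "w x = v x ^ (?k + 1)" for x
  \<comment> \<open>\<open>mderiv\<close> differentiates along this word, which in general is only a
    permutation of \<open>l\<close>.\<close>
  define L where "L = word (mi l)"
  have L: "mi L = mi l" "length L = ?k" by (simp_all add: L_def)
  have oW: "open W" unfolding W by (rule open_nonzero_set[OF U Ck_on_cont[OF v]])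
  have WU: "W \<subseteq> U" unfolding W by auto
  have vk: "Ck_on ?k U v" using Ck_on_mono[OF v l] .
  have wk: "Ck_on ?k U w" unfolding w_def by (rule Ck_on_power[OF U vk])
  have wkW: "Ck_on ?k W w" using Ck_on_subset[OF wk WU] .
  define \<phi> where "\<phi> x = inverse (w x) * \<psi> x" for x
  have "Ck_on ?k W (\<lambda>x. inverse (w x))"
    by (rule Ck_on_inverse[OF oW wkW]) (auto simp: W w_def)
  then have \<phi>: "Ckc ?k W \<phi>" unfolding \<phi>_def by (rule Ckc_mult[OF oW _ \<psi>])
  have "w x \<noteq> 0" if "x \<in> W" for x using that by (simp add: W w_def)
  then have w\<phi>: "w x * \<phi> x = \<psi> x" if "x \<in> W" for x using that by (simp add: \<phi>_def)
  have gW: "locint W g" unfolding W by (rule is_wdv_locint_nonzero_set[OF U v g])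
  obtain \<Phi> K where K: "compact K" "K \<subseteq> W" and \<Phi>: "\<And>j::nat. test_fun W (\<Phi> j)"
    "\<And>j x. x \<notin> K \<Longrightarrow> \<Phi> j x = 0" "\<And>x. x \<notin> K \<Longrightarrow> \<phi> x = 0"
    "\<And>l. length l \<le> ?k \<Longrightarrow> uniform_limit K (\<lambda>j. pd l (\<Phi> j)) (pd l \<phi>) sequentially"
    by (rule test_fun_approximation[OF oW \<eta> \<phi>]) (rule that; assumption)
  have KU: "K \<subseteq> U" using K WU by blast
  have oK: "open (- K)" using K(1) by (simp add: compact_imp_closed open_Compl)
  have C\<Phi>: "Ck_on i UNIV (\<Phi> j)" for i j using \<Phi>(1)[of j] unfolding test_fun_def by blast
  have C\<phi>: "Ck_on ?k UNIV \<phi>" using \<phi> unfolding Ckc_def by blast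
  have \<psi>0: "\<psi> x = 0" if "x \<notin> K" for x
  proof (cases "x \<in> W")
    case True
    then show ?thesis using \<Phi>(3)[OF that] by (auto simp: \<phi>_def w_def W)
  next
    case False
    then show ?thesis using \<psi> unfolding Ckc_def by blast
  qed
  \<comment> \<open>Leibniz expansion of \<open>pd L\<close> of \<open>w * u\<close>. In this form
    uniform convergence of the derivatives of \<open>u\<close> passes to the product, since
    \<open>w\<close> contributes fixed continuous coefficients.\<close>
  define S where "S u x = (\<Sum>c\<leftarrow>splits L. pd (fst c) w x * pd (snd c) u x)" for u x
  have S: "pd L (\<lambda>y. w y * u y) x = S u x" if "Ck_on ?k UNIV u" "x \<in> U" for u x
    unfolding S_def using pd_mult[OF U wk Ck_on_subset[OF that(1)] _ that(2)] L
    by (simp add: case_prod_unfold)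
  have S0: "S u x = 0" if "x \<notin> K" "\<And>x. x \<notin> K \<Longrightarrow> u x = 0" for u x
  proof -
    have "pd b u x = 0" for b
      using pd_cong[OF oK, of u "\<lambda>_. 0" x b] that by auto
    then show ?thesis by (simp add: S_def)
  qed
  have len: "length a \<le> ?k" "length b \<le> ?k" if "(a, b) \<in> set (splits L)" for a b
    using splits_length[OF that] L by auto
  have wc: "continuous_on K (pd a w)" if "length a \<le> ?k" for a
    using continuous_on_subset[OF pd_continuous_on[OF wk that] KU] .
  have Sc: "continuous_on K (S u)" if "Ck_on ?k UNIV u" for u
  proof -
    have "continuous_on K (\<lambda>x. \<Sum>c\<leftarrow>T. pd (fst c) w x * pd (snd c) u x)" if "set T \<subseteq> set (splits L)" for T
      using that
    proof (induction T)
      case (Cons c T)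
      have "continuous_on K (pd (snd c) u)" "continuous_on K (pd (fst c) w)"
        using len[of "fst c" "snd c"] Cons.prems continuous_on_subset[OF pd_continuous_on[OF \<open>Ck_on ?k UNIV u\<close>], of "snd c" K] wc
        by auto
      then show ?case using Cons by (auto intro!: continuous_on_add continuous_on_mult)
    qed simp
    then show ?thesis unfolding S_def by simp
  qed
  have bd: "bounded (u ` K)" if "continuous_on K u" for u :: "real^'n \<Rightarrow> real"
    using compact_imp_bounded[OF compact_continuous_image[OF that K(1)]] .
  have Slim: "uniform_limit K (\<lambda>j. S (\<Phi> j)) (S \<phi>) sequentially"
    unfolding S_def
  proof (rule uniform_limit_sum_list)
    fix c assume c: "c \<in> set (splits L)"
    then have lc: "length (fst c) \<le> ?k" "length (snd c) \<le> ?k" using len[of "fst c" "snd c"] by auto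
    show "uniform_limit K (\<lambda>j x. pd (fst c) w x * pd (snd c) (\<Phi> j) x) (\<lambda>x. pd (fst c) w x * pd (snd c) \<phi> x) sequentially"
      by (rule uniform_lim_mult[OF uniform_limit_const \<Phi>(4)[OF lc(2)]])
        (use bd wc[OF lc(1)] continuous_on_subset[OF pd_continuous_on[OF C\<phi> lc(2)]] in auto)
  qed
  have fK: "set_integrable lebesgue K f" using f K unfolding locint_def by blast
  have gK: "set_integrable lebesgue K (\<lambda>x. g x * w x)"
    using gW K continuous_on_subset[OF Ck_on_cont[OF wk] KU] unfolding locint_def
    by (blast intro: set_integrable_mult_continuous)
  have lim1: "(\<lambda>j. LINT x:K|lebesgue. f x * S (\<Phi> j) x) \<longlonglongrightarrow> (LINT x:K|lebesgue. f x * S \<phi> x)"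
    by (rule set_integral_uniform_limit[OF fK K(1) Sc[OF C\<Phi>] Slim])
  have lim2: "(\<lambda>j. LINT x:K|lebesgue. (g x * w x) * \<Phi> j x) \<longlonglongrightarrow> (LINT x:K|lebesgue. (g x * w x) * \<phi> x)"
    using set_integral_uniform_limit[OF gK K(1) _ \<Phi>(4)[of "[]"]] continuous_on_subset[OF Ck_on_cont[OF C\<Phi>]]
    by auto
  \<comment> \<open>A test function in \<open>W\<close> is also one in \<open>U\<close>, so the
    definition of the weighted derivative applies to \<open>\<Phi> j\<close> itself; only the limit
    has finite smoothness.\<close>
  have eq: "(LINT x:K|lebesgue. f x * S (\<Phi> j) x) = (- 1) ^ ?k * (LINT x:K|lebesgue. (g x * w x) * \<Phi> j x)" for j
  proof -
    have t: "test_fun U (\<Phi> j)"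
      using \<Phi>(1)[of j] WU unfolding test_fun_def by blast
    have "(LINT x:K|lebesgue. f x * S (\<Phi> j) x) = (LINT x:U|lebesgue. f x * S (\<Phi> j) x)"
      by (rule set_integral_eq_subset(1)[symmetric, OF KU]) (use S0 \<Phi>(2) in auto)
    also have "\<dots> = (LINT x:U|lebesgue. f x * mderiv (mi l) (\<lambda>y. w y * \<Phi> j y) x)"
      by (rule set_lebesgue_integral_cong) (use U S[OF C\<Phi>] in \<open>auto simp: mderiv_eq_pd_word L_def\<close>)
    also have "\<dots> = (- 1) ^ ?k * (LINT x:U|lebesgue. w x * \<Phi> j x * g x)"
      using g t unfolding is_wdv_def w_def by simp
    also have "(LINT x:U|lebesgue. w x * \<Phi> j x * g x) = (LINT x:K|lebesgue. w x * \<Phi> j x * g x)"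
      by (rule set_integral_eq_subset(1)[OF KU]) (use \<Phi>(2) in auto)
    finally show ?thesis by (simp only: mult_ac)
  qed
  have "(LINT x:K|lebesgue. f x * S \<phi> x) = (- 1) ^ ?k * (LINT x:K|lebesgue. (g x * w x) * \<phi> x)"
    by (rule LIMSEQ_unique[OF lim1[unfolded eq] tendsto_mult_left[OF lim2]])
  also have "(LINT x:K|lebesgue. (g x * w x) * \<phi> x) = (LINT x:K|lebesgue. g x * \<psi> x)"
    by (rule set_lebesgue_integral_cong) (use K w\<phi> in \<open>auto simp: mult.assoc compact_imp_closed\<close>)
  also have "\<dots> = (LINT x:W|lebesgue. g x * \<psi> x)"
    by (rule set_integral_eq_subset(1)[symmetric, OF K(2)]) (use \<psi>0 in auto)
  \<comment> \<open>This rewrites the left-hand side: \<open>w * \<phi>\<close> equals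
    \<open>\<psi>\<close> on the open set \<open>W\<close> around \<open>K\<close>, which undoes the
    division.\<close>
  also have "(LINT x:K|lebesgue. f x * S \<phi> x) = (LINT x:K|lebesgue. f x * pd l \<psi> x)"
  proof (rule set_lebesgue_integral_cong)
    show "\<forall>x. x \<in> K \<longrightarrow> f x * S \<phi> x = f x * pd l \<psi> x"
    proof (intro allI impI)
      fix x assume x: "x \<in> K"
      have "S \<phi> x = pd L (\<lambda>y. w y * \<phi> y) x" using S[OF C\<phi>, of x] x KU by auto
      also have "\<dots> = pd L \<psi> x"
        by (rule pd_cong[OF oW]) (use x K w\<phi> in auto)
      also have "\<dots> = pd l \<psi> x"
        using \<psi> L by (intro pd_mi_cong[OF open_UNIV, of ?k]) (auto simp: Ckc_def)
      finally show "f x * S \<phi> x = f x * pd l \<psi> x" by simp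
    qed
  qed (use K in \<open>auto simp: compact_imp_closed\<close>)
  also have "\<dots> = (LINT x:W|lebesgue. f x * pd l \<psi> x)"
  proof (rule set_integral_eq_subset(1)[symmetric, OF K(2)])
    show "f x * pd l \<psi> x = 0" if "x \<notin> K" for x
      using pd_cong[OF oK, of \<psi> "\<lambda>_. 0" x l] \<psi>0 that by auto
  qed
  finally show ?thesis .
qed

section \<open>The Leibniz formula for a weakly differentiable function times a cut-off\<close>

lemma compact_Int_closedin:
  assumes "closedin (top_of_set U) C" "compact K" "K \<subseteq> U"
  shows "compact (K \<inter> C)"
proof -
  obtain F where "closed F" "C = U \<inter> F" using assms(1) by (auto simp: closedin_closed)
  then have "K \<inter> C = K \<inter> F" using assms(3) by auto
  then show ?thesis using \<open>closed F\<close> assms(2) by (simp add: compact_Int_closed)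
qed

text \<open>\<open>C\<close> is closed relative to \<open>U\<close>, so it meets each compact subset
  of \<open>U\<close> in a compact subset of \<open>W\<close>, where \<open>g\<close> is integrable.
  Compactness of \<open>C\<close> would be too much to ask: the support of a cut-off may reach the
  boundary of \<open>U\<close>.\<close>

lemma locint_cutoff:
  assumes C: "closedin (top_of_set U) C" "C \<subseteq> W" and g: "locint W g"
    and z: "continuous_on U z" "\<And>x. x \<in> U \<Longrightarrow> x \<notin> C \<Longrightarrow> z x = 0"
  shows "locint U (\<lambda>x. z x * g x)"
  unfolding locint_def
proof (intro allI impI)
  fix K assume K: "compact K \<and> K \<subseteq> U"
  have c: "compact (K \<inter> C)" using compact_Int_closedin[OF C(1)] K by auto
  have "set_integrable lebesgue (K \<inter> C) (\<lambda>x. g x * z x)"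
    using g C(2) c K continuous_on_subset[OF z(1), of "K \<inter> C"] unfolding locint_def
    by (intro set_integrable_mult_continuous) auto
  then show "set_integrable lebesgue K (\<lambda>x. z x * g x)"
    using set_integral_eq_subset(2)[of "K \<inter> C" K "\<lambda>x. z x * g x"] z(2) K by (auto simp: mult.commute)
qed

text \<open>\<open>G b\<close> stands for the weak derivative of \<open>G []\<close> along
  \<open>b\<close>; the sum is then the expected derivative of \<open>z * G []\<close> along
  \<open>l\<close>.\<close>

definition leibniz_sum :: "(real^'n::finite \<Rightarrow> real) \<Rightarrow> ('n list \<Rightarrow> real^'n \<Rightarrow> real) \<Rightarrow> 'n list \<Rightarrow> real^'n \<Rightarrow> real" where
  "leibniz_sum z G l x = (\<Sum>(a, b)\<leftarrow>splits l. pd a z x * G b x)"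

context
  fixes U W C :: "(real^'n::finite) set" and m :: nat and z :: "real^'n \<Rightarrow> real"
    and G :: "'n list \<Rightarrow> real^'n \<Rightarrow> real"
  assumes U: "open U" and W: "open W" "W \<subseteq> U"
    and C: "closedin (top_of_set U) C" "C \<subseteq> W"
    and z: "Ck_on m U z" "\<And>x. x \<in> U \<Longrightarrow> x \<notin> C \<Longrightarrow> z x = 0"
    and G: "\<And>b. length b \<le> m \<Longrightarrow> locint W (G b)"
begin

lemma pd_cutoff_zero: "pd a z x = 0" if "x \<in> U" "x \<notin> C"
proof -
  have "open (U - C)"
    using openin_open_trans[OF _ U] openin_diff[OF openin_subtopology_self C(1)] by (simp add: openin_open_eq[OF U])
  then show ?thesis using pd_cong[of "U - C" z "\<lambda>_. 0" x a] z(2) that by auto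
qed

lemma locint_leibniz_sum: "length l \<le> m \<Longrightarrow> locint U (leibniz_sum z G l)"
  unfolding leibniz_sum_def[abs_def] case_prod_unfold
proof (rule locint_sum_list)
  fix c assume l: "length l \<le> m" and "c \<in> set (splits l)"
  then have "length (fst c) \<le> m" "length (snd c) \<le> m"
    using splits_length[of "fst c" "snd c" l] by auto
  then show "locint U (\<lambda>x. pd (fst c) z x * G (snd c) x)"
    by (intro locint_cutoff[OF C G] pd_continuous_on[OF z(1)] pd_cutoff_zero)
qed

text \<open>By \<open>mult_pd_eq_sum_pd\<close>, \<open>z * pd l \<psi>\<close> is a signed sum of
  full derivatives of functions with compact support in \<open>W\<close>, to which \<open>id\<close>
  applies term by term. The signs of both subwords multiply to that of \<open>l\<close>.\<close>

lemma leibniz_cutoff: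
  assumes id: "\<And>b \<psi>. length b \<le> m \<Longrightarrow> Ckc (length b) W \<psi> \<Longrightarrow>
      (LINT x:W|lebesgue. G [] x * pd b \<psi> x) = (- 1) ^ length b * (LINT x:W|lebesgue. G b x * \<psi> x)"
    and l: "length l \<le> m" and \<psi>: "Ckc (length l) U \<psi>"
  shows "(LINT x:U|lebesgue. z x * G [] x * pd l \<psi> x) = (- 1) ^ length l * (LINT x:U|lebesgue. \<psi> x * leibniz_sum z G l x)"
proof -
  let ?k = "length l"
  define T where "T c y = \<psi> y * pd (fst c) z y" for c :: "'n list \<times> 'n list" and y
  have zk: "Ck_on ?k U z" by (rule Ck_on_mono[OF z(1) l])
  have \<psi>k: "Ck_on ?k U \<psi>" using \<psi> Ck_on_subset unfolding Ckc_def by blast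
  obtain K where K: "compact K" "K \<subseteq> U" "\<And>x. x \<notin> K \<Longrightarrow> \<psi> x = 0"
    using \<psi> unfolding Ckc_def by blast
  have T: "Ckc (length (snd c)) W (T c)" "length (snd c) \<le> m" "length (fst c) + length (snd c) = ?k"
    if c: "c \<in> set (splits l)" for c
  proof -
    show len: "length (fst c) + length (snd c) = ?k" using splits_length[of "fst c" "snd c"] c by simp
    then show "length (snd c) \<le> m" using l by simp
    show "Ckc (length (snd c)) W (T c)"
    proof (rule CkcI[OF W(1)])
      have "Ck_on (length (snd c)) U (T c)"
        unfolding T_def[abs_def]
        by (rule Ck_on_mult[OF U Ck_on_mono[OF \<psi>k] Ck_on_pd[OF zk]]) (use len in auto)
      then show "Ck_on (length (snd c)) W (T c)" using Ck_on_subset W(2) by blast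
      show "compact (K \<inter> C)" by (rule compact_Int_closedin[OF C(1) K(1,2)])
      show "K \<inter> C \<subseteq> W" using C(2) by blast
      show "T c x = 0" if "x \<notin> K \<inter> C" for x
        using that K pd_cutoff_zero[of x "fst c"] unfolding T_def by (cases "x \<in> K") auto
    qed
  qed
  have G0: "locint W (G [])" by (rule G) simp
  have i1: "set_integrable lebesgue W (\<lambda>x. (- 1) ^ length (fst c) * (G [] x * pd (snd c) (T c) x))"
    if "c \<in> set (splits l)" for c
    using locint_integrable_Ckc[OF G0 Ckc_pd[OF T(1)[OF that], of "snd c" 0]] by simp
  have i2: "set_integrable lebesgue W (\<lambda>x. G (snd c) x * T c x)" if "c \<in> set (splits l)" for c
    using locint_integrable_Ckc[OF G[OF T(2)[OF that]] Ckc_mono[OF T(1)[OF that]]] by simp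
  have "(LINT x:U|lebesgue. z x * G [] x * pd l \<psi> x) = (LINT x:W|lebesgue. z x * G [] x * pd l \<psi> x)"
    by (rule set_integral_eq_subset(1)[OF W(2)]) (use z(2) C(2) in auto)
  also have "\<dots> = (LINT x:W|lebesgue. (\<Sum>c\<leftarrow>splits l. (- 1) ^ length (fst c) * (G [] x * pd (snd c) (T c) x)))"
  proof (rule set_lebesgue_integral_cong)
    show "\<forall>x. x \<in> W \<longrightarrow> z x * G [] x * pd l \<psi> x
      = (\<Sum>c\<leftarrow>splits l. (- 1) ^ length (fst c) * (G [] x * pd (snd c) (T c) x))"
    proof (intro allI impI)
      fix x assume "x \<in> W"
      then have "z x * pd l \<psi> x = (\<Sum>c\<leftarrow>splits l. (- 1) ^ length (fst c) * pd (snd c) (T c) x)"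
        using mult_pd_eq_sum_pd[OF U zk \<psi>k, of l x] W(2) by (auto simp: T_def[abs_def] case_prod_unfold)
      then have "G [] x * (z x * pd l \<psi> x) = (\<Sum>c\<leftarrow>splits l. G [] x * ((- 1) ^ length (fst c) * pd (snd c) (T c) x))"
        by (simp add: sum_list_const_mult)
      then show "z x * G [] x * pd l \<psi> x = (\<Sum>c\<leftarrow>splits l. (- 1) ^ length (fst c) * (G [] x * pd (snd c) (T c) x))"
        by (simp only: mult_ac)
    qed
  qed (use W in auto)
  also have "\<dots> = (\<Sum>c\<leftarrow>splits l. LINT x:W|lebesgue. (- 1) ^ length (fst c) * (G [] x * pd (snd c) (T c) x))"
    by (rule set_integral_sum_list(2)[OF i1])
  also have "\<dots> = (\<Sum>c\<leftarrow>splits l. (- 1) ^ ?k * (LINT x:W|lebesgue. G (snd c) x * T c x))"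
  proof (rule arg_cong[where f = sum_list], rule map_cong[OF refl])
    fix c assume c: "c \<in> set (splits l)"
    have "(LINT x:W|lebesgue. (- 1) ^ length (fst c) * (G [] x * pd (snd c) (T c) x))
      = (- 1) ^ length (fst c) * ((- 1) ^ length (snd c) * (LINT x:W|lebesgue. G (snd c) x * T c x))"
      using id[OF T(2,1)[OF c]] by simp
    also have "\<dots> = (- 1) ^ ?k * (LINT x:W|lebesgue. G (snd c) x * T c x)"
      unfolding T(3)[OF c, symmetric] by (simp add: power_add)
    finally show "(LINT x:W|lebesgue. (- 1) ^ length (fst c) * (G [] x * pd (snd c) (T c) x))
      = (- 1) ^ ?k * (LINT x:W|lebesgue. G (snd c) x * T c x)" .
  qed
  also have "\<dots> = (- 1) ^ ?k * (LINT x:W|lebesgue. (\<Sum>c\<leftarrow>splits l. G (snd c) x * T c x))"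
    by (simp add: sum_list_const_mult set_integral_sum_list(2)[OF i2])
  also have "(\<lambda>x. \<Sum>c\<leftarrow>splits l. G (snd c) x * T c x) = (\<lambda>x. \<psi> x * leibniz_sum z G l x)"
    unfolding leibniz_sum_def T_def by (auto simp: case_prod_unfold mult_ac simp flip: sum_list_const_mult)
  also have "(LINT x:W|lebesgue. \<psi> x * leibniz_sum z G l x) = (LINT x:U|lebesgue. \<psi> x * leibniz_sum z G l x)"
  proof (rule set_integral_eq_subset(1)[symmetric, OF W(2)])
    show "\<psi> x * leibniz_sum z G l x = 0" if "x \<in> U" "x \<notin> W" for x
    proof -
      have "pd a z x = 0" for a using that C(2) by (intro pd_cutoff_zero) auto
      then show ?thesis by (simp add: leibniz_sum_def case_prod_unfold)
    qed
  qed
  finally show ?thesis .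
qed

end

section \<open>Linearity of the weighted derivative\<close>

lemma pd_power_mult_factor:
  assumes U: "open U" and v: "Ck_on k U v" and \<psi>: "Ck_on k U \<psi>"
  shows "length l \<le> k \<Longrightarrow> length l \<le> j \<Longrightarrow>
    \<exists>c. Ck_on (k - length l) U c \<and> (\<forall>x\<in>U. pd l (\<lambda>y. v y ^ j * \<psi> y) x = v x ^ (j - length l) * c x)"
proof (induction l)
  case Nil
  then show ?case using \<psi> by auto
next
  case (Cons i l)
  then obtain c where c: "Ck_on (k - length l) U c"
    "\<And>x. x \<in> U \<Longrightarrow> pd l (\<lambda>y. v y ^ j * \<psi> y) x = v x ^ (j - length l) * c x" by auto
  define k' where "k' = k - length (i # l)"
  define q where "q = j - length (i # l)"
  have k': "k - length l = Suc k'" and q: "j - length l = Suc q"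
    using Cons.prems by (auto simp: k'_def q_def)
  have c': "Ck_on k' U c" "Ck_on k' U (partial i c)"
    using c(1) Ck_on_Suc_imp unfolding k' by auto
  have v': "Ck_on k' U v" "Ck_on k' U (partial i v)"
    using Ck_on_mono[OF v, of k'] Ck_on_pd[OF v, of "[i]" k'] Cons.prems by (simp_all add: k'_def)
  have d: "v differentiable (at x)" "c differentiable (at x)" if "x \<in> U" for x
    using Ck_on_differentiable[OF v _ U that] Ck_on_differentiable[OF c(1) _ U that] Cons.prems k' by auto
  \<comment> \<open>The product rule on \<open>v ^ Suc q * c\<close> gives up one power of
    \<open>v\<close> and one order of smoothness of \<open>c\<close>; the cofactor of
    \<open>v ^ q\<close> is again of the required kind.\<close>
  let ?c = "\<lambda>x. real (Suc q) * (partial i v x * c x) + v x * partial i c x"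
  have "pd (i # l) (\<lambda>y. v y ^ j * \<psi> y) x = v x ^ q * ?c x" if x: "x \<in> U" for x
  proof -
    have "pd (i # l) (\<lambda>y. v y ^ j * \<psi> y) x = partial i (\<lambda>y. v y ^ Suc q * c y) x"
      using c(2) q x by (auto intro!: partial_cong[OF U])
    also have "\<dots> = partial i (\<lambda>y. v y ^ Suc q) x * c x + v x ^ Suc q * partial i c x"
      by (rule partial_mult[OF _ d(2)[OF x]]) (rule differentiable_power[OF d(1)[OF x]])
    also have "partial i (\<lambda>y. v y ^ Suc q) x = (real (Suc q) * v x ^ q) * partial i v x"
      by (rule partial_compose[OF d(1)[OF x]]) (use DERIV_pow[of "Suc q" "v x"] in simp)
    finally show ?thesis by (simp add: algebra_simps)
  qed
  moreover have "Ck_on k' U ?c"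
    using c' v' by (intro Ck_on_add[OF U] Ck_on_cmult[OF U] Ck_on_mult[OF U])
  ultimately show ?case unfolding k'_def[symmetric] q_def[symmetric] by blast
qed

text \<open>The absolute values agree, so only measurability is at stake. As \<open>f\<close> alone
  is not known to be measurable, the product is recovered as \<open>f * |v|\<close> times the sign
  of \<open>v\<close>.\<close>

lemma locint_mult_of_abs:
  assumes "open U" "continuous_on U v" "locint U (\<lambda>x. f x * \<bar>v x\<bar>)"
  shows "locint U (\<lambda>x. f x * v x)"
  unfolding locint_def
proof (intro allI impI)
  fix K assume K: "compact K \<and> K \<subseteq> U"
  then have i: "set_integrable lebesgue K (\<lambda>x. f x * \<bar>v x\<bar>)" using assms(3) unfolding locint_def by blast
  show "set_integrable lebesgue K (\<lambda>x. f x * v x)"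
  proof (rule set_integrable_bound[OF i])
    have "(\<lambda>x. indicator K x *\<^sub>R v x) \<in> borel_measurable lebesgue"
      using set_borel_measurable_continuous[of K v] K continuous_on_subset[OF assms(2)] borel_compact[of K]
      unfolding set_borel_measurable_def by blast
    then have m: "(\<lambda>x. sgn (indicator K x *\<^sub>R v x)) \<in> borel_measurable lebesgue"
      by (rule measurable_compose) (rule borel_measurable_sgn)
    have "(\<lambda>x. indicator K x *\<^sub>R (f x * \<bar>v x\<bar>)) \<in> borel_measurable lebesgue"
      using i unfolding set_integrable_def by (rule borel_measurable_integrable)
    from borel_measurable_times[OF this m]
    have "(\<lambda>x. (indicator K x *\<^sub>R (f x * \<bar>v x\<bar>)) * sgn (indicator K x *\<^sub>R v x)) \<in> borel_measurable lebesgue" .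
    moreover have "(\<lambda>x. (indicator K x *\<^sub>R (f x * \<bar>v x\<bar>)) * sgn (indicator K x *\<^sub>R v x)) = (\<lambda>x. indicator K x *\<^sub>R (f x * v x))"
      by (auto simp: indicator_def abs_mult_sgn mult.assoc)
    ultimately show "set_borel_measurable lebesgue K (\<lambda>x. f x * v x)" unfolding set_borel_measurable_def by simp
  qed (simp add: abs_mult)
qed

text \<open>Differentiating \<open>v ^ (k + 1) \<phi>\<close> at most \<open>k\<close> times leaves a factor \<open>v\<close>, which compensates that \<open>f\<close> itself
  need not be integrable near the zeros of \<open>v\<close>.\<close>

lemma integrable_mult_mderiv:
  assumes U: "open U" and v: "Ck_on (mi_abs \<alpha>) U v" and f: "locint U (\<lambda>x. f x * \<bar>v x\<bar>)" and \<phi>: "test_fun U \<phi>"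
  shows "set_integrable lebesgue U (\<lambda>x. f x * mderiv \<alpha> (\<lambda>y. v y ^ (mi_abs \<alpha> + 1) * \<phi> y) x)"
proof -
  obtain K where K: "compact K" "K \<subseteq> U" "\<And>x. x \<notin> K \<Longrightarrow> \<phi> x = 0" and c: "Ck_on (mi_abs \<alpha>) UNIV \<phi>"
    using test_fun_imp_Ckc[OF \<phi>] unfolding Ckc_def by blast
  let ?F = "\<lambda>x. f x * mderiv \<alpha> (\<lambda>y. v y ^ (mi_abs \<alpha> + 1) * \<phi> y) x"
  obtain c where c: "continuous_on U c"
    "\<And>x. x \<in> U \<Longrightarrow> mderiv \<alpha> (\<lambda>y. v y ^ (mi_abs \<alpha> + 1) * \<phi> y) x = v x * c x"
    using pd_power_mult_factor[OF U v Ck_on_subset[OF c], of "word \<alpha>" "mi_abs \<alpha> + 1"]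
    by (auto simp: mderiv_eq_pd_word)
  have "locint U (\<lambda>x. f x * v x * c x)"
    by (rule locint_mult_continuous[OF locint_mult_of_abs[OF U Ck_on_cont[OF v] f] c(1)])
  then have "locint U ?F"
    by (subst locint_cong[where g = "\<lambda>x. f x * v x * c x"]) (simp_all only: c(2) mult.assoc)
  then have "set_integrable lebesgue K ?F" using K unfolding locint_def by blast
  moreover have "?F x = 0" if "x \<in> U" "x \<notin> K" for x
  proof -
    have "open (- K)" using K(1) by (simp add: compact_imp_closed open_Compl)
    from pd_cong[OF this, of "\<lambda>y. v y ^ (mi_abs \<alpha> + 1) * \<phi> y" "\<lambda>_. 0" x] show ?thesis
      using K(3) that by (simp add: mderiv_eq_pd_word)
  qed
  ultimately show ?thesis using set_integral_eq_subset(2)[OF K(2), of ?F] by blast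
qed

text \<open>The integral of a nonintegrable function is 0 by convention, so splitting an integral
  needs integrability of both parts; \<open>integrable_mult_mderiv\<close> supplies it on the
  left-hand side of the identity.\<close>

lemma is_wdv_diff:
  assumes U: "open U" and v: "Ck_on (mi_abs \<alpha>) U v"
    and f: "locint U (\<lambda>x. f x * \<bar>v x\<bar>)" "locint U (\<lambda>x. f' x * \<bar>v x\<bar>)"
    and g: "is_wdv U v \<alpha> f g" "is_wdv U v \<alpha> f' g'"
  shows "is_wdv U v \<alpha> (\<lambda>x. f x - f' x) (\<lambda>x. g x - g' x)"
  unfolding is_wdv_def Lp_w_loc_one_iff
proof (intro conjI allI impI)
  let ?w = "\<lambda>x. v x ^ (mi_abs \<alpha> + 1)"
  have l: "locint U (\<lambda>x. g x * ?w x)" "locint U (\<lambda>x. g' x * ?w x)"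
    using g unfolding is_wdv_def Lp_w_loc_one_iff by auto
  show "locint U (\<lambda>x. (g x - g' x) * ?w x)"
    using locint_diff[OF l] by (simp only: left_diff_distrib)
  fix \<phi> assume \<phi>: "test_fun U \<phi>"
  let ?D = "mderiv \<alpha> (\<lambda>y. ?w y * \<phi> y)"
  have i: "set_integrable lebesgue U (\<lambda>x. ?w x * \<phi> x * g x)" "set_integrable lebesgue U (\<lambda>x. ?w x * \<phi> x * g' x)"
    using locint_integrable_Ckc[OF l(1) test_fun_imp_Ckc[OF \<phi>]] locint_integrable_Ckc[OF l(2) test_fun_imp_Ckc[OF \<phi>]]
    by (simp_all only: mult_ac)
  have "(LINT x:U|lebesgue. (f x - f' x) * ?D x) = (LINT x:U|lebesgue. f x * ?D x) - (LINT x:U|lebesgue. f' x * ?D x)"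
    unfolding left_diff_distrib
    by (rule set_integral_diff(2)[OF integrable_mult_mderiv[OF U v f(1) \<phi>] integrable_mult_mderiv[OF U v f(2) \<phi>]])
  also have "(LINT x:U|lebesgue. f x * ?D x) = (- 1) ^ mi_abs \<alpha> * (LINT x:U|lebesgue. ?w x * \<phi> x * g x)"
    using g(1) \<phi> unfolding is_wdv_def by blast
  also have "(LINT x:U|lebesgue. f' x * ?D x) = (- 1) ^ mi_abs \<alpha> * (LINT x:U|lebesgue. ?w x * \<phi> x * g' x)"
    using g(2) \<phi> unfolding is_wdv_def by blast
  also have "(- 1) ^ mi_abs \<alpha> * (LINT x:U|lebesgue. ?w x * \<phi> x * g x) - (- 1) ^ mi_abs \<alpha> * (LINT x:U|lebesgue. ?w x * \<phi> x * g' x)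
    = (- 1) ^ mi_abs \<alpha> * (LINT x:U|lebesgue. ?w x * \<phi> x * g x - ?w x * \<phi> x * g' x)"
    unfolding set_integral_diff(2)[OF i] by (rule right_diff_distrib[symmetric])
  finally show "(LINT x:U|lebesgue. (f x - f' x) * ?D x) = (- 1) ^ mi_abs \<alpha> * (LINT x:U|lebesgue. ?w x * \<phi> x * (g x - g' x))"
    by (simp only: right_diff_distrib)
qed



section \<open>Convergence in the weighted spaces\<close>

lemma Lp_w_unit: "Lp_w A p u f \<longleftrightarrow> Lp_w A p (\<lambda>_. 1) (\<lambda>x. f x * u x)"
  by (simp add: Lp_w_def)

lemma Lp_w_iff_nn_integral:
  assumes "0 < p"
  shows "Lp_w A p (\<lambda>_. 1) F \<longleftrightarrow> (\<lambda>x. indicator A x *\<^sub>R F x) \<in> borel_measurable lebesgue \<and>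
    (\<integral>\<^sup>+x. ennreal (\<bar>indicator A x *\<^sub>R F x\<bar> powr p) \<partial>lebesgue) < \<infinity>"
proof -
  have "ennreal (\<bar>F x * 1\<bar> powr p) * indicator A x = ennreal (\<bar>indicator A x *\<^sub>R F x\<bar> powr p)" for x
    using assms by (auto simp: indicator_def)
  then show ?thesis by (simp add: Lp_w_def set_borel_measurable_def)
qed

lemma Lp_w_dominated:
  assumes "0 < p" "Lp_w A p (\<lambda>_. 1) Q" "set_borel_measurable lebesgue A F"
    and le: "AE x in lebesgue. x \<in> A \<longrightarrow> \<bar>F x\<bar> \<le> \<bar>Q x\<bar>"
  shows "Lp_w A p (\<lambda>_. 1) F"
  unfolding Lp_w_iff_nn_integral[OF assms(1)]
proof
  show "(\<lambda>x. indicator A x *\<^sub>R F x) \<in> borel_measurable lebesgue"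
    using assms(3) by (simp add: set_borel_measurable_def)
  have "(\<integral>\<^sup>+x. ennreal (\<bar>indicator A x *\<^sub>R F x\<bar> powr p) \<partial>lebesgue)
    \<le> (\<integral>\<^sup>+x. ennreal (\<bar>indicator A x *\<^sub>R Q x\<bar> powr p) \<partial>lebesgue)"
    by (rule nn_integral_mono_AE, use le in eventually_elim)
      (use assms(1) in \<open>auto simp: indicator_def intro!: ennreal_leI powr_mono2\<close>)
  also have "\<dots> < \<infinity>" using assms(2) unfolding Lp_w_iff_nn_integral[OF assms(1)] by blast
  finally show "(\<integral>\<^sup>+x. ennreal (\<bar>indicator A x *\<^sub>R F x\<bar> powr p) \<partial>lebesgue) < \<infinity>" .
qed

text \<open>A crude constant is enough, since only finiteness of the integral of a sum is drawn from
  it.\<close>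

lemma abs_add_powr_le:
  fixes a b :: real
  assumes "0 < p"
  shows "\<bar>a + b\<bar> powr p \<le> 2 powr p * (\<bar>a\<bar> powr p + \<bar>b\<bar> powr p)"
proof -
  have "\<bar>a + b\<bar> powr p \<le> (2 * max \<bar>a\<bar> \<bar>b\<bar>) powr p"
    using assms by (intro powr_mono2) auto
  also have "\<dots> = 2 powr p * max \<bar>a\<bar> \<bar>b\<bar> powr p" by (rule powr_mult)
  also have "\<dots> \<le> 2 powr p * (\<bar>a\<bar> powr p + \<bar>b\<bar> powr p)"
    by (intro mult_left_mono) (auto simp: max_def)
  finally show ?thesis .
qed

lemma borel_measurable_ennreal_abs_powr:
  fixes g :: "'a \<Rightarrow> real"
  shows "g \<in> borel_measurable M \<Longrightarrow> (\<lambda>x. ennreal (\<bar>g x\<bar> powr p)) \<in> borel_measurable M"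
  by measurable

lemma Lp_w_add:
  assumes p: "0 < p" and "Lp_w A p (\<lambda>_. 1) F" "Lp_w A p (\<lambda>_. 1) G"
  shows "Lp_w A p (\<lambda>_. 1) (\<lambda>x. F x + G x)"
  unfolding Lp_w_iff_nn_integral[OF p]
proof
  have m: "(\<lambda>x. indicator A x *\<^sub>R F x) \<in> borel_measurable lebesgue" "(\<lambda>x. indicator A x *\<^sub>R G x) \<in> borel_measurable lebesgue"
    and fin: "(\<integral>\<^sup>+x. ennreal (\<bar>indicator A x *\<^sub>R F x\<bar> powr p) \<partial>lebesgue) < \<infinity>"
      "(\<integral>\<^sup>+x. ennreal (\<bar>indicator A x *\<^sub>R G x\<bar> powr p) \<partial>lebesgue) < \<infinity>"
    using assms unfolding Lp_w_iff_nn_integral[OF p] by auto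
  show "(\<lambda>x. indicator A x *\<^sub>R (F x + G x)) \<in> borel_measurable lebesgue"
    unfolding scaleR_add_right using m by (rule borel_measurable_add)
  note mF = borel_measurable_ennreal_abs_powr[OF m(1), of p] and mG = borel_measurable_ennreal_abs_powr[OF m(2), of p]
  have "(\<integral>\<^sup>+x. ennreal (\<bar>indicator A x *\<^sub>R (F x + G x)\<bar> powr p) \<partial>lebesgue)
    \<le> (\<integral>\<^sup>+x. ennreal (2 powr p) * (ennreal (\<bar>indicator A x *\<^sub>R F x\<bar> powr p) + ennreal (\<bar>indicator A x *\<^sub>R G x\<bar> powr p)) \<partial>lebesgue)"
    unfolding scaleR_add_right
    by (intro nn_integral_mono) (auto simp flip: ennreal_plus ennreal_mult intro!: ennreal_leI abs_add_powr_le p)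
  also have "\<dots> = ennreal (2 powr p) * ((\<integral>\<^sup>+x. ennreal (\<bar>indicator A x *\<^sub>R F x\<bar> powr p) \<partial>lebesgue)
      + (\<integral>\<^sup>+x. ennreal (\<bar>indicator A x *\<^sub>R G x\<bar> powr p) \<partial>lebesgue))"
    by (simp only: nn_integral_cmult[OF borel_measurable_add[OF mF mG]] nn_integral_add[OF mF mG])
  also have "\<dots> < \<infinity>" using fin by (simp add: ennreal_mult_less_top)
  finally show "(\<integral>\<^sup>+x. ennreal (\<bar>indicator A x *\<^sub>R (F x + G x)\<bar> powr p) \<partial>lebesgue) < \<infinity>" .
qed

lemma Lp_w_cmult:
  assumes p: "0 < p" and "Lp_w A p (\<lambda>_. 1) F"
  shows "Lp_w A p (\<lambda>_. 1) (\<lambda>x. c * F x)"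
  unfolding Lp_w_iff_nn_integral[OF p]
proof
  have m: "(\<lambda>x. indicator A x *\<^sub>R F x) \<in> borel_measurable lebesgue"
    and fin: "(\<integral>\<^sup>+x. ennreal (\<bar>indicator A x *\<^sub>R F x\<bar> powr p) \<partial>lebesgue) < \<infinity>"
    using assms unfolding Lp_w_iff_nn_integral[OF p] by auto
  have eq: "indicator A x *\<^sub>R (c * F x) = c * (indicator A x *\<^sub>R F x)" for x by simp
  show "(\<lambda>x. indicator A x *\<^sub>R (c * F x)) \<in> borel_measurable lebesgue"
    unfolding eq using m by (intro borel_measurable_times borel_measurable_const)
  have "(\<integral>\<^sup>+x. ennreal (\<bar>indicator A x *\<^sub>R (c * F x)\<bar> powr p) \<partial>lebesgue)
    = (\<integral>\<^sup>+x. ennreal (\<bar>c\<bar> powr p) * ennreal (\<bar>indicator A x *\<^sub>R F x\<bar> powr p) \<partial>lebesgue)"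
    unfolding eq abs_mult by (simp add: powr_mult ennreal_mult)
  also have "\<dots> = ennreal (\<bar>c\<bar> powr p) * (\<integral>\<^sup>+x. ennreal (\<bar>indicator A x *\<^sub>R F x\<bar> powr p) \<partial>lebesgue)"
    by (rule nn_integral_cmult[OF borel_measurable_ennreal_abs_powr[OF m]])
  also have "\<dots> < \<infinity>" using fin by (simp add: ennreal_mult_less_top)
  finally show "(\<integral>\<^sup>+x. ennreal (\<bar>indicator A x *\<^sub>R (c * F x)\<bar> powr p) \<partial>lebesgue) < \<infinity>" .
qed

lemma Lp_w_abs:
  assumes "0 < p" "Lp_w A p (\<lambda>_. 1) F"
  shows "Lp_w A p (\<lambda>_. 1) (\<lambda>x. \<bar>F x\<bar>)"
proof (rule Lp_w_dominated[OF assms])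
  have "(\<lambda>x. \<bar>indicator A x *\<^sub>R F x\<bar>) \<in> borel_measurable lebesgue"
    using assms(2) unfolding Lp_w_iff_nn_integral[OF assms(1)] by (auto intro: borel_measurable_abs)
  moreover have "(\<lambda>x. \<bar>indicator A x *\<^sub>R F x\<bar>) = (\<lambda>x. indicator A x *\<^sub>R \<bar>F x\<bar>)"
    by (auto simp: indicator_def)
  ultimately show "set_borel_measurable lebesgue A (\<lambda>x. \<bar>F x\<bar>)" by (simp add: set_borel_measurable_def)
qed simp

lemma Lp_w_sum_list:
  assumes "0 < p" "\<And>c. c \<in> set T \<Longrightarrow> Lp_w A p (\<lambda>_. 1) (F c)"
  shows "Lp_w A p (\<lambda>_. 1) (\<lambda>x. \<Sum>c\<leftarrow>T. F c x)"
  using assms(2)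
proof (induction T)
  case Nil
  then show ?case using assms(1) by (simp add: Lp_w_iff_nn_integral)
qed (auto intro: Lp_w_add[OF assms(1)])

text \<open>Measurability passes to an almost everywhere equal function because Lebesgue measure is
  complete.\<close>

lemma Lp_w_cong_AE:
  fixes F G u :: "real^'n::finite \<Rightarrow> real"
  assumes "0 < p" "Lp_w A p u F" "AE x in lebesgue. x \<in> A \<longrightarrow> F x = G x"
  shows "Lp_w A p u G"
proof -
  have F: "Lp_w A p (\<lambda>_. 1) (\<lambda>x. F x * u x)" using assms(2) by (simp add: Lp_w_unit[of A p u])
  have "(\<lambda>x. indicator A x *\<^sub>R (G x * u x)) \<in> borel_measurable lebesgue"
  proof (rule borel_measurable_AE)
    show "(\<lambda>x. indicator A x *\<^sub>R (F x * u x)) \<in> borel_measurable lebesgue"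
      using F unfolding Lp_w_iff_nn_integral[OF assms(1)] by blast
    show "AE x in lebesgue. indicator A x *\<^sub>R (F x * u x) = indicator A x *\<^sub>R (G x * u x)"
      using assms(3) by eventually_elim (auto simp: indicator_def)
  qed
  then have "Lp_w A p (\<lambda>_. 1) (\<lambda>x. G x * u x)"
    by (intro Lp_w_dominated[OF assms(1) F]) (use assms(3) in \<open>auto simp: set_borel_measurable_def\<close>)
  then show ?thesis by (simp add: Lp_w_unit[of A p u])
qed

lemma Lp_w_pow_cong_AE:
  assumes "AE x in lebesgue. x \<in> A \<longrightarrow> F x = G x"
  shows "Lp_w_pow A p u F = Lp_w_pow A p u G"
  unfolding Lp_w_pow_def
  by (rule arg_cong[where f = enn2real], rule nn_integral_cong_AE, use assms in eventually_elim)
    (auto simp: indicator_def)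

text \<open>Dominated convergence for the \<open>p\<close>-th powers; eventual vanishing at almost
  every point provides the pointwise limit.\<close>

lemma Lp_w_pow_tendsto_zero:
  fixes Q :: "real^'n::finite \<Rightarrow> real"
  assumes p: "0 < p" and Q: "Lp_w A p (\<lambda>_. 1) Q"
    and m: "\<And>n. set_borel_measurable lebesgue A (\<lambda>x. R n x * u x)"
    and le: "\<And>n x. x \<in> A \<Longrightarrow> \<bar>R n x * u x\<bar> \<le> \<bar>Q x\<bar>"
    and lim: "AE x in lebesgue. x \<in> A \<longrightarrow> (\<forall>\<^sub>F n in sequentially. R n x * u x = 0)"
  shows "(\<lambda>n::nat. Lp_w_pow A p u (R n)) \<longlonglongrightarrow> 0"
proof -
  let ?N = "\<lambda>F x. ennreal (\<bar>indicator A x *\<^sub>R F x\<bar> powr p)"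
  have eq: "ennreal (\<bar>F x * u x\<bar> powr p) * indicator A x = ?N (\<lambda>x. F x * u x) x" for F x
    using p by (auto simp: indicator_def)
  have [measurable]: "(\<lambda>x. indicator A x *\<^sub>R (R n x * u x)) \<in> borel_measurable lebesgue" for n
    using m[of n] by (simp add: set_borel_measurable_def)
  have [measurable]: "(\<lambda>x. indicator A x *\<^sub>R Q x) \<in> borel_measurable lebesgue"
    using Q unfolding Lp_w_iff_nn_integral[OF p] by blast
  have "(\<lambda>n. \<integral>\<^sup>+x. ?N (\<lambda>x. R n x * u x) x \<partial>lebesgue) \<longlonglongrightarrow> (\<integral>\<^sup>+(x::real^'n). 0 \<partial>lebesgue)"
  proof (rule nn_integral_dominated_convergence[where w = "?N Q"])
    show "AE x in lebesgue. ?N (\<lambda>x. R n x * u x) x \<le> ?N Q x" for n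
      using le p by (auto simp: indicator_def intro!: ennreal_leI powr_mono2)
    show "(\<integral>\<^sup>+x. ?N Q x \<partial>lebesgue) < \<infinity>"
      using Q unfolding Lp_w_iff_nn_integral[OF p] by blast
    show "AE x in lebesgue. (\<lambda>n. ?N (\<lambda>x. R n x * u x) x) \<longlonglongrightarrow> 0"
      using lim
    proof eventually_elim
      case (elim x)
      show ?case
      proof (cases "x \<in> A")
        case True
        with elim have "\<forall>\<^sub>F n in sequentially. R n x * u x = 0" by blast
        then have "\<forall>\<^sub>F n in sequentially. ?N (\<lambda>x. R n x * u x) x = 0"
          by eventually_elim (simp add: p)
        then show ?thesis by (rule tendsto_eventually)
      qed (simp add: p)
    qed
  qed measurable
  then have "(\<lambda>n. \<integral>\<^sup>+x. ?N (\<lambda>x. R n x * u x) x \<partial>lebesgue) \<longlonglongrightarrow> 0" by simp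
  then have "(\<lambda>n. enn2real (\<integral>\<^sup>+x. ?N (\<lambda>x. R n x * u x) x \<partial>lebesgue)) \<longlonglongrightarrow> enn2real 0"
    using tendsto_enn2real[where F = sequentially and l = 0] by simp
  then show ?thesis by (simp add: Lp_w_pow_def eq)
qed

text \<open>Exactly one splitting has an empty first word. This allows \<open>G l\<close> to be
  subtracted inside the Leibniz sum.\<close>

lemma sum_splits_Nil:
  fixes F :: "'a list \<Rightarrow> real"
  shows "(\<Sum>(a, b)\<leftarrow>splits l. (if a = [] then F b else 0)) = F l"
proof (induction l arbitrary: F)
  case (Cons i l)
  show ?case unfolding sum_list_splits_Cons using Cons[of "\<lambda>b. F (i # b)"] by (simp add: case_prod_unfold)
qed simp

lemma cutoff_profile_values:
  assumes "cutoff_profile \<eta>"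
  shows "1 < \<bar>t\<bar> \<Longrightarrow> \<eta> t = 1" "\<bar>t\<bar> \<le> 1 / 2 \<Longrightarrow> \<eta> t = 0"
proof -
  show "\<eta> t = 1" if "1 < \<bar>t\<bar>"
  proof -
    have "t \<notin> {-1..1}" using that by auto
    then show ?thesis using assms unfolding cutoff_profile_def by blast
  qed
  show "\<eta> t = 0" if "\<bar>t\<bar> \<le> 1 / 2"
  proof -
    have "t \<in> {-1/2..1/2}" using that by auto
    then show ?thesis using assms unfolding cutoff_profile_def by blast
  qed
qed

section \<open>The product of the cut-off with \<open>f\<close> and its derivatives\<close>

locale cutoff_setting =
  fixes U :: "(real^'n::finite) set" and v :: "real^'n \<Rightarrow> real"
    and s :: "'n mindex \<Rightarrow> real" and \<eta> :: "real \<Rightarrow> real"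
    and p :: real and m :: nat and f :: "real^'n \<Rightarrow> real" and C :: real
  assumes U: "open U" and p: "1 \<le> p"
    and v: "Ck_on m U v" and v_nonzero: "AE x in lebesgue. x \<in> U \<longrightarrow> v x \<noteq> 0"
    and adm: "admissible m s" and \<eta>: "cutoff_profile \<eta>" and C: "0 < C"
    and annulus: "\<And>n \<sigma> x. \<lbrakk>1 \<le> n; 1 \<le> mi_abs \<sigma>; mi_abs \<sigma> \<le> m; x \<in> Mset U v n - Mset U v (2 * n)\<rbrakk> \<Longrightarrow>
      \<bar>mderiv \<sigma> v x\<bar> \<le> C * real n powr (s \<sigma> - 1)"
    and f: "f \<in> W_sv U m p s v"
begin

abbreviation V :: "'n mindex \<Rightarrow> real^'n \<Rightarrow> real" where
  "V \<equiv> s_weights s v"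

abbreviation W :: "(real^'n) set" where
  "W \<equiv> {x \<in> U. v x \<noteq> 0}"

definition G :: "'n list \<Rightarrow> real^'n \<Rightarrow> real" where
  "G b = wdv U v (mi b) f"

text \<open>Candidate for the weak derivative along \<open>l\<close> of
  \<open>chi \<eta> v n * f\<close>, in the ordinary and in the weighted sense alike.\<close>

definition H :: "nat \<Rightarrow> 'n list \<Rightarrow> real^'n \<Rightarrow> real" where
  "H n = leibniz_sum (chi \<eta> v n) G"

text \<open>Described through \<open>v\<close> and not as the closure of the points where the
  cut-off is nonzero, so that relative closedness and a lower bound for \<open>|v|\<close> come at
  once.\<close>

definition support :: "nat \<Rightarrow> (real^'n) set" where
  "support n = {x \<in> U. 1 / (2 * real n) \<le> \<bar>v x\<bar>}"

lemma p0: "0 < p" using p by simp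

lemma s_zero: "s (\<lambda>_. 0) = 0"
  using admissible_bounds[OF adm, of "[]"] by simp

lemma V_zero: "V (\<lambda>_. 0) = (\<lambda>x. \<bar>v x\<bar>)"
  by (simp add: s_weights_def s_zero)

lemma f_loc: "locint U (\<lambda>x. f x * \<bar>v x\<bar>)"
  using f unfolding W_sv_def W_Vv_def V_zero Lp_w_loc_one_iff by simp

lemma G_Nil [simp]: "G [] = f"
  by (simp add: G_def wdv_def mi_abs_def)

lemma is_wdv_G:
  assumes "b \<noteq> []" "length b \<le> m"
  shows "is_wdv U v (mi b) f (G b)"
proof -
  have "1 \<le> mi_abs (mi b) \<and> mi_abs (mi b) \<le> m" using assms by (cases b) auto
  then have "\<exists>g. is_wdv U v (mi b) f g" using f unfolding W_sv_def W_Vv_def by blast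
  then have "is_wdv U v (mi b) f (SOME g. is_wdv U v (mi b) f g)" by (rule someI_ex)
  then show ?thesis using assms by (simp add: G_def wdv_def)
qed

lemma Lp_G: "length b \<le> m \<Longrightarrow> Lp_w U p (\<lambda>_. 1) (\<lambda>x. G b x * V (mi b) x)"
proof (cases "b = []")
  case True
  then show ?thesis using f Lp_w_unit[of U p "V (mi b)" f] unfolding W_sv_def W_Vv_def by simp
next
  case False
  assume "length b \<le> m"
  then have "1 \<le> mi_abs (mi b) \<and> mi_abs (mi b) \<le> m" using False by (cases b) auto
  then have "Lp_w U p (V (mi b)) (G b)" using f unfolding W_sv_def W_Vv_def G_def by blast
  then show ?thesis by (simp add: Lp_w_unit[of U p "V (mi b)"])
qed

lemma open_W: "open W" by (rule open_nonzero_set[OF U Ck_on_cont[OF v]])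

lemma W_subset: "W \<subseteq> U" by auto

lemma locint_G:
  assumes "length b \<le> m"
  shows "locint W (G b)"
proof (cases "b = []")
  case True
  have "locint W (\<lambda>x. f x * \<bar>v x\<bar>)" by (rule locint_subset[OF f_loc]) auto
  moreover have "continuous_on W (\<lambda>x. inverse \<bar>v x\<bar>)"
    by (intro continuous_intros continuous_on_subset[OF Ck_on_cont[OF v]]) auto
  ultimately have "locint W (\<lambda>x. f x * \<bar>v x\<bar> * inverse \<bar>v x\<bar>)" by (rule locint_mult_continuous)
  then show ?thesis using True by (subst (asm) locint_cong[of _ _ f]) auto
next
  case False
  then show ?thesis using is_wdv_locint_nonzero_set[OF U v is_wdv_G] assms by blast
qed

lemma G_weak_deriv:
  assumes "length b \<le> m" "Ckc (length b) W \<psi>"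
  shows "(LINT x:W|lebesgue. G [] x * pd b \<psi> x) = (- 1) ^ length b * (LINT x:W|lebesgue. G b x * \<psi> x)"
proof (cases "b = []")
  case False
  then show ?thesis
    using wdv_nonzero_set_weak_deriv[OF U \<eta> v refl _ assms(1) is_wdv_G[OF _ assms(1)] assms(2)] locint_G[of "[]"]
    by simp
qed simp

lemma Ck_on_chi: "Ck_on m U (chi \<eta> v n)"
  unfolding chi_def using \<eta> by (intro Ck_on_compose[OF U Ck_on_cmult[OF U v]]) (simp add: cutoff_profile_def)

lemma closedin_support: "closedin (top_of_set U) (support n)"
proof -
  have "closedin (top_of_set U) (U \<inter> (\<lambda>x. \<bar>v x\<bar>) -` {1 / (2 * real n)..})"
    by (intro continuous_closedin_preimage continuous_on_rabs Ck_on_cont[OF v]) auto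
  moreover have "U \<inter> (\<lambda>x. \<bar>v x\<bar>) -` {1 / (2 * real n)..} = support n" by (auto simp: support_def)
  ultimately show ?thesis by simp
qed

context
  fixes n :: nat
  assumes n: "1 \<le> n"
begin

lemma support_subset_W: "support n \<subseteq> W"
  using n by (auto simp: support_def)

lemma chi_zero: "chi \<eta> v n x = 0" if "x \<in> U" "x \<notin> support n"
proof -
  have "\<bar>real n * v x\<bar> \<le> 1 / 2" using that n by (simp add: support_def abs_mult field_simps)
  then show ?thesis unfolding chi_def by (rule cutoff_profile_values(2)[OF \<eta>])
qed

text \<open>Listed in the order of the assumptions under which \<open>leibniz_cutoff\<close> and its
  companions are proved, so that they discharge them in one go.\<close>

lemmas cutoff_facts = U open_W W_subset closedin_support support_subset_W Ck_on_chi chi_zero locint_G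

lemma locint_H: "length l \<le> m \<Longrightarrow> locint U (H n l)"
  unfolding H_def by (rule locint_leibniz_sum[OF cutoff_facts])

lemma pd_chi_zero: "x \<in> U \<Longrightarrow> x \<notin> support n \<Longrightarrow> pd a (chi \<eta> v n) x = 0"
  by (rule pd_cutoff_zero[OF cutoff_facts])

lemma H_Nil: "H n [] = (\<lambda>x. chi \<eta> v n x * f x)"
  by (auto simp: H_def leibniz_sum_def)

lemma H_weak_deriv:
  assumes "length l \<le> m" "Ckc (length l) U \<psi>"
  shows "(LINT x:U|lebesgue. chi \<eta> v n x * f x * pd l \<psi> x) = (- 1) ^ length l * (LINT x:U|lebesgue. \<psi> x * H n l x)"
proof -
  have "(LINT x:U|lebesgue. chi \<eta> v n x * G [] x * pd l \<psi> x) = (- 1) ^ length l * (LINT x:U|lebesgue. \<psi> x * H n l x)"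
    unfolding H_def by (rule leibniz_cutoff[OF cutoff_facts G_weak_deriv assms])
  then show ?thesis by simp
qed

lemma is_weak_deriv_H:
  assumes "mi_abs \<alpha> \<le> m"
  shows "is_weak_deriv U \<alpha> (\<lambda>x. chi \<eta> v n x * f x) (H n (word \<alpha>))"
  unfolding is_weak_deriv_def Lp_w_loc_one_iff mderiv_eq_pd_word
proof (intro conjI allI impI)
  fix \<phi> assume "test_fun U \<phi>"
  then show "(LINT x:U|lebesgue. chi \<eta> v n x * f x * pd (word \<alpha>) \<phi> x)
    = (- 1) ^ mi_abs \<alpha> * (LINT x:U|lebesgue. \<phi> x * H n (word \<alpha>) x)"
    using H_weak_deriv[of "word \<alpha>" \<phi>] assms test_fun_imp_Ckc[of U \<phi> "mi_abs \<alpha>"] by simp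
qed (use assms locint_H[of "word \<alpha>"] locint_H[of "[]"] in \<open>simp_all add: H_Nil\<close>)

text \<open>The function tested against is here \<open>v ^ (mi_abs \<alpha> + 1) * \<phi>\<close>,
  whose smoothness is limited by that of \<open>v\<close>; \<open>H_weak_deriv\<close> is stated for
  \<open>Ckc\<close> functions so as to cover this case together with the ordinary
  derivative.\<close>

lemma is_wdv_H:
  assumes "mi_abs \<alpha> \<le> m"
  shows "is_wdv U v \<alpha> (\<lambda>x. chi \<eta> v n x * f x) (H n (word \<alpha>))"
  unfolding is_wdv_def Lp_w_loc_one_iff mderiv_eq_pd_word
proof (intro conjI allI impI)
  let ?w = "\<lambda>x. v x ^ (mi_abs \<alpha> + 1)"
  have w: "Ck_on m U ?w" by (rule Ck_on_power[OF U v])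
  show "locint U (\<lambda>x. H n (word \<alpha>) x * ?w x)"
    by (rule locint_mult_continuous[OF locint_H Ck_on_cont[OF w]]) (use assms in simp)
  fix \<phi> assume "test_fun U \<phi>"
  then have "Ckc (length (word \<alpha>)) U (\<lambda>y. ?w y * \<phi> y)"
    by (intro Ckc_mult[OF U _ test_fun_imp_Ckc]) (use w assms Ck_on_mono in auto)
  from H_weak_deriv[OF _ this] assms
  show "(LINT x:U|lebesgue. chi \<eta> v n x * f x * pd (word \<alpha>) (\<lambda>y. ?w y * \<phi> y) x)
    = (- 1) ^ mi_abs \<alpha> * (LINT x:U|lebesgue. ?w x * \<phi> x * H n (word \<alpha>) x)" by simp
qed

end

section \<open>Error terms and their domination\<close>

definition err :: "nat \<Rightarrow> 'n list \<Rightarrow> real^'n \<Rightarrow> real" where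
  "err n a x = pd a (chi \<eta> v n) x - (if a = [] then 1 else 0)"

text \<open>\<open>err\<close> amounts to differentiating \<open>chi \<eta> v n - 1\<close>.
  Subtracting 1 from the cut-off inside the sum leaves terms that vanish off
  \<open>Mset U v n\<close>.\<close>

lemma H_minus_G: "H n l x - G l x = (\<Sum>(a, b)\<leftarrow>splits l. err n a x * G b x)"
proof -
  have "(\<Sum>(a, b)\<leftarrow>splits l. err n a x * G b x)
    = (\<Sum>(a, b)\<leftarrow>splits l. pd a (chi \<eta> v n) x * G b x - (if a = [] then G b x else 0))"
    by (intro arg_cong[where f = sum_list] map_cong) (auto simp: err_def algebra_simps)
  also have "\<dots> = H n l x - G l x"
    using sum_splits_Nil[of "\<lambda>b. G b x" l]
    by (simp add: H_def leibniz_sum_def case_prod_unfold sum_list_subtractf)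
  finally show ?thesis by simp
qed

text \<open>Off \<open>Mset U v n\<close> the cut-off is locally 1, and on
  \<open>Mset U v (2 * n)\<close> its derivatives vanish. Errors of positive order thus live on the
  annulus, where \<open>pd_compose_bound\<close> applies.\<close>

lemma err_bound:
  obtains B where "\<And>a. length a \<le> m \<Longrightarrow> 0 \<le> B a"
    "\<And>a n x. \<lbrakk>length a \<le> m; 1 \<le> n; x \<in> U\<rbrakk> \<Longrightarrow> \<bar>err n a x\<bar> \<le> B a * real n powr s (mi a)"
    "\<And>a n x. \<lbrakk>length a \<le> m; 1 \<le> n; x \<in> U; x \<notin> Mset U v n\<rbrakk> \<Longrightarrow> err n a x = 0"
    "\<And>a n x. \<lbrakk>length a \<le> m; a \<noteq> []; 1 \<le> n; x \<in> U; x \<in> Mset U v (2 * n)\<rbrakk> \<Longrightarrow> err n a x = 0"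
proof -
  have sm: "smooth_real \<eta>" using \<eta> by (simp add: cutoff_profile_def)
  have "\<forall>a. length a \<le> m \<longrightarrow> (\<exists>B\<ge>0. \<forall>n\<ge>1. \<forall>x\<in>Mset U v n - Mset U v (2 * n). \<bar>pd a (chi \<eta> v n) x\<bar> \<le> B * real n powr s (mi a))"
    using pd_compose_bound[OF U v adm less_imp_le[OF C] annulus sm] unfolding chi_def by blast
  then obtain B where B: "\<And>a. length a \<le> m \<Longrightarrow> 0 \<le> B a"
    "\<And>a n x. \<lbrakk>length a \<le> m; 1 \<le> n; x \<in> Mset U v n - Mset U v (2 * n)\<rbrakk> \<Longrightarrow> \<bar>pd a (chi \<eta> v n) x\<bar> \<le> B a * real n powr s (mi a)"
    by metis
  have outer: "err n a x = 0" if "length a \<le> m" "1 \<le> n" "x \<in> U" "x \<notin> Mset U v n" for a n x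
  proof -
    let ?O = "U \<inter> (\<lambda>x. \<bar>v x\<bar>) -` {1 / real n<..}"
    have "open ?O"
      using continuous_open_preimage[OF continuous_on_rabs[OF Ck_on_cont[OF v]] U open_greaterThan] .
    moreover have "chi \<eta> v n y = 1" if "y \<in> ?O" for y
    proof -
      have "\<bar>real n * v y\<bar> > 1" using that \<open>1 \<le> n\<close> by (simp add: abs_mult field_simps)
      then show ?thesis unfolding chi_def by (rule cutoff_profile_values(1)[OF \<eta>])
    qed
    moreover have "x \<in> ?O" using that by (auto simp: Mset_def)
    ultimately have "pd a (chi \<eta> v n) x = pd a (\<lambda>_. 1) x" by (intro pd_cong) auto
    then show ?thesis by (auto simp: err_def pd_const)
  qed
  have inner: "err n a x = 0" if "length a \<le> m" "a \<noteq> []" "1 \<le> n" "x \<in> U" "x \<in> Mset U v (2 * n)" for a n x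
  proof -
    have "\<bar>real n * v x\<bar> \<le> 1 / 2" using that by (simp add: Mset_def abs_mult field_simps)
    then have "(deriv ^^ j) \<eta> (real n * v x) = 0" for j
      by (intro cutoff_profile_flat[OF \<eta>]) auto
    then have "pd a (chi \<eta> v n) x = 0"
      unfolding chi_def using that by (intro pd_compose_flat[OF U v _ sm])
    then show ?thesis using that by (simp add: err_def)
  qed
  \<comment> \<open>The undifferentiated error equals \<open>- 1\<close> on
    \<open>Mset U v (2 * n)\<close>, which the annulus bound does not see; it is at most 1 in
    absolute value because the cut-off takes values between 0 and 1.\<close>
  define B' where "B' a = (if a = [] then 1 else B a)" for a
  show ?thesis
  proof (rule that[of B'])
    show "0 \<le> B' a" if "length a \<le> m" for a using B(1) that by (simp add: B'_def)
    show "\<bar>err n a x\<bar> \<le> B' a * real n powr s (mi a)" if "length a \<le> m" "1 \<le> n" "x \<in> U" for a n x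
    proof (cases "a = []")
      case True
      have "0 \<le> chi \<eta> v n x \<and> chi \<eta> v n x \<le> 1" using \<eta> by (simp add: chi_def cutoff_profile_def)
      then show ?thesis using True that(2) by (auto simp: err_def B'_def s_zero)
    next
      case False
      show ?thesis
      proof (cases "x \<in> Mset U v n - Mset U v (2 * n)")
        case True
        then show ?thesis using B(2)[OF that(1,2)] False by (simp add: err_def B'_def)
      next
        case no: False
        then have "err n a x = 0" using inner[OF that(1) False that(2,3)] outer[OF that] by blast
        then show ?thesis using B(1)[OF that(1)] False by (simp add: B'_def)
      qed
    qed
  qed (use outer inner in auto)
qed

text \<open>The exponent of the weight for \<open>l\<close> exceeds that for \<open>b\<close> by
  some \<open>d \<ge> s (mi a)\<close>. As \<open>|v x| \<le> 1 / n\<close> on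
  \<open>Mset U v n\<close>, the surplus \<open>|v x| powr d\<close> compensates even
  \<open>n powr d\<close>.\<close>

lemma powr_weight_le:
  assumes l: "length l \<le> m" and ab: "(a, b) \<in> set (splits l)"
    and n: "1 \<le> n" and x: "x \<in> Mset U v n" "v x \<noteq> 0"
  shows "real n powr s (mi a) * V (mi l) x \<le> V (mi b) x"
proof -
  have sup: "s (mi a) + s (mi b) \<le> s (mi l)" by (rule admissible_superadditive[OF adm ab l])
  have sa: "0 \<le> s (mi a)" using admissible_bounds[OF adm, of a] splits_length[OF ab] l by simp
  define d where "d = s (mi l) - s (mi b)"
  have d: "s (mi a) \<le> d" "0 \<le> d" using sup sa by (auto simp: d_def)
  have "s (mi l) + 1 = (s (mi b) + 1) + d" by (simp add: d_def)
  then have "V (mi l) x = V (mi b) x * \<bar>v x\<bar> powr d"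
    by (simp add: s_weights_def powr_add)
  moreover have "real n powr s (mi a) * \<bar>v x\<bar> powr d \<le> 1"
  proof -
    have "real n powr s (mi a) * \<bar>v x\<bar> powr d \<le> real n powr d * (1 / real n) powr d"
      using n x d by (intro mult_mono powr_mono powr_mono2) (auto simp: Mset_def)
    also have "\<dots> = 1" using n by (simp flip: powr_mult)
    finally show ?thesis .
  qed
  ultimately have "real n powr s (mi a) * V (mi l) x = V (mi b) x * (real n powr s (mi a) * \<bar>v x\<bar> powr d)"
    by simp
  also have "\<dots> \<le> V (mi b) x * 1"
    by (rule mult_left_mono) (use \<open>real n powr s (mi a) * \<bar>v x\<bar> powr d \<le> 1\<close> in \<open>auto simp: s_weights_def\<close>)
  finally show ?thesis by simp
qed

text \<open>By \<open>powr_weight_le\<close> each summand of \<open>H_minus_G\<close> is at most a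
  constant times a weighted derivative of \<open>f\<close>, uniformly in \<open>n\<close>.\<close>

lemma H_minus_G_dominated:
  assumes l: "length l \<le> m"
  obtains Q where "Lp_w U p (\<lambda>_. 1) Q"
    "\<And>n x. 1 \<le> n \<Longrightarrow> x \<in> U \<Longrightarrow> \<bar>(H n l x - G l x) * V (mi l) x\<bar> \<le> \<bar>Q x\<bar>"
    "\<And>n x. 1 \<le> n \<Longrightarrow> x \<in> U \<Longrightarrow> x \<notin> Mset U v n \<Longrightarrow> (H n l x - G l x) * V (mi l) x = 0"
proof -
  obtain B where B: "\<And>a. length a \<le> m \<Longrightarrow> 0 \<le> B a"
    "\<And>a n x. \<lbrakk>length a \<le> m; 1 \<le> n; x \<in> U\<rbrakk> \<Longrightarrow> \<bar>err n a x\<bar> \<le> B a * real n powr s (mi a)"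
    "\<And>a n x. \<lbrakk>length a \<le> m; 1 \<le> n; x \<in> U; x \<notin> Mset U v n\<rbrakk> \<Longrightarrow> err n a x = 0"
    by (rule err_bound) (rule that; assumption)
  define Q where "Q x = (\<Sum>c\<leftarrow>splits l. B (fst c) * \<bar>G (snd c) x * V (mi (snd c)) x\<bar>)" for x
  have len: "length (fst c) \<le> m" "length (snd c) \<le> m" if "c \<in> set (splits l)" for c
    using splits_length[of "fst c" "snd c" l] that l by auto
  have "Lp_w U p (\<lambda>_. 1) Q"
    unfolding Q_def[abs_def] using len by (intro Lp_w_sum_list Lp_w_cmult Lp_w_abs Lp_G p0)
  moreover have van: "(H n l x - G l x) * V (mi l) x = 0" if "1 \<le> n" "x \<in> U" "x \<notin> Mset U v n" for n x
  proof -
    have "(\<Sum>(a, b)\<leftarrow>splits l. err n a x * G b x) = (\<Sum>c\<leftarrow>splits l. 0)"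
      using B(3)[OF _ that] len by (intro arg_cong[where f = sum_list] map_cong) auto
    then show ?thesis by (simp add: H_minus_G)
  qed
  moreover have "\<bar>(H n l x - G l x) * V (mi l) x\<bar> \<le> \<bar>Q x\<bar>" if nx: "1 \<le> n" "x \<in> U" for n x
  proof (cases "x \<in> Mset U v n \<and> v x \<noteq> 0")
    case True
    have "\<bar>(H n l x - G l x) * V (mi l) x\<bar> = \<bar>\<Sum>c\<leftarrow>splits l. err n (fst c) x * G (snd c) x * V (mi l) x\<bar>"
      by (simp add: H_minus_G case_prod_unfold sum_list_mult_const)
    also have "\<dots> \<le> (\<Sum>c\<leftarrow>splits l. \<bar>err n (fst c) x * G (snd c) x * V (mi l) x\<bar>)"
      using sum_list_abs[of "map (\<lambda>c. err n (fst c) x * G (snd c) x * V (mi l) x) (splits l)"] by (simp add: o_def)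
    also have "\<dots> \<le> Q x"
      unfolding Q_def
    proof (rule sum_list_mono)
      fix c assume c: "c \<in> set (splits l)"
      have V0: "0 \<le> V \<alpha> x" for \<alpha> by (simp add: s_weights_def)
      have w: "real n powr s (mi (fst c)) * V (mi l) x \<le> V (mi (snd c)) x"
        using powr_weight_le[OF l _ nx(1), of "fst c" "snd c" x] c True by simp
      have "\<bar>err n (fst c) x * G (snd c) x * V (mi l) x\<bar> = \<bar>err n (fst c) x\<bar> * \<bar>G (snd c) x\<bar> * V (mi l) x"
        using V0 by (simp add: abs_mult)
      also have "\<dots> \<le> B (fst c) * real n powr s (mi (fst c)) * \<bar>G (snd c) x\<bar> * V (mi l) x"
        using B(2)[OF len(1)[OF c] nx] V0 by (intro mult_right_mono) auto
      also have "\<dots> = B (fst c) * \<bar>G (snd c) x\<bar> * (real n powr s (mi (fst c)) * V (mi l) x)" by simp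
      also have "\<dots> \<le> B (fst c) * \<bar>G (snd c) x\<bar> * V (mi (snd c)) x"
        using w B(1)[OF len(1)[OF c]] by (intro mult_left_mono) auto
      also have "\<dots> = B (fst c) * \<bar>G (snd c) x * V (mi (snd c)) x\<bar>"
        using V0 by (simp add: abs_mult)
      finally show "\<bar>err n (fst c) x * G (snd c) x * V (mi l) x\<bar> \<le> B (fst c) * \<bar>G (snd c) x * V (mi (snd c)) x\<bar>" .
    qed
    finally show ?thesis by simp
  next
    case False
    \<comment> \<open>Either the error terms vanish, or \<open>v x = 0\<close> and the weight is a
      power of 0, which is 0.\<close>
    then have "(H n l x - G l x) * V (mi l) x = 0" using van[OF nx] by (auto simp: s_weights_def)
    then show ?thesis by (simp only: abs_zero abs_ge_zero)
  qed
  ultimately show ?thesis using that by blast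
qed

lemma V_measurable: "set_borel_measurable lebesgue U (V \<alpha>)"
proof -
  have "(\<lambda>x. indicator U x *\<^sub>R v x) \<in> borel_measurable lebesgue"
    using set_borel_measurable_continuous[OF _ Ck_on_cont[OF v]] U by (simp add: set_borel_measurable_def)
  then have "(\<lambda>x. \<bar>indicator U x *\<^sub>R v x\<bar> powr (s \<alpha> + 1)) \<in> borel_measurable lebesgue" by measurable
  moreover have "indicat_real U \<in> borel_measurable lebesgue"
    by (rule borel_measurable_indicator) (use U in simp)
  ultimately have "(\<lambda>x. indicator U x *\<^sub>R (\<bar>indicator U x *\<^sub>R v x\<bar> powr (s \<alpha> + 1))) \<in> borel_measurable lebesgue"
    by (rule borel_measurable_scaleR[rotated])
  moreover have "(\<lambda>x. indicator U x *\<^sub>R (\<bar>indicator U x *\<^sub>R v x\<bar> powr (s \<alpha> + 1))) = (\<lambda>x. indicator U x *\<^sub>R V \<alpha> x)"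
    by (auto simp: indicator_def s_weights_def)
  ultimately show ?thesis by (simp add: set_borel_measurable_def)
qed

lemma H_minus_G_measurable:
  assumes "1 \<le> n" "length l \<le> m"
  shows "set_borel_measurable lebesgue U (\<lambda>x. (H n l x - G l x) * V (mi l) x)"
proof -
  have "set_borel_measurable lebesgue U (\<lambda>x. H n l x * V (mi l) x)"
    using locint_measurable[OF U locint_H[OF assms]] V_measurable by (rule set_borel_measurable_times)
  moreover have "set_borel_measurable lebesgue U (\<lambda>x. G l x * V (mi l) x)"
    using Lp_G[OF assms(2)] by (simp add: Lp_w_def)
  ultimately show ?thesis
    unfolding set_borel_measurable_def left_diff_distrib scaleR_diff_right by (rule borel_measurable_diff)
qed

lemma Lp_H_weighted:
  assumes "1 \<le> n" "length l \<le> m"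
  shows "Lp_w U p (V (mi l)) (H n l)"
proof -
  obtain Q where Q: "Lp_w U p (\<lambda>_. 1) Q"
    "\<And>n x. 1 \<le> n \<Longrightarrow> x \<in> U \<Longrightarrow> \<bar>(H n l x - G l x) * V (mi l) x\<bar> \<le> \<bar>Q x\<bar>"
    by (rule H_minus_G_dominated[OF assms(2)]) (rule that; assumption)
  have "Lp_w U p (\<lambda>_. 1) (\<lambda>x. (H n l x - G l x) * V (mi l) x)"
    by (rule Lp_w_dominated[OF p0 Q(1) H_minus_G_measurable[OF assms]]) (use Q(2) assms in auto)
  from Lp_w_add[OF p0 this Lp_G[OF assms(2)]]
  have "Lp_w U p (\<lambda>_. 1) (\<lambda>x. H n l x * V (mi l) x)" by (simp add: left_diff_distrib)
  then show ?thesis by (simp add: Lp_w_unit[of U p "V (mi l)"])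
qed

text \<open>The bound may depend on \<open>n\<close> here. On \<open>support n\<close> the weight
  for \<open>b\<close> is at least \<open>(2 * n) powr - (s (mi b) + 1)\<close> and can be inserted
  at the cost of a constant; elsewhere the cut-off and its derivatives vanish.\<close>

lemma Lp_H:
  assumes n: "1 \<le> n" and l: "length l \<le> m"
  shows "Lp_w U p (\<lambda>_. 1) (H n l)"
proof -
  obtain B where B: "\<And>a. length a \<le> m \<Longrightarrow> 0 \<le> B a"
    "\<And>a n x. \<lbrakk>length a \<le> m; 1 \<le> n; x \<in> U\<rbrakk> \<Longrightarrow> \<bar>err n a x\<bar> \<le> B a * real n powr s (mi a)"
    by (rule err_bound) (rule that; assumption)
  \<comment> \<open>The summand 1 restores what \<open>err\<close> subtracts from the cut-off; the
    last factor is the reciprocal of the lower bound for the weight on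
    \<open>support n\<close>.\<close>
  define K where "K c = (B (fst c) * real n powr s (mi (fst c)) + 1) * (2 * real n) powr (s (mi (snd c)) + 1)" for c
  define Q where "Q x = (\<Sum>c\<leftarrow>splits l. K c * \<bar>G (snd c) x * V (mi (snd c)) x\<bar>)" for x
  have len: "length (fst c) \<le> m" "length (snd c) \<le> m" if "c \<in> set (splits l)" for c
    using splits_length[of "fst c" "snd c" l] that l by auto
  have K0: "0 \<le> K c" if "c \<in> set (splits l)" for c
    using B(1)[OF len(1)[OF that]] by (simp add: K_def)
  have Q: "Lp_w U p (\<lambda>_. 1) Q"
    unfolding Q_def[abs_def] using len by (intro Lp_w_sum_list Lp_w_cmult Lp_w_abs Lp_G p0)
  have "\<bar>H n l x\<bar> \<le> \<bar>Q x\<bar>" if x: "x \<in> U" for x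
  proof -
    have "\<bar>H n l x\<bar> \<le> (\<Sum>c\<leftarrow>splits l. \<bar>pd (fst c) (chi \<eta> v n) x * G (snd c) x\<bar>)"
      using sum_list_abs[of "map (\<lambda>c. pd (fst c) (chi \<eta> v n) x * G (snd c) x) (splits l)"]
      by (simp add: H_def leibniz_sum_def case_prod_unfold o_def)
    also have "\<dots> \<le> Q x"
      unfolding Q_def
    proof (rule sum_list_mono)
      fix c assume c: "c \<in> set (splits l)"
      show "\<bar>pd (fst c) (chi \<eta> v n) x * G (snd c) x\<bar> \<le> K c * \<bar>G (snd c) x * V (mi (snd c)) x\<bar>"
      proof (cases "x \<in> support n")
        case True
        have "\<bar>pd (fst c) (chi \<eta> v n) x\<bar> \<le> \<bar>err n (fst c) x\<bar> + 1" by (auto simp: err_def)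
        then have 1: "\<bar>pd (fst c) (chi \<eta> v n) x\<bar> \<le> B (fst c) * real n powr s (mi (fst c)) + 1"
          using B(2)[OF len(1)[OF c] n x] by simp
        have sb: "0 \<le> s (mi (snd c)) + 1"
          using admissible_bounds[OF adm len(2)[OF c]] by simp
        have "1 \<le> 2 * real n * \<bar>v x\<bar>" using True n by (simp add: support_def field_simps)
        then have "1 \<le> (2 * real n * \<bar>v x\<bar>) powr (s (mi (snd c)) + 1)" using sb by (rule ge_one_powr_ge_zero)
        also have "\<dots> = (2 * real n) powr (s (mi (snd c)) + 1) * V (mi (snd c)) x"
          by (simp add: s_weights_def powr_mult)
        finally have 2: "1 \<le> (2 * real n) powr (s (mi (snd c)) + 1) * V (mi (snd c)) x" .
        have V0: "0 \<le> V (mi (snd c)) x" by (simp add: s_weights_def)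
        have "\<bar>pd (fst c) (chi \<eta> v n) x * G (snd c) x\<bar> = \<bar>pd (fst c) (chi \<eta> v n) x\<bar> * 1 * \<bar>G (snd c) x\<bar>" by (simp add: abs_mult)
        also have "\<dots> \<le> (B (fst c) * real n powr s (mi (fst c)) + 1)
            * ((2 * real n) powr (s (mi (snd c)) + 1) * V (mi (snd c)) x) * \<bar>G (snd c) x\<bar>"
          using 1 2 by (intro mult_right_mono mult_mono) auto
        also have "\<dots> = K c * \<bar>G (snd c) x * V (mi (snd c)) x\<bar>"
          using V0 by (simp add: K_def abs_mult)
        finally show ?thesis .
      next
        case False
        then show ?thesis using pd_chi_zero[OF n x] K0[OF c] by simp
      qed
    qed
    finally show ?thesis by simp
  qed
  then show ?thesis
    by (intro Lp_w_dominated[OF p0 Q locint_measurable[OF U locint_H[OF n l]]]) auto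
qed

text \<open>The second premise treats order zero, where \<open>wdv\<close> returns the function
  itself and not a choice.\<close>

lemma wdv_AE_eq:
  assumes "is_wdv U v \<alpha> g h" "mi_abs \<alpha> = 0 \<Longrightarrow> g = h"
  shows "AE x in lebesgue. x \<in> U \<longrightarrow> h x = wdv U v \<alpha> g x"
proof (cases "mi_abs \<alpha> = 0")
  case False
  have "is_wdv U v \<alpha> g (SOME h. is_wdv U v \<alpha> g h)" using assms(1) by (rule someI[where P = "is_wdv U v \<alpha> g"])
  then show ?thesis using is_wdv_unique[OF U \<eta> v v_nonzero assms(1)] False by (simp add: wdv_def)
qed (use assms in \<open>simp add: wdv_def\<close>)

section \<open>Membership in the spaces and convergence of the norm\<close>

lemma word_zero: "mi_abs \<alpha> = 0 \<Longrightarrow> word \<alpha> = []"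
  by (metis length_0_conv length_word)

lemma chi_f_in_W_std:
  assumes n: "1 \<le> n"
  shows "(\<lambda>x. chi \<eta> v n x * f x) \<in> W_std U m p"
  unfolding W_std_def mem_Collect_eq
  using Lp_H[OF n, of "[]"] Lp_H[OF n, of "word _"] is_weak_deriv_H[OF n] unfolding H_Nil[OF n]
  by (metis le0 length_word list.size(3))

lemma locint_chi_f:
  assumes n: "1 \<le> n"
  shows "locint U (\<lambda>x. chi \<eta> v n x * f x * \<bar>v x\<bar>)"
  using locint_mult_continuous[OF locint_H[OF n, of "[]"], of "\<lambda>x. \<bar>v x\<bar>"] Ck_on_cont[OF v]
  by (simp add: H_Nil[OF n] continuous_on_rabs)

lemma chi_f_in_W_sv:
  assumes n: "1 \<le> n"
  shows "(\<lambda>x. chi \<eta> v n x * f x) \<in> W_sv U m p s v"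
  unfolding W_sv_def W_Vv_def mem_Collect_eq
proof (intro conjI allI impI)
  show "Lp_w U p (V (\<lambda>_. 0)) (\<lambda>x. chi \<eta> v n x * f x)"
    using Lp_H_weighted[OF n, of "[]"] by (simp add: H_Nil[OF n])
  show "Lp_w_loc U 1 (V (\<lambda>_. 0)) (\<lambda>x. chi \<eta> v n x * f x)"
    unfolding Lp_w_loc_one_iff V_zero by (rule locint_chi_f[OF n])
next
  fix \<alpha> :: "'n mindex" assume a: "1 \<le> mi_abs \<alpha> \<and> mi_abs \<alpha> \<le> m"
  then have w: "is_wdv U v \<alpha> (\<lambda>x. chi \<eta> v n x * f x) (H n (word \<alpha>))" using is_wdv_H[OF n] by blast
  then show "\<exists>g. is_wdv U v \<alpha> (\<lambda>x. chi \<eta> v n x * f x) g" by blast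
  show "Lp_w U p (V \<alpha>) (wdv U v \<alpha> (\<lambda>x. chi \<eta> v n x * f x))"
    by (rule Lp_w_cong_AE[OF p0 _ wdv_AE_eq[OF w]]) (use Lp_H_weighted[OF n, of "word \<alpha>"] a in auto)
qed

text \<open>For positive order the derivative of a difference is chosen on its own and not as a
  difference of choices; it is identified through \<open>is_wdv_diff\<close> and uniqueness.\<close>

lemma wdv_chi_f_minus_f:
  assumes n: "1 \<le> n" and a: "mi_abs \<alpha> \<le> m"
  shows "AE x in lebesgue. x \<in> U \<longrightarrow>
    H n (word \<alpha>) x - G (word \<alpha>) x = wdv U v \<alpha> (\<lambda>x. chi \<eta> v n x * f x - f x) x"
proof (cases "mi_abs \<alpha> = 0")
  case True
  then show ?thesis by (simp add: wdv_def word_zero H_Nil[OF n])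
next
  case False
  have g: "is_wdv U v \<alpha> f (G (word \<alpha>))"
    using is_wdv_G[of "word \<alpha>"] a False by (metis length_word length_0_conv mi_word)
  have "is_wdv U v \<alpha> (\<lambda>x. chi \<eta> v n x * f x - f x) (\<lambda>x. H n (word \<alpha>) x - G (word \<alpha>) x)"
    by (rule is_wdv_diff[OF U Ck_on_mono[OF v a] locint_chi_f[OF n] f_loc is_wdv_H[OF n a] g])
  then show ?thesis by (rule wdv_AE_eq) (use False in simp)
qed

lemma Lp_w_pow_tendsto:
  assumes a: "mi_abs \<alpha> \<le> m"
  shows "(\<lambda>n. Lp_w_pow U p (V \<alpha>) (wdv U v \<alpha> (\<lambda>x. chi \<eta> v (Suc n) x * f x - f x))) \<longlonglongrightarrow> 0"
proof -
  let ?l = "word \<alpha>"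
  have l: "length ?l \<le> m" using a by simp
  obtain Q where Q: "Lp_w U p (\<lambda>_. 1) Q"
    "\<And>n x. 1 \<le> n \<Longrightarrow> x \<in> U \<Longrightarrow> \<bar>(H n ?l x - G ?l x) * V (mi ?l) x\<bar> \<le> \<bar>Q x\<bar>"
    "\<And>n x. 1 \<le> n \<Longrightarrow> x \<in> U \<Longrightarrow> x \<notin> Mset U v n \<Longrightarrow> (H n ?l x - G ?l x) * V (mi ?l) x = 0"
    by (rule H_minus_G_dominated[OF l]) (rule that; assumption)
  have "(\<lambda>n. Lp_w_pow U p (V \<alpha>) (\<lambda>x. H (Suc n) ?l x - G ?l x)) \<longlonglongrightarrow> 0"
  proof (rule Lp_w_pow_tendsto_zero[OF p0 Q(1)])
    show "set_borel_measurable lebesgue U (\<lambda>x. (H (Suc n) ?l x - G ?l x) * V \<alpha> x)" for n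
      using H_minus_G_measurable[of "Suc n" ?l] a by simp
    show "\<bar>(H (Suc n) ?l x - G ?l x) * V \<alpha> x\<bar> \<le> \<bar>Q x\<bar>" if "x \<in> U" for n x
      using Q(2)[of "Suc n" x] that by simp
    show "AE x in lebesgue. x \<in> U \<longrightarrow> (\<forall>\<^sub>F n in sequentially. (H (Suc n) ?l x - G ?l x) * V \<alpha> x = 0)"
      using v_nonzero
    proof eventually_elim
      case (elim x)
      show ?case
      proof
        assume x: "x \<in> U"
        then have vx: "\<bar>v x\<bar> > 0" using elim by simp
        \<comment> \<open>Once \<open>n > 1 / |v x|\<close> the point has left
          \<open>Mset U v n\<close>, and from then on the error is exactly zero.\<close>
        obtain N where N: "1 < real N * \<bar>v x\<bar>" using reals_Archimedean3[OF vx] by blast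
        have "x \<notin> Mset U v (Suc n)" if "n \<ge> N" for n
        proof -
          have "1 < real (Suc n) * \<bar>v x\<bar>"
            using N mult_right_mono[of "real N" "real (Suc n)" "\<bar>v x\<bar>"] that by simp
          then show ?thesis by (simp add: Mset_def field_simps)
        qed
        then have "(H (Suc n) ?l x - G ?l x) * V \<alpha> x = 0" if "n \<ge> N" for n
          using Q(3)[of "Suc n" x] x that by simp
        then show "\<forall>\<^sub>F n in sequentially. (H (Suc n) ?l x - G ?l x) * V \<alpha> x = 0"
          unfolding eventually_sequentially by blast
      qed
    qed
  qed
  moreover have "Lp_w_pow U p (V \<alpha>) (\<lambda>x. H (Suc n) ?l x - G ?l x)
    = Lp_w_pow U p (V \<alpha>) (wdv U v \<alpha> (\<lambda>x. chi \<eta> v (Suc n) x * f x - f x))" for n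
    by (rule Lp_w_pow_cong_AE[OF wdv_chi_f_minus_f]) (use a in auto)
  ultimately show ?thesis by simp
qed

lemma norm_tendsto: "(\<lambda>n. W_sv_norm U m p s v (\<lambda>x. chi \<eta> v n x * f x - f x)) \<longlonglongrightarrow> 0"
proof (rule LIMSEQ_imp_Suc)
  let ?S = "\<lambda>n. \<Sum>\<alpha>\<in>{\<alpha>. mi_abs \<alpha> \<le> m}. Lp_w_pow U p (V \<alpha>) (wdv U v \<alpha> (\<lambda>x. chi \<eta> v (Suc n) x * f x - f x))"
  have S: "?S \<longlonglongrightarrow> (\<Sum>\<alpha>\<in>{\<alpha> :: 'n mindex. mi_abs \<alpha> \<le> m}. 0)"
    by (rule tendsto_sum) (rule Lp_w_pow_tendsto, simp)
  have "(\<lambda>n. ?S n powr (1 / p)) \<longlonglongrightarrow> 0"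
  proof (rule tendsto_zero_powrI[where b = "1 / p"])
    show "\<forall>\<^sub>F n in sequentially. 0 \<le> ?S n"
      by (simp add: sum_nonneg Lp_w_pow_def)
  qed (use S p in auto)
  then show "(\<lambda>n. W_sv_norm U m p s v (\<lambda>x. chi \<eta> v (Suc n) x * f x - f x)) \<longlonglongrightarrow> 0"
    by (simp add: W_sv_norm_def W_Vv_norm_def)
qed

end

theorem theorem8:
  fixes \<Omega> :: "(real^'n::finite) set" and v :: "real^'n \<Rightarrow> real"
    and s :: "'n mindex \<Rightarrow> real" and \<eta> :: "real \<Rightarrow> real"
    and p :: real and m :: nat and f :: "real^'n \<Rightarrow> real"
  assumes "open \<Omega>" and "1 \<le> p"
    and "Ck_star_on m \<Omega> v" and "ess_bounded_on \<Omega> v"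
    and "admissible m s"
    and "cutoff_profile \<eta>"
    and "\<exists>C>0. \<forall>n::nat. n \<ge> 1 \<longrightarrow> (\<forall>\<sigma>. 1 \<le> mi_abs \<sigma> \<and> mi_abs \<sigma> \<le> m \<longrightarrow>
            (\<forall>x \<in> Mset \<Omega> v n - Mset \<Omega> v (2 * n).
               \<bar>mderiv \<sigma> v x\<bar> \<le> C * real n powr (s \<sigma> - 1)))"
    and "f \<in> W_sv \<Omega> m p s v"
  shows "(\<forall>n::nat. n \<ge> 1 \<longrightarrow> (\<lambda>x. chi \<eta> v n x * f x) \<in> W_std \<Omega> m p
                              \<and> (\<lambda>x. chi \<eta> v n x * f x) \<in> W_sv \<Omega> m p s v)
         \<and> (\<lambda>n. W_sv_norm \<Omega> m p s v (\<lambda>x. chi \<eta> v n x * f x - f x)) \<longlonglongrightarrow> 0"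
proof -
  obtain C where "C > 0" and C: "\<forall>n::nat. n \<ge> 1 \<longrightarrow> (\<forall>\<sigma>. 1 \<le> mi_abs \<sigma> \<and> mi_abs \<sigma> \<le> m \<longrightarrow>
      (\<forall>x \<in> Mset \<Omega> v n - Mset \<Omega> v (2 * n). \<bar>mderiv \<sigma> v x\<bar> \<le> C * real n powr (s \<sigma> - 1)))"
    using assms(7) by blast
  interpret cutoff_setting \<Omega> v s \<eta> p m f C
    by unfold_locales (use assms \<open>C > 0\<close> C in \<open>auto simp: Ck_star_on_def\<close>)
  show ?thesis using chi_f_in_W_std chi_f_in_W_sv norm_tendsto by blast
qed

end
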